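(* Assume that Assumptions 1 and 2 stated in the context hold, and let $L_0\in U_{ad}$. Then for any $\epsilon>0$, the model-based policy gradient update $$L_{k+1}=L_k-\eta\,\nabla C(L_k)$$ with a constant step size $0<\eta\le\eta^*$ converges globally to the optimal matrix $L^*$ at a linear rate: $$C(L_{k+1})-C(L^* )\le\Big(1-2\eta\,\frac{\mu^2\,\underline\sigma_R}{\|\Sigma_{L^*}\|}\Big)\big(C(L_k)-C(L^* )\big),$$ where $\eta^*=c\,(1+C(L_0))^{-5}$ for a suitable constant $c=c_{A,B,Q,R,\mu}>0$ depending only on the model parameters attached to $A,B,Q,R$ and on $\mu$. Moreover, if the number of iterations $k$ satisfies $$k\ \ge\ \frac{\|\Sigma_{L^*}\|}{2\eta\mu^2\underline\sigma_R}\,\log\frac{C(L_0)-C(L^* )}{\epsilon},$$ then the model-based policy gradient method enjoys the performance bound $$C(L_k)-C(L^* )<\epsilon .$$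
   Context: Discrete-time infinite-horizon linear quadratic problem with random parameters. The state $x_t\in\mathbb{R}^n$ and control $u_t\in\mathbb{R}^m$ satisfy $x_{t+1}=A_{t+1}x_t+B_{t+1}u_t$, $t=0,1,2,\dots$, with $x_0\in\mathbb{R}^n$ drawn from an initial distribution $\mathcal{D}$ with finite second moment; the cost is $\sum_{t\ge0}\big(x_t^\top Q_{t+1}x_t+u_t^\top R_{t+1}u_t\big)$. Write $\Lambda_t=[A_t,\ B_t]\in\mathbb{R}^{n\times(n+m)}$ and let $N_t$ be the block-diagonal matrix with diagonal blocks $Q_t$ ($n\times n$) and $R_t$ ($m\times m$); $N_t$ is symmetric positive semidefinite. The random matrices $[\Lambda_t^\top,N_t]$, $t\ge1$, are independent and identically distributed; $[\Lambda^\top,N]$ (with blocks $A,B,Q,R$) denotes an independent copy of $[\Lambda_1^\top,N_1]$. $\|\cdot\|$ is the Euclidean norm of vectors and the operator norm of matrices; $\sigma_{\min}$ is the smallest singular value. Admissible set: for $L\in\mathbb{R}^{m\times n}$ let $\mathcal{F}_L(X)=\mathbb{E}[(A-BL)X(A-BL)^\top]$, a linear map on real symmetric $n\times n$ matrices, and $U_{ad}=\{L\in\mathbb{R}^{m\times n}:\rho(\mathcal{F}_L)<1\}$, where $\rho$ is the spectral radius. $L\in U_{ad}$ is equivalent to the feedback $u_t=-Lx_t$ being mean-square stabilizing, i.e. $\mathbb{E}[x_t^\top x_t]\to0$. Assumption 1: $\mathbb{E}\|x_0\|^2$, $\mathbb{E}\|N\|$ and $\mathbb{E}\|\Lambda\|^2$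 are finite, $\mathbb{E}[N]$ is positive definite, and $(A,B)$ is mean-square stabilizable (there is a matrix $L$ for which $u_t=-Lx_t$ is mean-square stabilizing). Assumption 2: $\Sigma_0:=\mathbb{E}[x_0x_0^\top]$ is positive definite. For $L\in U_{ad}$, with $x_t$ the state under $u_t=-Lx_t$, i.e. $x_{t+1}=(A_{t+1}-B_{t+1}L)x_t$, put $C(L)=\mathbb{E}\big[\sum_{t\ge0}x_t^\top(Q_{t+1}+L^\top R_{t+1}L)x_t\big]$ and $\Sigma_L=\mathbb{E}\big[\sum_{t\ge0}x_tx_t^\top\big]$. $\nabla C(L)$ is the gradient of $C$ with respect to the matrix $L$. $L^*=\operatorname{argmin}_{L\in U_{ad}}C(L)$. $\mu=\sigma_{\min}(\Sigma_0)$ and $\underline\sigma_R=\sigma_{\min}(\mathbb{E}[R])$. The model parameters attached to $A,B,Q,R$ are quantities such as $\mathbb{E}\|A\|^2$, $\mathbb{E}\|B\|^2$, $\mathbb{E}\|Q\|$, $\mathbb{E}\|R\|$, $\sigma_{\min}(\mathbb{E}[Q])$, $\sigma_{\min}(\mathbb{E}[R])$, and their reciprocals.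
   Formalization: The final bound excludes the single case k = 0 with C(L_0) − C(L* ) = ε, where the stated condition reads 0 ≥ log 1 and the strict inequality fails; x_0 is taken independent of the random parameters, as implicit in being drawn from an initial distribution. *)

theory Defs
  imports "HOL-Probability.Probability"
begin

section \<open>Matrices and linear operators\<close>

definition outer_prod :: "real ^ 'n \<Rightarrow> real ^ 'n \<Rightarrow> real ^ 'n ^ 'n" where
  "outer_prod x y = (\<chi> i j. x $ i * y $ j)"

definition pos_semidef :: "real ^ 'n ^ 'n \<Rightarrow> bool" where
  "pos_semidef M \<longleftrightarrow> transpose M = M \<and> (\<forall>x. 0 \<le> x \<bullet> (M *v x))"

definition pos_def :: "real ^ 'n ^ 'n \<Rightarrow> bool" where
  "pos_def M \<longleftrightarrow> transpose M = M \<and> (\<forall>x. x \<noteq> 0 \<longrightarrow> 0 < x \<bullet> (M *v x))"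

text \<open>On \<open>real ^ 'n ^ 'm\<close> the library's \<^const>\<open>norm\<close> is the Frobenius norm, so the operator norm
  is taken from \<^const>\<open>onorm\<close>.\<close>

definition op_norm :: "real ^ 'n ^ 'm \<Rightarrow> real" where
  "op_norm M = onorm (\<lambda>x. M *v x)"

text \<open>Singular values are the nonnegative square roots of the eigenvalues of \<open>M\<^sup>T M\<close>.\<close>

definition singular_values :: "real ^ 'n ^ 'n \<Rightarrow> real set" where
  "singular_values M =
     {s. 0 \<le> s \<and> (\<exists>v. v \<noteq> 0 \<and> (transpose M ** M) *v v = s\<^sup>2 *\<^sub>R v)}"

definition sigma_min :: "real ^ 'n ^ 'n \<Rightarrow> real" where
  "sigma_min M = Inf (singular_values M)"

text \<open>The spectrum of a real-linear map \<open>F\<close> on a real subspace \<open>V\<close> is the set of eigenvalues of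
  its complexification: the two equations are the real and imaginary part of
  \<open>F (X + \<i> Y) = z (X + \<i> Y)\<close>.\<close>

definition spectrum_on :: "'v::real_vector set \<Rightarrow> ('v \<Rightarrow> 'v) \<Rightarrow> complex set" where
  "spectrum_on V F =
     {z. \<exists>X\<in>V. \<exists>Y\<in>V. (X \<noteq> 0 \<or> Y \<noteq> 0) \<and>
           F X = Re z *\<^sub>R X - Im z *\<^sub>R Y \<and> F Y = Im z *\<^sub>R X + Re z *\<^sub>R Y}"

definition spectral_radius_on :: "'v::real_vector set \<Rightarrow> ('v \<Rightarrow> 'v) \<Rightarrow> real" where
  "spectral_radius_on V F = Sup (cmod ` spectrum_on V F)"

text \<open>The inner product on \<open>real ^ 'n ^ 'm\<close> is the Frobenius inner product, so for such arguments
  this is the matrix of partial derivatives.\<close>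

definition grad :: "('a::real_inner \<Rightarrow> real) \<Rightarrow> 'a \<Rightarrow> 'a" where
  "grad f x = (THE D. GDERIV f x :> D)"

definition block_row :: "real ^ 'n ^ 'n \<Rightarrow> real ^ 'm ^ 'n \<Rightarrow> real ^ ('n + 'm) ^ 'n" where
  "block_row A B = (\<chi> i j. case j of Inl k \<Rightarrow> A $ i $ k | Inr k \<Rightarrow> B $ i $ k)"

definition block_diag ::
  "real ^ 'n ^ 'n \<Rightarrow> real ^ 'm ^ 'm \<Rightarrow> real ^ ('n + 'm) ^ ('n + 'm)" where
  "block_diag Q R = (\<chi> i j. case (i, j) of
       (Inl k, Inl l) \<Rightarrow> Q $ k $ l
     | (Inr k, Inr l) \<Rightarrow> R $ k $ l
     | _ \<Rightarrow> 0)"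


section \<open>The random-parameter linear quadratic problem\<close>

text \<open>The parameters \<open>A t, B t, Q t, R t\<close> are used for \<open>t \<ge> 1\<close> only; since they are identically
  distributed over \<open>t\<close>, the index \<open>1\<close> plays the role of the generic copy in expectations.\<close>

primrec closed_loop ::
  "(nat \<Rightarrow> 'w \<Rightarrow> real ^ 'n ^ 'n) \<Rightarrow> (nat \<Rightarrow> 'w \<Rightarrow> real ^ 'm ^ 'n) \<Rightarrow> real ^ 'n ^ 'm \<Rightarrow>
   ('w \<Rightarrow> real ^ 'n) \<Rightarrow> nat \<Rightarrow> 'w \<Rightarrow> real ^ 'n" where
  "closed_loop A B L x0 0 = x0"
| "closed_loop A B L x0 (Suc t) =
     (\<lambda>\<omega>. (A (Suc t) \<omega> - B (Suc t) \<omega> ** L) *v closed_loop A B L x0 t \<omega>)"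

definition F_op ::
  "'w measure \<Rightarrow> (nat \<Rightarrow> 'w \<Rightarrow> real ^ 'n ^ 'n) \<Rightarrow> (nat \<Rightarrow> 'w \<Rightarrow> real ^ 'm ^ 'n) \<Rightarrow>
   real ^ 'n ^ 'm \<Rightarrow> real ^ 'n ^ 'n \<Rightarrow> real ^ 'n ^ 'n" where
  "F_op M A B L X =
     (\<integral>\<omega>. (A 1 \<omega> - B 1 \<omega> ** L) ** X ** transpose (A 1 \<omega> - B 1 \<omega> ** L) \<partial>M)"

definition U_ad ::
  "'w measure \<Rightarrow> (nat \<Rightarrow> 'w \<Rightarrow> real ^ 'n ^ 'n) \<Rightarrow> (nat \<Rightarrow> 'w \<Rightarrow> real ^ 'm ^ 'n) \<Rightarrow>
   (real ^ 'n ^ 'm) set" where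
  "U_ad M A B = {L. spectral_radius_on {X. transpose X = X} (F_op M A B L) < 1}"

text \<open>Stabilization is a property of \<open>(A, B)\<close> and \<open>L\<close> alone: it is required from every
  deterministic initial state.\<close>

definition ms_stabilizing ::
  "'w measure \<Rightarrow> (nat \<Rightarrow> 'w \<Rightarrow> real ^ 'n ^ 'n) \<Rightarrow> (nat \<Rightarrow> 'w \<Rightarrow> real ^ 'm ^ 'n) \<Rightarrow>
   real ^ 'n ^ 'm \<Rightarrow> bool" where
  "ms_stabilizing M A B L \<longleftrightarrow>
     (\<forall>\<xi>. (\<lambda>t. \<integral>\<omega>. closed_loop A B L (\<lambda>_. \<xi>) t \<omega> \<bullet> closed_loop A B L (\<lambda>_. \<xi>) t \<omega> \<partial>M)
           \<longlonglongrightarrow> 0)"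

text \<open>\<open>cost\<close> and \<open>Sigma_L\<close> are meaningful for \<open>L\<close> in \<^const>\<open>U_ad\<close> only; elsewhere the series or the
  expectation may diverge and then has the library's default value.\<close>

definition cost ::
  "'w measure \<Rightarrow> (nat \<Rightarrow> 'w \<Rightarrow> real ^ 'n ^ 'n) \<Rightarrow> (nat \<Rightarrow> 'w \<Rightarrow> real ^ 'm ^ 'n) \<Rightarrow>
   (nat \<Rightarrow> 'w \<Rightarrow> real ^ 'n ^ 'n) \<Rightarrow> (nat \<Rightarrow> 'w \<Rightarrow> real ^ 'm ^ 'm) \<Rightarrow> ('w \<Rightarrow> real ^ 'n) \<Rightarrow>
   real ^ 'n ^ 'm \<Rightarrow> real" where
  "cost M A B Q R x0 L =
     (\<integral>\<omega>. (\<Sum>t. closed_loop A B L x0 t \<omega> \<bullet>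
              ((Q (Suc t) \<omega> + transpose L ** R (Suc t) \<omega> ** L) *v closed_loop A B L x0 t \<omega>)) \<partial>M)"

definition Sigma0 :: "'w measure \<Rightarrow> ('w \<Rightarrow> real ^ 'n) \<Rightarrow> real ^ 'n ^ 'n" where
  "Sigma0 M x0 = (\<integral>\<omega>. outer_prod (x0 \<omega>) (x0 \<omega>) \<partial>M)"

definition Sigma_L ::
  "'w measure \<Rightarrow> (nat \<Rightarrow> 'w \<Rightarrow> real ^ 'n ^ 'n) \<Rightarrow> (nat \<Rightarrow> 'w \<Rightarrow> real ^ 'm ^ 'n) \<Rightarrow>
   ('w \<Rightarrow> real ^ 'n) \<Rightarrow> real ^ 'n ^ 'm \<Rightarrow> real ^ 'n ^ 'n" where
  "Sigma_L M A B x0 L =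
     (\<integral>\<omega>. (\<Sum>t. outer_prod (closed_loop A B L x0 t \<omega>) (closed_loop A B L x0 t \<omega>)) \<partial>M)"

primrec policy_gradient ::
  "(real ^ 'n ^ 'm \<Rightarrow> real) \<Rightarrow> real \<Rightarrow> real ^ 'n ^ 'm \<Rightarrow> nat \<Rightarrow> real ^ 'n ^ 'm" where
  "policy_gradient C \<eta> L0 0 = L0"
| "policy_gradient C \<eta> L0 (Suc k) =
     policy_gradient C \<eta> L0 k - \<eta> *\<^sub>R grad C (policy_gradient C \<eta> L0 k)"

text \<open>\<open>init_indep\<close>: the initial state is independent of the whole parameter sequence. It uses
  \<open>indep_set\<close> on the generated sigma-algebras because \<open>indep_var\<close> needs both
  variables to have values in the same type.\<close>

locale lq_system = prob_space M
  for M :: "'w measure" +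
  fixes A :: "nat \<Rightarrow> 'w \<Rightarrow> real ^ 'n ^ 'n"
    and B :: "nat \<Rightarrow> 'w \<Rightarrow> real ^ 'm ^ 'n"
    and Q :: "nat \<Rightarrow> 'w \<Rightarrow> real ^ 'n ^ 'n"
    and R :: "nat \<Rightarrow> 'w \<Rightarrow> real ^ 'm ^ 'm"
    and x0 :: "'w \<Rightarrow> real ^ 'n"
  assumes params_indep:
      "indep_vars (\<lambda>_. borel)
         (\<lambda>t \<omega>. (block_row (A t \<omega>) (B t \<omega>), block_diag (Q t \<omega>) (R t \<omega>))) {1..}"
    and params_ident_distr:
      "\<And>t. 1 \<le> t \<Longrightarrow>
         distr M borel (\<lambda>\<omega>. (block_row (A t \<omega>) (B t \<omega>), block_diag (Q t \<omega>) (R t \<omega>))) =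
         distr M borel (\<lambda>\<omega>. (block_row (A 1 \<omega>) (B 1 \<omega>), block_diag (Q 1 \<omega>) (R 1 \<omega>)))"
    and init_measurable: "random_variable borel x0"
    and init_indep:
      "indep_set
         (sets (vimage_algebra (space M) x0 borel))
         (sets (vimage_algebra (space M)
            (\<lambda>\<omega>. \<lambda>t\<in>{1..}. (block_row (A t \<omega>) (B t \<omega>), block_diag (Q t \<omega>) (R t \<omega>)))
            (\<Pi>\<^sub>M t\<in>{1..}. borel)))"
    and weights_psd:
      "\<And>t. 1 \<le> t \<Longrightarrow> AE \<omega> in M. pos_semidef (block_diag (Q t \<omega>) (R t \<omega>))"

locale lq_problem = lq_system M A B Q R x0
  for M :: "'w measure"
    and A :: "nat \<Rightarrow> 'w \<Rightarrow> real ^ 'n ^ 'n"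
    and B :: "nat \<Rightarrow> 'w \<Rightarrow> real ^ 'm ^ 'n"
    and Q :: "nat \<Rightarrow> 'w \<Rightarrow> real ^ 'n ^ 'n"
    and R :: "nat \<Rightarrow> 'w \<Rightarrow> real ^ 'm ^ 'm"
    and x0 :: "'w \<Rightarrow> real ^ 'n" +
  assumes init_second_moment: "integrable M (\<lambda>\<omega>. (norm (x0 \<omega>))\<^sup>2)"
    and weights_integrable: "integrable M (\<lambda>\<omega>. op_norm (block_diag (Q 1 \<omega>) (R 1 \<omega>)))"
    and params_second_moment:
      "integrable M (\<lambda>\<omega>. (op_norm (block_row (A 1 \<omega>) (B 1 \<omega>)))\<^sup>2)"
    and weights_pos_def: "pos_def (\<integral>\<omega>. block_diag (Q 1 \<omega>) (R 1 \<omega>) \<partial>M)"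
    and stabilizable: "\<exists>L. ms_stabilizing M A B L"
    and Sigma0_pos_def: "pos_def (Sigma0 M x0)"

end

theory Submission
  imports Defs
begin

text \<open>For a stabilising gain the second moments of the state are the iterates of the positive operator
  \<open>F L\<close>, so the cost is \<open>J L = \<langle>K L, \<Sigma> L\<rangle> = \<langle>P L, \<Sigma>\<^sub>0\<rangle>\<close> with the solutions \<open>\<Sigma> L\<close> and \<open>P L\<close> of
  a Lyapunov equation and its adjoint. This gives the exact difference formula
  \<open>J (L + H) - J L = 2 \<langle>E L \<Sigma>', H\<rangle> + \<langle>G L H \<Sigma>', H\<rangle>\<close> with \<open>\<Sigma>' = \<Sigma> (L + H)\<close>. Completing the square in it
  yields gradient dominance. Replacing \<open>\<Sigma>'\<close> by \<open>\<Sigma> L\<close> costs at most a multiple of \<open>(1 + J L)\<^sup>5 \<parallel>H\<parallel>\<^sup>2\<close>,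
  which gives the gradient \<open>2 E L \<Sigma> L\<close> and the descent inequality with step size \<open>c (1 + J L)\<^sup>-\<^sup>5\<close>.
  Stability of the new iterate needs no continuity of the spectral radius: \<open>\<Sigma> L\<close> remains a Lyapunov
  matrix for nearby gains, and for positive operators the existence of a Lyapunov matrix is
  equivalent to spectral radius below one.\<close>

section \<open>Matrices\<close>

text \<open>All estimates are monomials in \<open>u L = 1 + J L\<close> and one constant
  \<open>k\<close> bounding the parameters. Both are at least 1, so lower-order terms can be
  absorbed into the leading one. The exponent five is a product: \<open>E L\<close> is of order
  \<open>u ^ 2\<close> and \<open>\<Sigma> (L + H) - \<Sigma> L\<close> of order
  \<open>u ^ 3 * norm H\<close>. The resulting remainder constant is \<open>340 * k ^ 10\<close>;
  the step size uses twice that, so that half of the first-order decrease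
  \<open>eta * (norm (D L)) ^ 2\<close> survives, and gradient dominance turns this half into the
  stated rate. The set of stabilising gains is open and the cost is uncontrolled outside it, so the
  existence of a minimiser is not automatic. It holds because the admissible perturbation radius
  depends on \<open>L\<close> only through \<open>u L\<close>: it is uniform on a sublevel set,
  whose limits therefore cannot leave the set. Randomness enters only through moments. Passing to
  them rests on the independence of the state at time \<open>t\<close> from the parameters at time
  \<open>t + 1\<close>.\<close>

lemma inner_matrix: "X \<bullet> Y = (\<Sum>i\<in>UNIV. \<Sum>j\<in>UNIV. X $ i $ j * Y $ i $ j)"
  for X Y :: "real ^ 'n ^ 'm"
  by (simp add: inner_vec_def)

lemma norm_matrix_power2: "(norm X)\<^sup>2 = (\<Sum>i\<in>UNIV. (norm (X $ i))\<^sup>2)"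
  for X :: "real ^ 'n ^ 'm"
  by (simp add: power2_norm_eq_inner inner_vec_def[of X])

lemma transpose_nth: "transpose X $ i $ j = X $ j $ i"
  by (simp add: transpose_def)

lemma inner_transpose: "transpose X \<bullet> transpose Y = X \<bullet> Y" for X Y :: "real ^ 'n ^ 'm"
  unfolding inner_matrix transpose_nth by (rule sum.swap)

lemma norm_transpose [simp]: "norm (transpose X) = norm X" for X :: "real ^ 'n ^ 'm"
  by (simp add: norm_eq_sqrt_inner inner_transpose)

lemma norm_matrix_vector_le: "norm (X *v v) \<le> norm X * norm v" for X :: "real ^ 'n ^ 'm"
proof (rule power2_le_imp_le)
  have "(norm (X *v v))\<^sup>2 = (\<Sum>i\<in>UNIV. (X $ i \<bullet> v)\<^sup>2)"
    unfolding power2_norm_eq_inner inner_vec_def[of "X *v v"]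
    by (simp add: matrix_vector_mul_component power2_eq_square)
  also have "\<dots> \<le> (\<Sum>i\<in>UNIV. (norm (X $ i) * norm v)\<^sup>2)"
    by (intro sum_mono) (metis Cauchy_Schwarz_ineq2 norm_ge_zero power2_abs power_mono abs_ge_zero)
  also have "\<dots> = (norm X * norm v)\<^sup>2"
    by (simp add: power_mult_distrib norm_matrix_power2 sum_distrib_right)
  finally show "(norm (X *v v))\<^sup>2 \<le> (norm X * norm v)\<^sup>2" .
qed simp

lemma matrix_mult_row: "(X ** Y) $ i = transpose Y *v (X $ i)"
  for X :: "real ^ 'k ^ 'm" and Y :: "real ^ 'n ^ 'k"
  by (simp add: vec_eq_iff matrix_matrix_mult_def vector_matrix_mult_def mult.commute)

lemma norm_matrix_mult_le: "norm (X ** Y) \<le> norm X * norm Y"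
  for X :: "real ^ 'k ^ 'm" and Y :: "real ^ 'n ^ 'k"
proof (rule power2_le_imp_le)
  have "(norm (X ** Y))\<^sup>2 = (\<Sum>i\<in>UNIV. (norm (transpose Y *v (X $ i)))\<^sup>2)"
    unfolding norm_matrix_power2 matrix_mult_row ..
  also have "\<dots> \<le> (\<Sum>i\<in>UNIV. (norm (transpose Y) * norm (X $ i))\<^sup>2)"
    by (intro sum_mono power_mono norm_matrix_vector_le) simp
  also have "\<dots> = (norm X * norm Y)\<^sup>2"
    by (simp add: power_mult_distrib norm_matrix_power2[of X] sum_distrib_left mult.commute)
  finally show "(norm (X ** Y))\<^sup>2 \<le> (norm X * norm Y)\<^sup>2" .
qed simp

lemma bounded_bilinear_matrix_mult:
  "bounded_bilinear (\<lambda>(X :: real ^ 'k ^ 'm) (Y :: real ^ 'n ^ 'k). X ** Y)"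
proof
  show "\<exists>K. \<forall>(X :: real ^ 'k ^ 'm) (Y :: real ^ 'n ^ 'k). norm (X ** Y) \<le> norm X * norm Y * K"
    by (rule exI[of _ 1]) (simp add: norm_matrix_mult_le)
qed (simp_all add: vec_eq_iff matrix_matrix_mult_def sum.distrib sum_distrib_left algebra_simps)

lemmas matrix_mult_algebra =
  bounded_bilinear.add_left[OF bounded_bilinear_matrix_mult]
  bounded_bilinear.add_right[OF bounded_bilinear_matrix_mult]
  bounded_bilinear.diff_left[OF bounded_bilinear_matrix_mult]
  bounded_bilinear.diff_right[OF bounded_bilinear_matrix_mult]
  bounded_bilinear.minus_left[OF bounded_bilinear_matrix_mult]
  bounded_bilinear.minus_right[OF bounded_bilinear_matrix_mult]
  bounded_bilinear.scaleR_left[OF bounded_bilinear_matrix_mult]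
  bounded_bilinear.scaleR_right[OF bounded_bilinear_matrix_mult]

lemma bounded_linear_transpose: "bounded_linear (transpose :: real ^ 'n ^ 'm \<Rightarrow> _)"
  by (rule bounded_linear_intro[where K = 1])
     (simp_all, simp_all add: transpose_def vec_eq_iff)

lemmas transpose_algebra =
  linear_add[OF bounded_linear.linear[OF bounded_linear_transpose]]
  linear_diff[OF bounded_linear.linear[OF bounded_linear_transpose]]
  linear_neg[OF bounded_linear.linear[OF bounded_linear_transpose]]
  linear_scale[OF bounded_linear.linear[OF bounded_linear_transpose]]

lemma trace_eq_inner: "trace X = mat 1 \<bullet> X" for X :: "real ^ 'n ^ 'n"
  by (simp add: trace_def inner_matrix mat_def if_distrib[of "\<lambda>x. x * _"] cong: if_cong)

text \<open>Left multiplication by \<open>X\<close> has the adjoint \<open>transpose X\<close>.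
  Together with its mirror image \<open>inner_mult_right\<close> this does the work of the cyclic
  invariance of the trace.\<close>

lemma inner_mult_left: "(X ** Y) \<bullet> Z = Y \<bullet> (transpose X ** Z)"
  for X :: "real ^ 'k ^ 'm" and Y :: "real ^ 'n ^ 'k"
proof -
  have "(X ** Y) \<bullet> Z = (\<Sum>i\<in>UNIV. \<Sum>j\<in>UNIV. \<Sum>k\<in>UNIV. X $ i $ k * Y $ k $ j * Z $ i $ j)"
    by (simp add: inner_matrix matrix_matrix_mult_def sum_distrib_right)
  also have "\<dots> = (\<Sum>i\<in>UNIV. \<Sum>k\<in>UNIV. \<Sum>j\<in>UNIV. X $ i $ k * Y $ k $ j * Z $ i $ j)"
    by (intro sum.cong refl sum.swap)
  also have "\<dots> = (\<Sum>k\<in>UNIV. \<Sum>i\<in>UNIV. \<Sum>j\<in>UNIV. X $ i $ k * Y $ k $ j * Z $ i $ j)"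
    by (rule sum.swap)
  also have "\<dots> = (\<Sum>k\<in>UNIV. \<Sum>j\<in>UNIV. \<Sum>i\<in>UNIV. X $ i $ k * Y $ k $ j * Z $ i $ j)"
    by (intro sum.cong refl sum.swap)
  also have "\<dots> = Y \<bullet> (transpose X ** Z)"
    by (simp add: inner_matrix matrix_matrix_mult_def sum_distrib_left transpose_nth mult_ac)
  finally show ?thesis .
qed

lemma inner_mult_right: "(X ** Y) \<bullet> Z = X \<bullet> (Z ** transpose Y)"
  for X :: "real ^ 'k ^ 'm" and Y :: "real ^ 'n ^ 'k"
  using inner_mult_left[of "transpose Y" "transpose X" "transpose Z"]
    inner_transpose[of "X ** Y" Z] inner_transpose[of X "Z ** transpose Y"]
  by (simp add: matrix_transpose_mul)

text \<open>Makes a quadratic form linear in \<open>outer_prod x x\<close>, so that expected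
  quadratic costs depend only on second-moment matrices.\<close>

lemma inner_outer_prod: "X \<bullet> outer_prod x y = x \<bullet> (X *v y)" for X :: "real ^ 'n ^ 'n"
  by (simp add: inner_matrix outer_prod_def inner_vec_def[of x] matrix_vector_mult_def
      sum_distrib_left mult_ac)

lemma norm_outer_prod: "norm (outer_prod x y) = norm x * norm y"
proof -
  have "(norm (outer_prod x y))\<^sup>2 = (norm x * norm y)\<^sup>2"
    unfolding norm_matrix_power2 power_mult_distrib power2_norm_eq_inner
    by (simp add: inner_vec_def outer_prod_def sum_product power2_eq_square mult_ac)
  then show ?thesis by simp
qed

text \<open>One step of the closed loop acts on second moments as a congruence; this is where the
  form of \<open>F_op\<close> comes from.\<close>

lemma outer_prod_matrix_vector:
  "outer_prod (X *v x) (X *v x) = X ** outer_prod x x ** transpose X"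
proof -
  have "(\<Sum>k\<in>UNIV. \<Sum>l\<in>UNIV. X $ i $ k * x $ k * (X $ j $ l * x $ l)) =
      (\<Sum>l\<in>UNIV. \<Sum>k\<in>UNIV. X $ i $ k * (x $ k * x $ l) * X $ j $ l)" for i j
    by (subst sum.swap) (simp add: mult_ac)
  then show ?thesis
    by (simp add: vec_eq_iff outer_prod_def matrix_vector_mult_def matrix_matrix_mult_def
        transpose_nth sum_product sum_distrib_right sum_distrib_left mult_ac)
qed

section \<open>The cone of positive semidefinite matrices\<close>

lemma pos_semidef_sym: "pos_semidef X \<Longrightarrow> transpose X = X"
  and pos_semidef_ge: "pos_semidef X \<Longrightarrow> 0 \<le> x \<bullet> (X *v x)"
  by (auto simp: pos_semidef_def)

lemma matrix_vector_algebra: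
  fixes X Y :: "real ^ 'n ^ 'm"
  shows "(X + Y) *v v = X *v v + Y *v v" "(X - Y) *v v = X *v v - Y *v v"
    "(c *\<^sub>R X) *v v = c *\<^sub>R (X *v v)"
  by (simp_all add: matrix_vector_mult_add_rdistrib matrix_vector_mult_diff_rdistrib
      scaleR_matrix_vector_assoc)

lemma pos_semidef_0 [simp]: "pos_semidef 0"
  by (simp add: pos_semidef_def transpose_def vec_eq_iff)

lemma pos_semidef_mat_1 [simp]: "pos_semidef (mat 1)"
  by (simp add: pos_semidef_def)

lemma pos_semidef_add: "pos_semidef X \<Longrightarrow> pos_semidef Y \<Longrightarrow> pos_semidef (X + Y)"
  by (auto simp: pos_semidef_def transpose_algebra matrix_vector_algebra inner_add_right)

lemma pos_semidef_scaleR: "pos_semidef X \<Longrightarrow> 0 \<le> c \<Longrightarrow> pos_semidef (c *\<^sub>R X)"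
  by (auto simp: pos_semidef_def transpose_algebra matrix_vector_algebra)

lemma pos_semidef_sum: "(\<And>i. i \<in> I \<Longrightarrow> pos_semidef (f i)) \<Longrightarrow> pos_semidef (sum f I)"
  by (induction I rule: infinite_finite_induct) (auto intro: pos_semidef_add)

lemma pos_semidef_trans:
  "pos_semidef (X - Y) \<Longrightarrow> pos_semidef (Y - Z) \<Longrightarrow> pos_semidef (X - Z)"
  using pos_semidef_add[of "X - Y" "Y - Z"] by simp

lemma pos_semidef_outer_prod [simp]: "pos_semidef (outer_prod x x)"
proof -
  have "y \<bullet> (outer_prod x x *v y) = (x \<bullet> y)\<^sup>2" for y
    by (simp add: inner_vec_def outer_prod_def matrix_vector_mult_def power2_eq_square
        sum_distrib_left sum_distrib_right mult_ac)
  then show ?thesis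
    by (simp add: pos_semidef_def outer_prod_def transpose_def vec_eq_iff mult.commute)
qed

lemma pos_semidef_congruence:
  assumes "pos_semidef X"
  shows "pos_semidef (Z ** X ** transpose Z)"
proof -
  have "y \<bullet> ((Z ** X ** transpose Z) *v y) = (transpose Z *v y) \<bullet> (X *v (transpose Z *v y))" for y
    by (simp add: dot_lmul_matrix flip: matrix_vector_mul_assoc)
  then show ?thesis using assms
    by (simp add: pos_semidef_def matrix_transpose_mul matrix_mul_assoc del: transpose_matrix_vector)
qed

lemma pos_semidef_congruence':
  "pos_semidef X \<Longrightarrow> pos_semidef (transpose Z ** X ** Z)"
  using pos_semidef_congruence[of X "transpose Z"] by simp

lemma closed_pos_semidef: "closed {X :: real ^ 'n ^ 'n. pos_semidef X}"
proof -
  have "{X :: real ^ 'n ^ 'n. pos_semidef X} =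
      {X. transpose X = X} \<inter> (\<Inter>x. {X. 0 \<le> X \<bullet> outer_prod x x})"
    by (auto simp: pos_semidef_def inner_outer_prod)
  moreover have "closed {X :: real ^ 'n ^ 'n. transpose X = X}"
    by (intro closed_Collect_eq linear_continuous_on bounded_linear_transpose continuous_on_id)
  moreover have "closed {X :: real ^ 'n ^ 'n. 0 \<le> X \<bullet> outer_prod x x}" for x
    by (intro closed_Collect_le continuous_intros)
  ultimately show ?thesis by (simp add: closed_Int closed_INT)
qed

lemma pos_semidef_limit:
  "(\<And>k. pos_semidef (f k)) \<Longrightarrow> f \<longlonglongrightarrow> X \<Longrightarrow> pos_semidef X"
  using closed_sequentially[OF closed_pos_semidef, of f X] by auto

lemma sym_bilinear:
  fixes X :: "real ^ 'n ^ 'n"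
  assumes "transpose X = X"
  shows "x \<bullet> (X *v y) = y \<bullet> (X *v x)"
proof -
  have "x \<bullet> (X *v y) = (transpose X *v x) \<bullet> y" by (simp add: dot_lmul_matrix)
  then show ?thesis using assms by (simp add: inner_commute)
qed

lemma matrix_vector_axis: "X *v axis i 1 = column i X" for X :: "real ^ 'n ^ 'm"
  by (simp add: vec_eq_iff matrix_vector_mult_def axis_def column_def
      if_distrib[of "\<lambda>x. _ * x"] cong: if_cong)

lemma axis_inner_axis: "axis i 1 \<bullet> (X *v axis j 1) = X $ i $ j" for X :: "real ^ 'n ^ 'm"
  by (simp add: matrix_vector_axis inner_axis' column_def)

lemma pos_semidef_diag: "pos_semidef X \<Longrightarrow> 0 \<le> X $ i $ i"
  using pos_semidef_ge[of X "axis i 1"] by (simp add: axis_inner_axis)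

text \<open>The form restricted to the span of \<open>x\<close> and \<open>y\<close> is a
  nonnegative binary quadratic form. It may be degenerate, so a vanishing leading coefficient is
  treated separately.\<close>

lemma pos_semidef_Cauchy_Schwarz:
  assumes "pos_semidef X"
  shows "(x \<bullet> (X *v y))\<^sup>2 \<le> (x \<bullet> (X *v x)) * (y \<bullet> (X *v y))"
proof -
  let ?a = "x \<bullet> (X *v x)" and ?b = "x \<bullet> (X *v y)" and ?c = "y \<bullet> (X *v y)"
  have sym: "y \<bullet> (X *v x) = ?b"
    by (rule sym_bilinear[OF pos_semidef_sym[OF assms]])
  have pos: "0 \<le> s\<^sup>2 * ?a + 2 * (s * t) * ?b + t\<^sup>2 * ?c" for s t
    using pos_semidef_ge[OF assms, of "s *\<^sub>R x + t *\<^sub>R y"] sym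
    by (simp add: matrix_vector_right_distrib matrix_vector_mult_scaleR inner_add_left
        inner_add_right power2_eq_square algebra_simps)
  have a: "0 \<le> ?a" and c: "0 \<le> ?c" by (auto intro: pos_semidef_ge assms)
  show ?thesis
  proof (cases "?a = 0")
    case True
    have "?b = 0"
    proof (rule ccontr)
      assume "?b \<noteq> 0"
      \<comment> \<open>With \<open>?a = 0\<close> this choice gives the form the value
        \<open>- (?c + 1) + ?c = - 1\<close>.\<close>
      then show False using pos[of "- (?c + 1) / (2 * ?b)" 1] True by (simp add: field_simps)
    qed
    then show ?thesis using a c by simp
  next
    case False
    have "0 \<le> ?a * (?a * ?c - ?b\<^sup>2)"
      \<comment> \<open>Here the form evaluates to \<open>?a\<close> times the discriminant
        expression, which avoids a division.\<close>
      using pos[of "- ?b" ?a] by (simp add: power2_eq_square algebra_simps)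
    then have "0 \<le> ?a * ?c - ?b\<^sup>2" using False a by (simp add: zero_le_mult_iff)
    then show ?thesis by simp
  qed
qed

lemma trace_nonneg: "pos_semidef X \<Longrightarrow> 0 \<le> trace X"
  by (simp add: trace_def sum_nonneg pos_semidef_diag)

text \<open>Each entry satisfies \<open>(X $ i $ j) ^ 2 \<le> X $ i $ i * X $ j $ j\<close>. The
  trace is linear and monotone in the semidefinite order, so bounds on the cone are proved for
  traces and passed to norms here.\<close>

lemma norm_le_trace:
  assumes "pos_semidef X"
  shows "norm X \<le> trace X"
proof (rule power2_le_imp_le)
  have "(norm X)\<^sup>2 = (\<Sum>i\<in>UNIV. \<Sum>j\<in>UNIV. (X $ i $ j)\<^sup>2)"
    unfolding power2_norm_eq_inner inner_matrix by (simp add: power2_eq_square)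
  also have "\<dots> \<le> (\<Sum>i\<in>UNIV. \<Sum>j\<in>UNIV. X $ i $ i * X $ j $ j)"
    using pos_semidef_Cauchy_Schwarz[OF assms, of "axis i 1" "axis j 1" for i j]
    by (intro sum_mono) (simp add: axis_inner_axis)
  also have "\<dots> = (trace X)\<^sup>2"
    by (simp add: trace_def power2_eq_square sum_product)
  finally show "(norm X)\<^sup>2 \<le> (trace X)\<^sup>2" .
qed (rule trace_nonneg[OF assms])

lemma pos_semidef_norm_minus:
  fixes X :: "real ^ 'n ^ 'n"
  assumes "transpose X = X" "norm X \<le> c"
  shows "pos_semidef (c *\<^sub>R mat 1 - X)" "pos_semidef (c *\<^sub>R mat 1 + X)"
proof -
  have "\<bar>x \<bullet> (X *v x)\<bar> \<le> c * (x \<bullet> x)" for x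
  proof -
    have "\<bar>x \<bullet> (X *v x)\<bar> \<le> norm x * (norm X * norm x)"
      by (rule order_trans[OF Cauchy_Schwarz_ineq2]) (intro mult_left_mono norm_matrix_vector_le, simp)
    also have "\<dots> = norm X * (x \<bullet> x)" by (simp add: power2_norm_eq_inner[symmetric] power2_eq_square)
    also have "\<dots> \<le> c * (x \<bullet> x)" by (intro mult_right_mono assms) simp
    finally show ?thesis .
  qed
  then have "x \<bullet> (X *v x) \<le> c * (x \<bullet> x)" "0 \<le> c * (x \<bullet> x) + x \<bullet> (X *v x)" for x
    unfolding abs_le_iff by (metis, metis add.commute diff_ge_0_iff_ge diff_minus_eq_add minus_le_iff)
  then show "pos_semidef (c *\<^sub>R mat 1 - X)" "pos_semidef (c *\<^sub>R mat 1 + X)"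
    using assms(1)
    by (simp_all add: pos_semidef_def transpose_algebra matrix_vector_algebra inner_diff_right
        inner_add_right)
qed

text \<open>Self-duality of the cone is proved by Cholesky elimination: subtracting the rank one matrix
  built from a column with positive diagonal entry keeps the matrix in the cone and clears that
  column.\<close>

lemma inner_pos_semidef_nonneg:
  fixes X Y :: "real ^ 'n ^ 'n"
  assumes "pos_semidef X" "pos_semidef Y"
  shows "0 \<le> X \<bullet> Y"
  using assms(2)
proof (induction "card {i. Y $ i $ i \<noteq> 0}" arbitrary: Y rule: less_induct)
  case (less Y)
  show ?case
  proof (cases "\<exists>i. Y $ i $ i \<noteq> 0")
    case False
    then have "trace Y = 0" by (simp add: trace_def)
    then have "Y = 0" using norm_le_trace[OF less.prems] by simp
    then show ?thesis by simp
  next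
    case True
    then obtain i where "Y $ i $ i \<noteq> 0" by blast
    with pos_semidef_diag[OF less.prems, of i] have d: "0 < Y $ i $ i" by simp
    define v where "v = column i Y"
    define Y' where "Y' = Y - (1 / Y $ i $ i) *\<^sub>R outer_prod v v"
    have sym: "Y $ j $ k = Y $ k $ j" for j k
      using pos_semidef_sym[OF less.prems] by (metis transpose_nth)
    have "0 \<le> x \<bullet> (Y' *v x)" for x
    proof -
      have "x \<bullet> (outer_prod v v *v x) = (v \<bullet> x)\<^sup>2"
        by (simp add: inner_vec_def outer_prod_def matrix_vector_mult_def power2_eq_square
            sum_distrib_left sum_distrib_right mult_ac)
      also have "v \<bullet> x = x \<bullet> (Y *v axis i 1)"
        by (simp add: v_def matrix_vector_axis inner_commute)
      also have "\<dots>\<^sup>2 \<le> (x \<bullet> (Y *v x)) * Y $ i $ i"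
        using pos_semidef_Cauchy_Schwarz[OF less.prems, of x "axis i 1"] by (simp add: axis_inner_axis)
      finally show ?thesis using d
        by (simp add: Y'_def matrix_vector_algebra inner_diff_right field_simps)
    qed
    moreover have "transpose Y' = Y'"
      using pos_semidef_sym[OF less.prems] pos_semidef_sym[OF pos_semidef_outer_prod, of v]
      by (simp add: Y'_def transpose_algebra)
    ultimately have psd: "pos_semidef Y'" by (simp add: pos_semidef_def)
    have "Y' $ j $ j = Y $ j $ j - (Y $ i $ j)\<^sup>2 / Y $ i $ i" for j
      by (simp add: Y'_def outer_prod_def v_def column_def power2_eq_square sym)
    then have diag: "Y' $ i $ i = 0" and "Y $ j $ j = 0 \<Longrightarrow> Y' $ j $ j \<le> 0" for j
      using d by (auto simp: power2_eq_square)
    then have "Y $ j $ j = 0 \<Longrightarrow> Y' $ j $ j = 0" for j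
      using pos_semidef_diag[OF psd, of j] by (simp add: antisym)
    then have "{j. Y' $ j $ j \<noteq> 0} \<subset> {j. Y $ j $ j \<noteq> 0}"
      using diag d by force
    then have "0 \<le> X \<bullet> Y'"
      by (intro less.hyps psd psubset_card_mono) simp_all
    moreover have "0 \<le> X \<bullet> outer_prod v v"
      by (simp add: inner_outer_prod pos_semidef_ge[OF assms(1)])
    moreover have "X \<bullet> Y = X \<bullet> Y' + (1 / Y $ i $ i) * (X \<bullet> outer_prod v v)"
      by (simp add: Y'_def inner_diff_right)
    ultimately show ?thesis using d by simp
  qed
qed

lemma pos_semidef_of_ge:
  assumes "0 < c" "pos_semidef (X - c *\<^sub>R mat 1)"
  shows "pos_semidef X"
  using pos_semidef_add[OF assms(2) pos_semidef_scaleR[OF pos_semidef_mat_1, of c]] assms(1) by simp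

text \<open>Self-duality of the cone applied to \<open>X - a *\<^sub>R mat 1\<close>. It extracts
  trace bounds from the cost, once with \<open>K L\<close> and once with \<open>S0\<close> as the
  bounded matrix.\<close>

lemma inner_ge_trace:
  assumes "pos_semidef (X - a *\<^sub>R mat 1)" "pos_semidef Y"
  shows "a * trace Y \<le> X \<bullet> Y"
  using inner_pos_semidef_nonneg[OF assms] by (simp add: inner_diff_left trace_eq_inner)

lemma inner_le_trace:
  assumes "pos_semidef (a *\<^sub>R mat 1 - X)" "pos_semidef Y"
  shows "X \<bullet> Y \<le> a * trace Y"
  using inner_pos_semidef_nonneg[OF assms] by (simp add: inner_diff_left trace_eq_inner)

lemma trace_mono: "pos_semidef (X - Y) \<Longrightarrow> trace Y \<le> trace X"
  using trace_nonneg[of "X - Y"] by (simp add: trace_eq_inner inner_diff_right)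

text \<open>Norm control for an indefinite \<open>X\<close> squeezed between \<open>- Y\<close> and
  \<open>Y\<close>. The factor 3 counts two traces from \<open>Y + X\<close>, since
  \<open>trace X \<le> trace Y\<close>, and one from \<open>Y\<close>.\<close>

lemma norm_sandwich:
  assumes "pos_semidef (Y - X)" "pos_semidef (Y + X)"
  shows "norm X \<le> 3 * trace Y"
proof -
  have "pos_semidef (2 *\<^sub>R Y)" using pos_semidef_add[OF assms] by (simp add: scaleR_2)
  then have Y: "pos_semidef Y" using pos_semidef_scaleR[of "2 *\<^sub>R Y" "1/2"] by simp
  have "norm X \<le> norm (Y + X) + norm Y"
    using norm_triangle_ineq4[of "Y + X" Y] by simp
  also have "\<dots> \<le> trace (Y + X) + trace Y"
    by (intro add_mono norm_le_trace assms Y)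
  also have "trace (Y + X) \<le> 2 * trace Y"
    using trace_mono[of Y X] assms by (simp add: trace_eq_inner inner_add_right)
  finally show ?thesis by simp
qed

text \<open>Row by row, \<open>Y \<ge> a\<close> gives \<open>a * norm x \<le> norm (Y *v x)\<close>
  by Cauchy-Schwarz. It is used to strip the factor \<open>\<Sigma> L\<close> off the
  gradient.\<close>

lemma norm_mult_ge:
  fixes X :: "real ^ 'n ^ 'm"
  assumes "pos_semidef (Y - a *\<^sub>R mat 1)" "0 \<le> a"
  shows "a * norm X \<le> norm (X ** Y)"
proof (rule power2_le_imp_le)
  have Y: "pos_semidef Y" using pos_semidef_add[OF assms(1) pos_semidef_scaleR[OF pos_semidef_mat_1 assms(2)]]
    by simp
  have row: "a * norm x \<le> norm (Y *v x)" for x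
  proof (cases "x = 0")
    case False
    have "a * (norm x)\<^sup>2 \<le> x \<bullet> (Y *v x)"
      using pos_semidef_ge[OF assms(1), of x]
      by (simp add: matrix_vector_algebra inner_diff_right power2_norm_eq_inner)
    also have "\<dots> \<le> norm x * norm (Y *v x)" by (rule norm_cauchy_schwarz)
    finally show ?thesis using False by (simp add: power2_eq_square)
  qed simp
  have "(a * norm X)\<^sup>2 = (\<Sum>i\<in>UNIV. (a * norm (X $ i))\<^sup>2)"
    by (simp add: power_mult_distrib norm_matrix_power2 sum_distrib_left)
  also have "\<dots> \<le> (\<Sum>i\<in>UNIV. (norm (transpose Y *v (X $ i)))\<^sup>2)"
    using assms(2) unfolding pos_semidef_sym[OF Y] by (intro sum_mono power_mono row) auto
  also have "\<dots> = (norm (X ** Y))\<^sup>2" unfolding norm_matrix_power2 matrix_mult_row ..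
  finally show "(a * norm X)\<^sup>2 \<le> (norm (X ** Y))\<^sup>2" .
qed simp

section \<open>Operator norm and smallest singular value\<close>

lemma bounded_linear_matrix_vector: "bounded_linear (\<lambda>x. X *v x)" for X :: "real ^ 'n ^ 'm"
  by (simp add: linear_linear)

lemma op_norm_le_norm: "op_norm X \<le> norm X" for X :: "real ^ 'n ^ 'm"
  unfolding op_norm_def by (rule onorm_bound) (auto simp: norm_matrix_vector_le)

lemma op_norm_nonneg: "0 \<le> op_norm X" for X :: "real ^ 'n ^ 'm"
  unfolding op_norm_def by (rule onorm_pos_le[OF bounded_linear_matrix_vector])

lemma norm_matrix_vector_le_op_norm: "norm (X *v v) \<le> op_norm X * norm v" for X :: "real ^ 'n ^ 'm"
  unfolding op_norm_def by (rule onorm[OF bounded_linear_matrix_vector])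

text \<open>Every entry is bounded by the operator norm. The crude dimension factor is affordable
  because the final constant may depend on the dimensions.\<close>

lemma norm_le_op_norm: "norm X \<le> real CARD('m) * real CARD('n) * op_norm X"
  for X :: "real ^ 'n ^ 'm"
proof -
  have "norm X \<le> (\<Sum>i\<in>UNIV. norm (X $ i))" by (simp add: norm_vec_def L2_set_le_sum)
  also have "\<dots> \<le> (\<Sum>i\<in>(UNIV :: 'm set). \<Sum>j\<in>(UNIV :: 'n set). op_norm X)"
  proof (intro sum_mono)
    fix i
    have "norm (X $ i) \<le> (\<Sum>j\<in>UNIV. \<bar>X $ i $ j\<bar>)" by (rule norm_le_l1_cart)
    also have "\<dots> \<le> (\<Sum>j\<in>(UNIV :: 'n set). op_norm X)"
      unfolding op_norm_def by (rule sum_mono) (rule matrix_component_le_onorm)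
    finally show "norm (X $ i) \<le> (\<Sum>j\<in>(UNIV :: 'n set). op_norm X)" .
  qed
  finally show ?thesis by simp
qed

text \<open>By the triangle inequality \<open>op_norm\<close> is 1-Lipschitz for the Frobenius norm;
  the continuity supplies measurability of random operator norms.\<close>

lemma continuous_on_op_norm: "continuous_on UNIV (op_norm :: real ^ 'n ^ 'm \<Rightarrow> real)"
proof -
  have le: "op_norm X \<le> op_norm Y + norm (X - Y)" for X Y :: "real ^ 'n ^ 'm"
  proof -
    have "op_norm X = onorm (\<lambda>x. Y *v x + (X - Y) *v x)"
      by (simp add: op_norm_def flip: matrix_vector_mult_add_rdistrib)
    also have "\<dots> \<le> op_norm Y + op_norm (X - Y)"
      unfolding op_norm_def by (intro onorm_triangle bounded_linear_matrix_vector)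
    finally show ?thesis using op_norm_le_norm[of "X - Y"] by simp
  qed
  have "\<bar>op_norm X - op_norm Y\<bar> \<le> norm (X - Y)" for X Y :: "real ^ 'n ^ 'm"
    using le[of X Y] le[of Y X] by (simp add: norm_minus_commute abs_le_iff)
  then show ?thesis
    by (intro continuous_on_iff[THEN iffD2]) (auto simp: dist_norm intro: le_less_trans)
qed

lemma pos_semidef_op_norm_minus:
  assumes "pos_semidef X"
  shows "pos_semidef (op_norm X *\<^sub>R mat 1 - X)"
proof -
  have "x \<bullet> (X *v x) \<le> op_norm X * (x \<bullet> x)" for x
  proof -
    have "x \<bullet> (X *v x) \<le> norm x * (op_norm X * norm x)"
      by (rule order_trans[OF norm_cauchy_schwarz])
         (intro mult_left_mono norm_matrix_vector_le_op_norm, simp)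
    also have "\<dots> = op_norm X * (x \<bullet> x)" by (simp add: power2_norm_eq_inner[symmetric] power2_eq_square)
    finally show ?thesis .
  qed
  then show ?thesis
    by (auto simp: pos_semidef_def transpose_algebra matrix_vector_algebra inner_diff_right
        pos_semidef_sym[OF assms])
qed

lemma op_norm_ge:
  assumes "pos_semidef (X - a *\<^sub>R mat 1)"
  shows "a \<le> op_norm X"
proof -
  obtain x :: "real ^ 'a" where x: "norm x = 1" using vector_choose_size[of 1] by auto
  have "a \<le> x \<bullet> (X *v x)"
    using pos_semidef_ge[OF assms, of x] x
    by (simp add: matrix_vector_algebra inner_diff_right flip: power2_norm_eq_inner)
  also have "\<dots> \<le> norm x * norm (X *v x)" by (rule norm_cauchy_schwarz)
  also have "\<dots> \<le> op_norm X" using norm_matrix_vector_le_op_norm[of X x] x by simp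
  finally show ?thesis .
qed

text \<open>A minimiser of the Rayleigh quotient on the unit sphere is an eigenvector, because adding any
  multiple of another vector cannot lower the form below its minimum.\<close>

lemma pos_def_sigma_min:
  fixes X :: "real ^ 'n ^ 'n"
  assumes "pos_def X"
  shows "0 < sigma_min X" "pos_semidef (X - sigma_min X *\<^sub>R mat 1)"
proof -
  have sym: "transpose X = X" and pos: "\<And>x. x \<noteq> 0 \<Longrightarrow> 0 < x \<bullet> (X *v x)"
    using assms by (auto simp: pos_def_def)
  have "continuous_on (sphere 0 1) (\<lambda>x. x \<bullet> (X *v x))"
    by (intro continuous_intros linear_continuous_on bounded_linear_matrix_vector)
  moreover have "(sphere 0 1 :: (real ^ 'n) set) \<noteq> {}" by simp
  ultimately obtain v where v: "v \<in> sphere 0 1"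
    and min: "\<And>x. x \<in> sphere 0 1 \<Longrightarrow> v \<bullet> (X *v v) \<le> x \<bullet> (X *v x)"
    using continuous_attains_inf[OF compact_sphere, of 0 1 "\<lambda>x. x \<bullet> (X *v x)"] by blast
  define l where "l = v \<bullet> (X *v v)"
  have v0: "v \<noteq> 0" and vv: "v \<bullet> v = 1" using v by (auto simp: dot_square_norm)
  have l0: "0 < l" using pos[OF v0] by (simp add: l_def)
  have form: "l * (x \<bullet> x) \<le> x \<bullet> (X *v x)" for x
  proof (cases "x = 0")
    case False
    then have "l \<le> ((1 / norm x) *\<^sub>R x) \<bullet> (X *v ((1 / norm x) *\<^sub>R x))"
      unfolding l_def by (intro min) simp
    also have "\<dots> = (x \<bullet> (X *v x)) / (norm x)\<^sup>2"
      unfolding matrix_vector_mult_scaleR by (simp add: power2_eq_square)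
    finally show ?thesis using False by (simp add: pos_le_divide_eq power2_norm_eq_inner[of x])
  qed simp
  have psd: "pos_semidef (X - l *\<^sub>R mat 1)"
    using form sym
    by (simp add: pos_semidef_def transpose_algebra matrix_vector_algebra inner_diff_right)
  have "y \<bullet> ((X - l *\<^sub>R mat 1) *v v) = 0" for y
  proof -
    have "v \<bullet> ((X - l *\<^sub>R mat 1) *v v) = 0"
      by (simp add: matrix_vector_algebra inner_diff_right l_def vv)
    then show ?thesis using pos_semidef_Cauchy_Schwarz[OF psd, of y v] by simp
  qed
  from this[of "(X - l *\<^sub>R mat 1) *v v"] have eig: "X *v v = l *\<^sub>R v"
    by (simp only: inner_eq_zero_iff) (simp add: matrix_vector_algebra)
  have "(transpose X ** X) *v v = l\<^sup>2 *\<^sub>R v"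
    unfolding matrix_vector_mul_assoc[symmetric] sym
    by (simp add: eig matrix_vector_mult_scaleR power2_eq_square)
  then have l: "l \<in> singular_values X" using l0 v0 by (auto simp: singular_values_def)
  \<comment> \<open>An eigenvector \<open>w\<close> of \<open>transpose X ** X\<close> for
    \<open>s ^ 2\<close> satisfies \<open>norm (X *v w) = s * norm w\<close>, while
    \<open>X \<ge> l\<close> forces this norm to be at least \<open>l * norm w\<close>.\<close>
  have ge: "l \<le> s" if s: "s \<in> singular_values X" for s
  proof -
    from s obtain w where s0: "0 \<le> s" and w0: "w \<noteq> 0" and w: "(transpose X ** X) *v w = s\<^sup>2 *\<^sub>R w"
      by (auto simp: singular_values_def)
    have "w \<bullet> ((transpose X ** X) *v w) = (X *v w) \<bullet> (X *v w)"
      unfolding sym matrix_vector_mul_assoc[symmetric] by (rule sym_bilinear[OF sym])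
    then have "(norm (X *v w))\<^sup>2 = (s * norm w)\<^sup>2"
      by (simp add: w power_mult_distrib power2_norm_eq_inner)
    then have n: "norm (X *v w) = s * norm w" using s0 by simp
    have "l * (norm w)\<^sup>2 \<le> norm w * norm (X *v w)"
      using form[of w] norm_cauchy_schwarz[of w "X *v w"] by (simp add: power2_norm_eq_inner)
    then show ?thesis using w0 unfolding n by (simp add: power2_eq_square)
  qed
  have "sigma_min X = l" unfolding sigma_min_def
    by (rule cInf_eq_minimum[OF l ge])
  then show "0 < sigma_min X" "pos_semidef (X - sigma_min X *\<^sub>R mat 1)" using l0 psd by auto
qed

section \<open>Positive operators on matrices\<close>

definition pos_operator :: "(real ^ 'n ^ 'n \<Rightarrow> real ^ 'n ^ 'n) \<Rightarrow> bool" where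
  "pos_operator F \<longleftrightarrow> linear F \<and> (\<forall>X. pos_semidef X \<longrightarrow> pos_semidef (F X))"

text \<open>The discrete Lyapunov inequality in the semidefinite order. Scaling \<open>X\<close>
  turns any strictly positive lower bound on \<open>X - F X\<close> into the identity, so the
  normalisation loses nothing.\<close>

definition stable_operator :: "(real ^ 'n ^ 'n \<Rightarrow> real ^ 'n ^ 'n) \<Rightarrow> bool" where
  "stable_operator F \<longleftrightarrow> (\<exists>X. pos_semidef X \<and> pos_semidef (X - F X - mat 1))"

lemma pos_operator_linear: "pos_operator F \<Longrightarrow> linear F"
  and pos_operator_pos: "pos_operator F \<Longrightarrow> pos_semidef X \<Longrightarrow> pos_semidef (F X)"
  by (auto simp: pos_operator_def)

lemma pos_operator_mono:
  assumes "pos_operator F" "pos_semidef (X - Y)"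
  shows "pos_semidef (F X - F Y)"
  using pos_operator_pos[OF assms] linear_diff[OF pos_operator_linear[OF assms(1)]] by metis

text \<open>A symmetric \<open>X\<close> is the difference of the semidefinite matrices
  \<open>norm X *\<^sub>R mat 1\<close> and \<open>norm X *\<^sub>R mat 1 - X\<close>, whose images
  are symmetric.\<close>

lemma pos_operator_sym:
  assumes F: "pos_operator F" and X: "transpose X = X"
  shows "transpose (F X) = F X"
proof -
  have "pos_semidef (F (norm X *\<^sub>R mat 1) - F X)"
    by (intro pos_operator_mono[OF F] pos_semidef_norm_minus X order_refl)
  moreover have "pos_semidef (F (norm X *\<^sub>R mat 1))"
    by (intro pos_operator_pos[OF F] pos_semidef_scaleR) simp_all
  ultimately show ?thesis
    by (metis (no_types, lifting) pos_semidef_sym transpose_algebra(2) diff_diff_eq2 add_diff_cancel_left')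
qed

lemma pos_operator_funpow:
  assumes F: "pos_operator F"
  shows "pos_operator (F ^^ k)"
proof (induction k)
  case 0
  then show ?case by (simp add: pos_operator_def linear_id flip: id_def)
next
  case (Suc k)
  then show ?case using F linear_compose[of "F ^^ k" F] by (simp add: pos_operator_def comp_def)
qed

lemma trace_mat_1: "trace (mat 1 :: real ^ 'n ^ 'n) = real CARD('n)"
  by (simp add: trace_def mat_def)

lemma trace_scaleR: "trace (c *\<^sub>R X) = c * trace X" and trace_add: "trace (X + Y) = trace X + trace Y"
  for X Y :: "real ^ 'n ^ 'n"
  by (simp_all add: trace_eq_inner inner_add_right)

lemma continuous_on_trace: "continuous_on S (trace :: real ^ 'n ^ 'n \<Rightarrow> real)"
  unfolding trace_eq_inner[abs_def] by (intro continuous_intros)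

text \<open>Brouwer's theorem, applied to \<open>X \<mapsto> F X + e I\<close> normalised to trace one, gives fixed points
  with factors \<open>l\<close>. A factor \<open>l < 1\<close> makes \<open>X / e\<close> a Lyapunov matrix; otherwise, letting
  \<open>e\<close> tend to \<open>0\<close>, an eigenvalue at least \<open>1\<close> remains.\<close>

lemma pos_operator_eigenvalue:
  fixes F :: "real ^ 'n ^ 'n \<Rightarrow> real ^ 'n ^ 'n"
  assumes F: "pos_operator F"
  shows "\<exists>X l. pos_semidef X \<and> trace X = 1 \<and> 0 \<le> l \<and> F X = l *\<^sub>R X \<and> (1 \<le> l \<or> stable_operator F)"
proof -
  define K where "K = {X :: real ^ 'n ^ 'n. pos_semidef X \<and> trace X = 1}"
  have lin: "linear F" by (rule pos_operator_linear[OF F])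
  have cont: "continuous_on S F" for S
    using lin by (simp add: linear_continuous_on linear_linear)
  have K_eq: "K = {X. pos_semidef X} \<inter> {X. trace X = 1}" by (auto simp: K_def)
  have "closed {X :: real ^ 'n ^ 'n. trace X = 1}"
    by (intro closed_Collect_eq continuous_on_trace continuous_intros)
  then have "closed K" unfolding K_eq by (intro closed_Int closed_pos_semidef)
  moreover have "bounded K"
    unfolding bounded_iff by (rule exI[of _ 1]) (metis (mono_tags) K_def mem_Collect_eq norm_le_trace)
  ultimately have compact: "compact K" by (simp add: compact_eq_bounded_closed)
  have convex: "convex K"
    unfolding convex_def K_def
    by (auto intro!: pos_semidef_add pos_semidef_scaleR simp: trace_add trace_scaleR)
  have "(1 / real CARD('n)) *\<^sub>R mat 1 \<in> K"
    by (simp add: K_def trace_scaleR trace_mat_1 pos_semidef_scaleR)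
  then have nonempty: "K \<noteq> {}" by auto
  have ex: "\<exists>X\<in>K. F X + e *\<^sub>R mat 1 = trace (F X + e *\<^sub>R mat 1) *\<^sub>R X" if e: "0 < e" for e
  proof -
    define T where "T X = F X + e *\<^sub>R mat 1" for X
    have T_psd: "pos_semidef (T X)" if "X \<in> K" for X
      using that e by (auto simp: T_def K_def intro!: pos_semidef_add pos_semidef_scaleR pos_operator_pos[OF F])
    have T_pos: "0 < trace (T X)" if "X \<in> K" for X
      using that e trace_nonneg[OF pos_operator_pos[OF F, of X]]
      by (simp add: T_def K_def trace_add trace_scaleR trace_mat_1 add_nonneg_pos)
    have contT: "continuous_on K T" unfolding T_def by (intro continuous_intros cont)
    have "continuous_on K (\<lambda>X. trace (T X))"
      by (rule continuous_on_compose2[OF continuous_on_trace[of UNIV] contT]) simp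
    then have "continuous_on K (\<lambda>X. (1 / trace (T X)) *\<^sub>R T X)"
      using T_pos by (intro continuous_on_scaleR continuous_on_divide continuous_on_const contT)
        (auto dest!: T_pos)
    moreover have "(\<lambda>X. (1 / trace (T X)) *\<^sub>R T X) \<in> K \<rightarrow> K"
    proof
      fix X assume X: "X \<in> K"
      show "(1 / trace (T X)) *\<^sub>R T X \<in> K"
        using T_pos[OF X] T_psd[OF X] by (simp add: K_def trace_scaleR pos_semidef_scaleR)
    qed
    ultimately obtain X where X: "X \<in> K" "(1 / trace (T X)) *\<^sub>R T X = X"
      by (rule brouwer[OF compact convex nonempty])
    have "trace (T X) *\<^sub>R ((1 / trace (T X)) *\<^sub>R T X) = T X" using T_pos[OF X(1)] by simp
    then have "T X = trace (T X) *\<^sub>R X" unfolding X(2) by (rule sym)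
    then show ?thesis unfolding T_def using X(1) by (rule bexI)
  qed
  define e where "e k = inverse (real (Suc k))" for k
  have e_pos: "0 < e k" for k by (simp add: e_def)
  have "\<forall>k. \<exists>X. X \<in> K \<and> F X + e k *\<^sub>R mat 1 = trace (F X + e k *\<^sub>R mat 1) *\<^sub>R X"
    using ex[OF e_pos] by blast
  from choice[OF this] obtain X where
    "\<forall>k. X k \<in> K \<and> F (X k) + e k *\<^sub>R mat 1 = trace (F (X k) + e k *\<^sub>R mat 1) *\<^sub>R X k" ..
  then have X: "X k \<in> K"
    and eq: "F (X k) + e k *\<^sub>R mat 1 = trace (F (X k) + e k *\<^sub>R mat 1) *\<^sub>R X k" for k by blast+
  obtain Y r where Y: "Y \<in> K" and r: "strict_mono r" and lim: "(X \<circ> r) \<longlonglongrightarrow> Y"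
    using compact X unfolding compact_def by blast
  define l where "l k = trace (F (X k) + e k *\<^sub>R mat 1)" for k
  have e_lim: "(\<lambda>k. e (r k)) \<longlonglongrightarrow> 0"
    using LIMSEQ_subseq_LIMSEQ[OF LIMSEQ_inverse_real_of_nat r] by (simp add: e_def comp_def)
  have X_lim: "(\<lambda>k. X (r k)) \<longlonglongrightarrow> Y" using lim by (simp add: comp_def)
  have "(\<lambda>k. F (X (r k))) \<longlonglongrightarrow> F Y"
    by (rule continuous_on_tendsto_compose[OF cont[of UNIV] X_lim]) auto
  then have FX_lim: "(\<lambda>k. F (X (r k)) + e (r k) *\<^sub>R mat 1) \<longlonglongrightarrow> F Y"
    using tendsto_add[of "\<lambda>k. F (X (r k))" "F Y" sequentially, OF _ tendsto_scaleR[OF e_lim tendsto_const[of "mat 1"]]]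
    by simp
  have l_lim: "(\<lambda>k. l (r k)) \<longlonglongrightarrow> trace (F Y)"
    unfolding l_def by (rule continuous_on_tendsto_compose[OF continuous_on_trace[of UNIV] FX_lim]) auto
  have "F (X k) + e k *\<^sub>R mat 1 = l k *\<^sub>R X k" for k unfolding l_def by (rule eq)
  then have "(\<lambda>k. F (X (r k)) + e (r k) *\<^sub>R mat 1) \<longlonglongrightarrow> trace (F Y) *\<^sub>R Y"
    using tendsto_scaleR[OF l_lim X_lim] by presburger
  then have FY: "F Y = trace (F Y) *\<^sub>R Y" using LIMSEQ_unique FX_lim by blast
  have "1 \<le> trace (F Y)" if "\<not> stable_operator F"
  proof (rule LIMSEQ_le_const[OF l_lim], intro exI allI impI)
    fix k
    show "1 \<le> l (r k)"
    proof (rule ccontr)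
      assume "\<not> 1 \<le> l (r k)"
      let ?Z = "(1 / e (r k)) *\<^sub>R X (r k)"
      have "F (X (r k)) = l (r k) *\<^sub>R X (r k) - e (r k) *\<^sub>R mat 1"
        using eq[of "r k"] unfolding l_def by (metis add_diff_cancel_right')
      then have "F ?Z = (l (r k) / e (r k)) *\<^sub>R X (r k) - mat 1"
        using e_pos[of "r k"] by (simp add: linear_scale[OF lin] scaleR_diff_right)
      then have "?Z - F ?Z - mat 1 = ((1 - l (r k)) / e (r k)) *\<^sub>R X (r k)"
        by (simp add: diff_divide_distrib scaleR_diff_left)
      moreover have "pos_semidef \<dots>"
        using \<open>\<not> 1 \<le> l (r k)\<close> X[of "r k"] e_pos[of "r k"] by (intro pos_semidef_scaleR) (auto simp: K_def)
      moreover have "pos_semidef ?Z"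
        using X[of "r k"] e_pos[of "r k"] by (intro pos_semidef_scaleR) (auto simp: K_def less_imp_le)
      ultimately show False using that unfolding stable_operator_def by metis
    qed
  qed
  moreover have "0 \<le> trace (F Y)" using Y by (intro trace_nonneg pos_operator_pos[OF F]) (simp add: K_def)
  ultimately show ?thesis using Y FY unfolding K_def by blast
qed

text \<open>A Lyapunov matrix satisfies \<open>1 \<le> X \<le> t\<close>, hence
  \<open>F X \<le> X - 1 \<le> (1 - 1 / t) X\<close> and the iterates of \<open>X\<close> decay
  geometrically. Since \<open>norm Y *\<^sub>R X\<close> dominates both \<open>Y\<close> and
  \<open>- Y\<close>, the iterates of every symmetric \<open>Y\<close> decay with them.\<close>

lemma stable_operator_funpow_bound:
  assumes F: "pos_operator F" and stable: "stable_operator F"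
  obtains c g where "0 < g" "g < 1" "0 \<le> c"
    "\<And>k Y. transpose Y = Y \<Longrightarrow> norm ((F ^^ k) Y) \<le> c * g ^ k * norm Y"
proof -
  obtain X where X: "pos_semidef X" and lyap: "pos_semidef (X - F X - mat 1)"
    using stable unfolding stable_operator_def by blast
  \<comment> \<open>The summand \<open>norm X\<close> gives \<open>X \<le> t\<close>, and the 2
    keeps the ratio \<open>g\<close> strictly between 0 and 1.\<close>
  define t where "t = 2 + norm X"
  define g where "g = 1 - 1 / t"
  have t: "2 \<le> t" by (simp add: t_def)
  have g: "0 < g" "g < 1" using t by (auto simp: g_def field_simps)
  have FX: "pos_semidef (X - F X)" using pos_semidef_add[OF lyap pos_semidef_mat_1] by simp
  have XI: "pos_semidef (X - mat 1)"
    using pos_semidef_add[OF lyap pos_operator_pos[OF F X]] by (simp add: algebra_simps)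
  have "pos_semidef (t *\<^sub>R mat 1 - X)"
    by (rule pos_semidef_norm_minus[OF pos_semidef_sym[OF X]]) (simp add: t_def)
  then have "pos_semidef ((1 / t) *\<^sub>R (t *\<^sub>R mat 1 - X))" using t by (intro pos_semidef_scaleR) auto
  then have "pos_semidef (mat 1 - (1 / t) *\<^sub>R X)" using t by (simp add: scaleR_diff_right)
  from pos_semidef_add[OF lyap this] have contr: "pos_semidef (g *\<^sub>R X - F X)"
    by (simp add: g_def algebra_simps)
  have pow: "pos_semidef (g ^ k *\<^sub>R X - (F ^^ k) X)" for k
  proof (induction k)
    case 0
    then show ?case by simp
  next
    case (Suc k)
    have "pos_semidef (F (g ^ k *\<^sub>R X) - (F ^^ Suc k) X)" using pos_operator_mono[OF F Suc] by simp
    moreover have "pos_semidef (g ^ k *\<^sub>R (g *\<^sub>R X - F X))" using g contr by (intro pos_semidef_scaleR) auto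
    ultimately show ?case
      using pos_semidef_trans[of "g ^ Suc k *\<^sub>R X" "F (g ^ k *\<^sub>R X)"]
      by (simp add: linear_scale[OF pos_operator_linear[OF F]] scaleR_diff_right mult.commute)
  qed
  show ?thesis
  proof
    show "0 < g" "g < 1" by fact+
    show "0 \<le> 3 * trace X" using trace_nonneg[OF X] by simp
    fix k and Y :: "real ^ 'a ^ 'a" assume Y: "transpose Y = Y"
    note Fk = pos_operator_funpow[OF F, of k] and lin = pos_operator_linear[OF pos_operator_funpow[OF F, of k]]
    have "pos_semidef (norm Y *\<^sub>R (X - mat 1))" by (intro pos_semidef_scaleR XI) simp
    then have "pos_semidef (norm Y *\<^sub>R (X - mat 1) + (norm Y *\<^sub>R mat 1 - Y))"
      "pos_semidef (norm Y *\<^sub>R (X - mat 1) + (norm Y *\<^sub>R mat 1 + Y))"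
      by (auto intro!: pos_semidef_add pos_semidef_norm_minus[OF Y])
    then have "pos_semidef (norm Y *\<^sub>R X - Y)" "pos_semidef (norm Y *\<^sub>R X + Y)"
      by (simp_all add: algebra_simps)
    from this[THEN pos_operator_pos[OF Fk]]
    have "norm ((F ^^ k) Y) \<le> 3 * trace (norm Y *\<^sub>R (F ^^ k) X)"
      by (intro norm_sandwich) (simp_all add: linear_add[OF lin] linear_diff[OF lin] linear_scale[OF lin])
    also have "\<dots> = 3 * norm Y * trace ((F ^^ k) X)" by (simp add: trace_scaleR)
    also have "\<dots> \<le> 3 * norm Y * (g ^ k * trace X)"
      using trace_mono[OF pow[of k]] by (intro mult_left_mono) (simp_all add: trace_scaleR)
    finally show "norm ((F ^^ k) Y) \<le> 3 * trace X * g ^ k * norm Y" by (simp add: mult_ac)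
  qed
qed

lemma spectrum_on_funpow:
  assumes lin: "linear F" and X: "F X = Re z *\<^sub>R X - Im z *\<^sub>R Y" and Y: "F Y = Im z *\<^sub>R X + Re z *\<^sub>R Y"
  shows "(F ^^ k) X = Re (z ^ k) *\<^sub>R X - Im (z ^ k) *\<^sub>R Y \<and> (F ^^ k) Y = Im (z ^ k) *\<^sub>R X + Re (z ^ k) *\<^sub>R Y"
proof (induction k)
  case (Suc k)
  then show ?case
    by (simp add: linear_add[OF lin] linear_diff[OF lin] linear_scale[OF lin] X Y)
       (simp add: algebra_simps)
qed simp

text \<open>Real form of \<open>|z (X + i Y)| = |z| |X + i Y|\<close> in the complexified
  space.\<close>

lemma rotation_norm_power2:
  fixes X Y :: "'a::real_inner"
  shows "(norm (Re z *\<^sub>R X - Im z *\<^sub>R Y))\<^sup>2 + (norm (Im z *\<^sub>R X + Re z *\<^sub>R Y))\<^sup>2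
      = (cmod z)\<^sup>2 * ((norm X)\<^sup>2 + (norm Y)\<^sup>2)"
  unfolding cmod_power2 unfolding power2_norm_eq_inner
  by (simp add: inner_diff_left inner_diff_right inner_add_left inner_add_right inner_commute[of Y X])
     (simp add: power2_eq_square algebra_simps)

text \<open>On the two parts of a complex eigenvector, \<open>F ^^ k\<close> acts as multiplication
  by \<open>z ^ k\<close>, so it scales the sum of their squared norms by exactly
  \<open>(cmod z) ^ (2 * k)\<close>.\<close>

lemma spectrum_on_cmod_bound:
  fixes F :: "real ^ 'n ^ 'n \<Rightarrow> real ^ 'n ^ 'n"
  assumes lin: "linear F" and z: "z \<in> spectrum_on V F"
    and bound: "\<And>Y. Y \<in> V \<Longrightarrow> norm ((F ^^ k) Y) \<le> c * norm Y" and c: "0 \<le> c"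
  shows "cmod z ^ k \<le> c"
proof -
  from z obtain X Y where XY: "X \<in> V" "Y \<in> V" "X \<noteq> 0 \<or> Y \<noteq> 0"
    and eq: "F X = Re z *\<^sub>R X - Im z *\<^sub>R Y" "F Y = Im z *\<^sub>R X + Re z *\<^sub>R Y"
    unfolding spectrum_on_def by blast
  have "(cmod (z ^ k))\<^sup>2 * ((norm X)\<^sup>2 + (norm Y)\<^sup>2) = (norm ((F ^^ k) X))\<^sup>2 + (norm ((F ^^ k) Y))\<^sup>2"
    using spectrum_on_funpow[OF lin eq, of k] rotation_norm_power2[of "z ^ k" X Y] by simp
  also have "\<dots> \<le> (c * norm X)\<^sup>2 + (c * norm Y)\<^sup>2"
    using XY by (intro add_mono power_mono bound) auto
  also have "\<dots> = c\<^sup>2 * ((norm X)\<^sup>2 + (norm Y)\<^sup>2)" by (simp add: power_mult_distrib algebra_simps)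
  finally have "(cmod (z ^ k))\<^sup>2 \<le> c\<^sup>2"
    using XY(3) by (simp add: mult_le_cancel_right sum_power2_gt_zero_iff not_less sum_power2_le_zero_iff)
  then have "cmod (z ^ k) \<le> c" using c by (rule power2_le_imp_le)
  then show ?thesis by (simp add: norm_power)
qed

text \<open>The real eigenvalue \<open>l\<close> serves both directions: if it is at least 1 it
  contradicts a small radius, and otherwise a Lyapunov matrix is already at hand. It also shows that
  the spectrum is nonempty, so that its supremum is meaningful.\<close>

lemma spectral_radius_less_1_iff:
  fixes F :: "real ^ 'n ^ 'n \<Rightarrow> real ^ 'n ^ 'n"
  assumes F: "pos_operator F"
  shows "spectral_radius_on {X. transpose X = X} F < 1 \<longleftrightarrow> stable_operator F"
proof
  have lin: "linear F" by (rule pos_operator_linear[OF F])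
  obtain X l where X: "pos_semidef X" "trace X = 1" "0 \<le> l" "F X = l *\<^sub>R X"
    and l: "1 \<le> l \<or> stable_operator F"
    using pos_operator_eigenvalue[OF F] by blast
  have "X \<noteq> 0" using X(2) by (auto simp: trace_def)
  then have spec: "complex_of_real l \<in> spectrum_on {X. transpose X = X} F"
    unfolding spectrum_on_def mem_Collect_eq
    using X pos_semidef_sym[OF pos_semidef_0]
    by (intro bexI[of _ X] bexI[of _ 0]) (auto simp: linear_0[OF lin] pos_semidef_sym)
  {
    assume sr: "spectral_radius_on {X. transpose X = X} F < 1"
    \<comment> \<open>\<open>Sup\<close> dominates the modulus of \<open>l\<close> only if the
      spectrum is bounded above; the operator bound of \<open>F\<close> provides this.\<close>
    have "bounded_linear F" using lin by (simp add: linear_linear)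
    then obtain c where c: "0 \<le> c" "\<And>Y. norm (F Y) \<le> norm Y * c"
      using bounded_linear.nonneg_bounded by blast
    have "cmod z \<le> c" if "z \<in> spectrum_on {X. transpose X = X} F" for z
      using spectrum_on_cmod_bound[OF lin that, of 1 c] c by (simp add: mult.commute)
    then have "bdd_above (cmod ` spectrum_on {X. transpose X = X} F)" by (intro bdd_aboveI2)
    then have "cmod (complex_of_real l) \<le> spectral_radius_on {X. transpose X = X} F"
      unfolding spectral_radius_on_def by (intro cSup_upper imageI spec)
    then show "stable_operator F" using sr l X(3) by simp
  }
  {
    assume stable: "stable_operator F"
    obtain c g where g: "0 < g" "g < 1" and c: "0 \<le> c"
      and bound: "\<And>k Y. transpose Y = Y \<Longrightarrow> norm ((F ^^ k) Y) \<le> c * g ^ k * norm Y"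
      using stable_operator_funpow_bound[OF F stable] by metis
    \<comment> \<open>If \<open>cmod z > g\<close>, the powers of \<open>cmod z / g\<close> would
      eventually exceed the fixed constant \<open>c\<close>.\<close>
    have "cmod z \<le> g" if z: "z \<in> spectrum_on {X. transpose X = X} F" for z
    proof (rule ccontr)
      assume "\<not> cmod z \<le> g"
      then have "1 < cmod z / g" using g by simp
      then obtain k where "c < (cmod z / g) ^ k" using real_arch_pow by blast
      moreover have "cmod z ^ k \<le> c * g ^ k"
        using spectrum_on_cmod_bound[OF lin z, of k "c * g ^ k"] bound c g by simp
      ultimately show False using g by (simp add: power_divide pos_less_divide_eq)
    qed
    then have "spectral_radius_on {X. transpose X = X} F \<le> g"
      unfolding spectral_radius_on_def using spec by (intro cSup_least) auto
    then show "spectral_radius_on {X. transpose X = X} F < 1" using g by simp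
  }
qed

section \<open>Neumann series of Lyapunov equations and the comparison principle\<close>

definition resolvent :: "(real ^ 'n ^ 'n \<Rightarrow> real ^ 'n ^ 'n) \<Rightarrow> real ^ 'n ^ 'n \<Rightarrow> real ^ 'n ^ 'n" where
  "resolvent F Y = (\<Sum>k. (F ^^ k) Y)"

lemma stable_operator_summable:
  assumes F: "pos_operator F" and stable: "stable_operator F" and Y: "transpose Y = Y"
  shows "summable (\<lambda>k. norm ((F ^^ k) Y))"
proof -
  obtain c g where g: "0 < g" "g < 1"
    and bound: "\<And>k Y. transpose Y = Y \<Longrightarrow> norm ((F ^^ k) Y) \<le> c * g ^ k * norm Y"
    using stable_operator_funpow_bound[OF F stable] by metis
  have "summable (\<lambda>k. c * g ^ k * norm Y)"
    using g by (intro summable_mult summable_mult2 summable_geometric) simp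
  then show ?thesis by (rule summable_comparison_test'[where N = 0]) (simp add: bound[OF Y])
qed

text \<open>Shifting the series by one index. The assumption is convergence instead of stability
  because for the adjoint operator \<open>F' L\<close> convergence is obtained by duality with
  \<open>F L\<close>.\<close>

lemma resolvent_eq_summable:
  assumes F: "linear F" and sum: "summable (\<lambda>k. norm ((F ^^ k) Y))"
  shows "resolvent F Y = F (resolvent F Y) + Y"
proof -
  have s: "summable (\<lambda>k. (F ^^ k) Y)" by (rule summable_norm_cancel[OF sum])
  have bl: "bounded_linear F" using F by (simp add: linear_linear)
  have "resolvent F Y = (\<Sum>k. (F ^^ Suc k) Y) + Y"
    using suminf_split_head[OF s] by (simp add: resolvent_def)
  also have "(\<Sum>k. (F ^^ Suc k) Y) = F (resolvent F Y)"
    using bounded_linear.suminf[OF bl s] by (simp add: resolvent_def)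
  finally show ?thesis .
qed

lemma resolvent_psd_summable:
  assumes F: "pos_operator F" and sum: "summable (\<lambda>k. norm ((F ^^ k) Y))" and Y: "pos_semidef Y"
  shows "pos_semidef (resolvent F Y)"
  using summable_LIMSEQ[OF summable_norm_cancel[OF sum]] unfolding resolvent_def
  by (rule pos_semidef_limit[rotated])
     (intro pos_semidef_sum pos_operator_pos[OF pos_operator_funpow[OF F] Y])

lemmas resolvent_eq =
  resolvent_eq_summable[OF pos_operator_linear stable_operator_summable]
lemmas resolvent_psd = resolvent_psd_summable[OF _ stable_operator_summable]

lemma resolvent_ge:
  assumes F: "pos_operator F" "stable_operator F" and Y: "pos_semidef Y"
  shows "pos_semidef (resolvent F Y - Y)"
proof -
  note sym = pos_semidef_sym[OF Y]
  have "resolvent F Y - Y = F (resolvent F Y)"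
    using resolvent_eq[OF F(1) F sym] by (simp add: algebra_simps)
  then show ?thesis using pos_operator_pos[OF F(1) resolvent_psd[OF F(1) F sym Y]] by simp
qed

text \<open>A maximum principle: iterating gives \<open>V \<ge> (F ^^ k) V\<close>, and the
  right-hand side tends to 0. Differences of solutions of Lyapunov equations are compared through
  their right-hand sides with it.\<close>

lemma stable_operator_comparison:
  assumes F: "pos_operator F" "stable_operator F" and V: "transpose V = V" "pos_semidef (V - F V)"
  shows "pos_semidef V"
proof -
  have "pos_semidef (V - (F ^^ k) V)" for k
  proof (induction k)
    case (Suc k)
    from pos_operator_mono[OF F(1) Suc] show ?case
      using pos_semidef_trans[OF V(2)] by simp
  qed simp
  moreover have "(\<lambda>k. (F ^^ k) V) \<longlonglongrightarrow> 0"
    by (rule tendsto_norm_zero_cancel[OF summable_LIMSEQ_zero[OF stable_operator_summable[OF F V(1)]]])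
  from tendsto_diff[OF tendsto_const this, of V] have "(\<lambda>k. V - (F ^^ k) V) \<longlonglongrightarrow> V" by simp
  ultimately show ?thesis by (rule pos_semidef_limit)
qed

section \<open>The mean operators of the closed loop\<close>

definition sq_integrable :: "'w measure \<Rightarrow> ('w \<Rightarrow> 'b::euclidean_space) \<Rightarrow> bool" where
  "sq_integrable M f \<longleftrightarrow> f \<in> borel_measurable M \<and> integrable M (\<lambda>\<omega>. (norm (f \<omega>))\<^sup>2)"

definition second_moment :: "'w measure \<Rightarrow> ('w \<Rightarrow> 'b::euclidean_space) \<Rightarrow> real" where
  "second_moment M f = (\<integral>\<omega>. (norm (f \<omega>))\<^sup>2 \<partial>M)"

lemma borel_measurable_matrix_mult [measurable]:
  assumes [measurable]: "f \<in> borel_measurable M" "g \<in> borel_measurable M"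
  shows "(\<lambda>\<omega>. (f \<omega> :: real ^ 'k ^ 'm) ** (g \<omega> :: real ^ 'n ^ 'k)) \<in> borel_measurable M"
  by (rule borel_measurable_continuous_Pair[OF assms])
     (intro bounded_bilinear.continuous_on[OF bounded_bilinear_matrix_mult] continuous_intros)

lemma borel_measurable_transpose [measurable]:
  assumes "f \<in> borel_measurable M"
  shows "(\<lambda>\<omega>. transpose (f \<omega> :: real ^ 'n ^ 'm)) \<in> borel_measurable M"
  by (rule borel_measurable_continuous_on[OF linear_continuous_on[OF bounded_linear_transpose] assms])

text \<open>The product of the two random norms is bounded by half the sum of their squares, so
  second moments suffice and the bound stays additive in them.\<close>

lemma sq_integrable_mult:
  fixes f :: "'w \<Rightarrow> real ^ 'k ^ 'm" and g :: "'w \<Rightarrow> real ^ 'n ^ 'l" and X :: "real ^ 'l ^ 'k"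
  assumes f: "sq_integrable M f" and g: "sq_integrable M g"
  shows "integrable M (\<lambda>\<omega>. f \<omega> ** X ** g \<omega>)"
    and "norm (\<integral>\<omega>. f \<omega> ** X ** g \<omega> \<partial>M) \<le> norm X * ((second_moment M f + second_moment M g) / 2)"
proof -
  have meas [measurable]: "f \<in> borel_measurable M" "g \<in> borel_measurable M"
    and int: "integrable M (\<lambda>\<omega>. (norm (f \<omega>))\<^sup>2)" "integrable M (\<lambda>\<omega>. (norm (g \<omega>))\<^sup>2)"
    using f g by (auto simp: sq_integrable_def)
  define h where "h \<omega> = norm X * (((norm (f \<omega>))\<^sup>2 + (norm (g \<omega>))\<^sup>2) / 2)" for \<omega>
  have h: "integrable M h" unfolding h_def using int by simp
  have le: "norm (f \<omega> ** X ** g \<omega>) \<le> h \<omega>" for \<omega>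
  proof -
    have "norm (f \<omega> ** X ** g \<omega>) \<le> norm (f \<omega>) * norm X * norm (g \<omega>)"
      by (rule order_trans[OF norm_matrix_mult_le]) (intro mult_right_mono norm_matrix_mult_le, simp)
    also have "\<dots> = norm X * (norm (f \<omega>) * norm (g \<omega>))" by simp
    also have "\<dots> \<le> h \<omega>"
      unfolding h_def using sum_squares_bound[of "norm (f \<omega>)" "norm (g \<omega>)"]
      by (intro mult_left_mono) auto
    finally show ?thesis .
  qed
  show i: "integrable M (\<lambda>\<omega>. f \<omega> ** X ** g \<omega>)"
    by (rule Bochner_Integration.integrable_bound[OF h])
       (use le in \<open>auto intro!: AE_I2 order_trans[OF le abs_ge_self]\<close>)
  have "norm (\<integral>\<omega>. f \<omega> ** X ** g \<omega> \<partial>M) \<le> (\<integral>\<omega>. h \<omega> \<partial>M)"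
    by (rule order_trans[OF integral_norm_bound integral_mono[OF integrable_norm[OF i] h le]])
  also have "\<dots> = norm X * ((second_moment M f + second_moment M g) / 2)"
    unfolding h_def second_moment_def using int by simp
  finally show "norm (\<integral>\<omega>. f \<omega> ** X ** g \<omega> \<partial>M)
      \<le> norm X * ((second_moment M f + second_moment M g) / 2)" .
qed

lemma sq_integrable_transpose:
  assumes "sq_integrable M f"
  shows "sq_integrable M (\<lambda>\<omega>. transpose (f \<omega> :: real ^ 'n ^ 'm))"
  using assms by (auto simp: sq_integrable_def)

lemma second_moment_transpose [simp]:
  "second_moment M (\<lambda>\<omega>. transpose (f \<omega> :: real ^ 'n ^ 'm)) = second_moment M f"
  by (simp add: second_moment_def)

lemma second_moment_nonneg: "0 \<le> second_moment M f"
  by (simp add: second_moment_def)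

lemma norm_diff_mult_power2_le:
  "(norm (A - B ** L))\<^sup>2 \<le> 2 * (norm A)\<^sup>2 + 2 * (norm L)\<^sup>2 * (norm B)\<^sup>2"
  for A :: "real ^ 'n ^ 'n" and B :: "real ^ 'm ^ 'n"
proof -
  have "(norm (A - B ** L))\<^sup>2 \<le> (norm A + norm B * norm L)\<^sup>2"
    using norm_triangle_ineq4[of A "B ** L"] norm_matrix_mult_le[of B L] by (intro power_mono) auto
  also have "\<dots> \<le> 2 * (norm A)\<^sup>2 + 2 * (norm B * norm L)\<^sup>2"
    using sum_squares_bound[of "norm A" "norm B * norm L"] by (simp add: power2_sum)
  finally show ?thesis by (simp add: power_mult_distrib mult_ac)
qed

lemma sq_integrable_diff_mult:
  fixes f :: "'w \<Rightarrow> real ^ 'n ^ 'n" and g :: "'w \<Rightarrow> real ^ 'm ^ 'n"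
  assumes f: "sq_integrable M f" and g: "sq_integrable M g"
  shows "sq_integrable M (\<lambda>\<omega>. f \<omega> - g \<omega> ** L)"
    and "second_moment M (\<lambda>\<omega>. f \<omega> - g \<omega> ** L) \<le> 2 * second_moment M f + 2 * (norm L)\<^sup>2 * second_moment M g"
proof -
  have meas [measurable]: "f \<in> borel_measurable M" "g \<in> borel_measurable M"
    and int: "integrable M (\<lambda>\<omega>. (norm (f \<omega>))\<^sup>2)" "integrable M (\<lambda>\<omega>. (norm (g \<omega>))\<^sup>2)"
    using f g by (auto simp: sq_integrable_def)
  have h: "integrable M (\<lambda>\<omega>. 2 * (norm (f \<omega>))\<^sup>2 + 2 * (norm L)\<^sup>2 * (norm (g \<omega>))\<^sup>2)"
    using int by simp
  have i: "integrable M (\<lambda>\<omega>. (norm (f \<omega> - g \<omega> ** L))\<^sup>2)"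
    by (rule Bochner_Integration.integrable_bound[OF h])
       (auto intro!: AE_I2 order_trans[OF norm_diff_mult_power2_le])
  then show "sq_integrable M (\<lambda>\<omega>. f \<omega> - g \<omega> ** L)" by (simp add: sq_integrable_def)
  show "second_moment M (\<lambda>\<omega>. f \<omega> - g \<omega> ** L) \<le> 2 * second_moment M f + 2 * (norm L)\<^sup>2 * second_moment M g"
  proof -
    have "(\<integral>\<omega>. (norm (f \<omega> - g \<omega> ** L))\<^sup>2 \<partial>M)
        \<le> (\<integral>\<omega>. 2 * (norm (f \<omega>))\<^sup>2 + 2 * (norm L)\<^sup>2 * (norm (g \<omega>))\<^sup>2 \<partial>M)"
      by (rule integral_mono[OF i h norm_diff_mult_power2_le])
    then show ?thesis using int by (simp add: second_moment_def)
  qed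
qed

text \<open>Absorbs lower-order monomials into the leading one; it is the reason why
  \<open>k\<close> and \<open>u L\<close> are kept at least 1.\<close>

lemma power_product_mono:
  fixes k u :: real
  assumes "1 \<le> k" "1 \<le> u" "i \<le> i'" "j \<le> j'"
  shows "k ^ i * u ^ j \<le> k ^ i' * u ^ j'"
  using assms by (intro mult_mono power_increasing) auto

lemma integral_pos_semidef:
  assumes f: "integrable M f" and "\<And>\<omega>. pos_semidef (f \<omega> :: real ^ 'k ^ 'k)"
  shows "pos_semidef (\<integral>\<omega>. f \<omega> \<partial>M)"
proof -
  have "transpose (\<integral>\<omega>. f \<omega> \<partial>M) = (\<integral>\<omega>. transpose (f \<omega>) \<partial>M)"
    by (rule integral_bounded_linear[OF bounded_linear_transpose f, symmetric])
  moreover have "x \<bullet> ((\<integral>\<omega>. f \<omega> \<partial>M) *v x) = (\<integral>\<omega>. x \<bullet> (f \<omega> *v x) \<partial>M)" for x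
    using f by (simp flip: inner_outer_prod)
  ultimately show ?thesis
    using assms(2) by (simp add: pos_semidef_def)
qed

lemma integral_matrix_mult_left:
  fixes f :: "'w \<Rightarrow> real ^ 'k ^ 'l" and X :: "real ^ 'l ^ 'j"
  assumes "integrable M f"
  shows "(\<integral>\<omega>. X ** f \<omega> \<partial>M) = X ** (\<integral>\<omega>. f \<omega> \<partial>M)" "integrable M (\<lambda>\<omega>. X ** f \<omega>)"
  by (rule integral_bounded_linear[OF bounded_bilinear.bounded_linear_right[OF bounded_bilinear_matrix_mult] assms]
      integrable_bounded_linear[OF bounded_bilinear.bounded_linear_right[OF bounded_bilinear_matrix_mult] assms])+

lemma integral_matrix_mult_right:
  fixes f :: "'w \<Rightarrow> real ^ 'l ^ 'j" and X :: "real ^ 'k ^ 'l"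
  assumes "integrable M f"
  shows "(\<integral>\<omega>. f \<omega> ** X \<partial>M) = (\<integral>\<omega>. f \<omega> \<partial>M) ** X" "integrable M (\<lambda>\<omega>. f \<omega> ** X)"
  by (rule integral_bounded_linear[OF bounded_bilinear.bounded_linear_left[OF bounded_bilinear_matrix_mult] assms]
      integrable_bounded_linear[OF bounded_bilinear.bounded_linear_left[OF bounded_bilinear_matrix_mult] assms])+

text \<open>The deterministic core: one copy \<open>(a, b)\<close> of the dynamics, the mean weights
  and the initial second moment. No state process occurs here.\<close>

locale lq_moments =
  fixes M :: "'w measure"
    and a :: "'w \<Rightarrow> real ^ 'n ^ 'n" and b :: "'w \<Rightarrow> real ^ 'm ^ 'n"
    and Qm :: "real ^ 'n ^ 'n" and Rm :: "real ^ 'm ^ 'm" and S0 :: "real ^ 'n ^ 'n"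
    and sQ sR mu :: real
  assumes a: "sq_integrable M a" and b: "sq_integrable M b"
    and sQ: "0 < sQ" "pos_semidef (Qm - sQ *\<^sub>R mat 1)"
    and sR: "0 < sR" "pos_semidef (Rm - sR *\<^sub>R mat 1)"
    and mu: "0 < mu" "pos_semidef (S0 - mu *\<^sub>R mat 1)"
begin

definition cl :: "real ^ 'n ^ 'm \<Rightarrow> 'w \<Rightarrow> real ^ 'n ^ 'n" where
  "cl L \<omega> = a \<omega> - b \<omega> ** L"

definition F :: "real ^ 'n ^ 'm \<Rightarrow> real ^ 'n ^ 'n \<Rightarrow> real ^ 'n ^ 'n" where
  "F L X = (\<integral>\<omega>. cl L \<omega> ** X ** transpose (cl L \<omega>) \<partial>M)"

text \<open>The adjoint of \<open>F L\<close> for the Frobenius inner product, governing the value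
  matrix \<open>P L\<close>.\<close>

definition F' :: "real ^ 'n ^ 'm \<Rightarrow> real ^ 'n ^ 'n \<Rightarrow> real ^ 'n ^ 'n" where
  "F' L Y = (\<integral>\<omega>. transpose (cl L \<omega>) ** Y ** cl L \<omega> \<partial>M)"

definition U :: "(real ^ 'n ^ 'm) set" where
  "U = {L. stable_operator (F L)}"

definition K :: "real ^ 'n ^ 'm \<Rightarrow> real ^ 'n ^ 'n" where
  "K L = Qm + transpose L ** Rm ** L"

definition \<Sigma> :: "real ^ 'n ^ 'm \<Rightarrow> real ^ 'n ^ 'n" where
  "\<Sigma> L = resolvent (F L) S0"

definition P :: "real ^ 'n ^ 'm \<Rightarrow> real ^ 'n ^ 'n" where
  "P L = resolvent (F' L) (K L)"

definition J :: "real ^ 'n ^ 'm \<Rightarrow> real" where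
  "J L = K L \<bullet> \<Sigma> L"

definition V :: "real ^ 'n ^ 'm \<Rightarrow> real ^ 'n ^ 'm" where
  "V L = (\<integral>\<omega>. transpose (b \<omega>) ** P L ** cl L \<omega> \<partial>M)"

definition W :: "real ^ 'n ^ 'm \<Rightarrow> real ^ 'm ^ 'm" where
  "W L = (\<integral>\<omega>. transpose (b \<omega>) ** P L ** b \<omega> \<partial>M)"

text \<open>Equal to \<open>G L ** L\<close> minus the mean of
  \<open>transpose b ** P L ** a\<close>. Its vanishing is the stationarity condition of the Riccati
  equation.\<close>

definition E :: "real ^ 'n ^ 'm \<Rightarrow> real ^ 'n ^ 'm" where
  "E L = Rm ** L - V L"

definition G :: "real ^ 'n ^ 'm \<Rightarrow> real ^ 'm ^ 'm" where
  "G L = Rm + W L"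

definition D :: "real ^ 'n ^ 'm \<Rightarrow> real ^ 'n ^ 'm" where
  "D L = 2 *\<^sub>R (E L ** \<Sigma> L)"

lemma cl: "sq_integrable M (cl L)"
  and second_moment_cl: "second_moment M (cl L) \<le> 2 * second_moment M a + 2 * (norm L)\<^sup>2 * second_moment M b"
  unfolding cl_def[abs_def] by (intro sq_integrable_diff_mult a b)+

lemma F_integrable: "integrable M (\<lambda>\<omega>. cl L \<omega> ** X ** transpose (cl L \<omega>))"
  by (intro sq_integrable_mult cl sq_integrable_transpose)

lemma F'_integrable: "integrable M (\<lambda>\<omega>. transpose (cl L \<omega>) ** X ** cl L \<omega>)"
  by (intro sq_integrable_mult cl sq_integrable_transpose)

lemma F_pos: "pos_operator (F L)"
  unfolding pos_operator_def
proof (intro conjI allI impI)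
  show "linear (F L)"
    by (rule linearI) (simp_all add: F_def matrix_mult_algebra F_integrable)
  show "pos_semidef (F L X)" if "pos_semidef X" for X
    unfolding F_def by (intro integral_pos_semidef F_integrable pos_semidef_congruence that)
qed

lemma F'_pos: "pos_operator (F' L)"
  unfolding pos_operator_def
proof (intro conjI allI impI)
  show "linear (F' L)"
    by (rule linearI) (simp_all add: F'_def matrix_mult_algebra F'_integrable)
  show "pos_semidef (F' L X)" if "pos_semidef X" for X
    unfolding F'_def by (intro integral_pos_semidef F'_integrable pos_semidef_congruence' that)
qed

lemma F_adjoint: "F' L Y \<bullet> X = Y \<bullet> F L X"
proof -
  have "F' L Y \<bullet> X = (\<integral>\<omega>. (transpose (cl L \<omega>) ** Y ** cl L \<omega>) \<bullet> X \<partial>M)"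
    unfolding F'_def using F'_integrable by simp
  also have "\<dots> = (\<integral>\<omega>. Y \<bullet> (cl L \<omega> ** X ** transpose (cl L \<omega>)) \<partial>M)"
    by (simp add: inner_mult_right[of _ "cl L _"] inner_mult_left[of _ Y] matrix_mul_assoc)
  also have "\<dots> = Y \<bullet> F L X"
    unfolding F_def using F_integrable by simp
  finally show ?thesis .
qed

lemma F_adjoint_funpow: "(F' L ^^ k) Y \<bullet> X = Y \<bullet> (F L ^^ k) X"
proof (induction k arbitrary: X)
  case (Suc k)
  have "(F' L ^^ Suc k) Y \<bullet> X = (F' L ^^ k) Y \<bullet> F L X" by (simp add: F_adjoint)
  also have "\<dots> = Y \<bullet> (F L ^^ Suc k) X" unfolding Suc by (simp add: funpow_swap1)
  finally show ?case .
qed simp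

text \<open>Stability is a condition on \<open>F L\<close>. It passes to the adjoint because the
  trace of the iterate on a semidefinite \<open>Y\<close> is
  \<open>Y \<bullet> (F L ^^ k) (mat 1)\<close>, and this trace bounds the norm.\<close>

lemma F'_summable:
  assumes L: "L \<in> U" and Y: "pos_semidef Y"
  shows "summable (\<lambda>k. norm ((F' L ^^ k) Y))"
proof -
  have "summable (\<lambda>k. norm ((F L ^^ k) (mat 1)))"
    using L by (intro stable_operator_summable F_pos) (simp_all add: U_def)
  then have s: "summable (\<lambda>k. norm Y * norm ((F L ^^ k) (mat 1)))" by (rule summable_mult)
  have "norm ((F' L ^^ k) Y) \<le> norm Y * norm ((F L ^^ k) (mat 1))" for k
  proof -
    have "norm ((F' L ^^ k) Y) \<le> trace ((F' L ^^ k) Y)"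
      by (intro norm_le_trace pos_operator_pos[OF pos_operator_funpow[OF F'_pos]] Y)
    also have "\<dots> = Y \<bullet> (F L ^^ k) (mat 1)"
      by (simp add: trace_eq_inner inner_commute[of "mat 1"] F_adjoint_funpow)
    also have "\<dots> \<le> norm Y * norm ((F L ^^ k) (mat 1))" by (rule norm_cauchy_schwarz)
    finally show ?thesis .
  qed
  then show ?thesis by (intro summable_comparison_test'[OF s, where N = 0]) simp
qed

lemma Qm_psd: "pos_semidef Qm" and Rm_psd: "pos_semidef Rm" and S0_psd: "pos_semidef S0"
  using sQ sR mu by (auto intro: pos_semidef_of_ge)

lemma K_psd: "pos_semidef (K L)"
  unfolding K_def by (intro pos_semidef_add Qm_psd pos_semidef_congruence' Rm_psd)

lemma P_psd: "L \<in> U \<Longrightarrow> pos_semidef (P L)"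
  unfolding P_def by (intro resolvent_psd_summable F'_pos F'_summable K_psd)

lemma P_eq: "L \<in> U \<Longrightarrow> P L = F' L (P L) + K L"
  unfolding P_def by (intro resolvent_eq_summable F'_pos[THEN pos_operator_linear] F'_summable K_psd)

lemma \<Sigma>_eq: "L \<in> U \<Longrightarrow> \<Sigma> L = F L (\<Sigma> L) + S0"
  unfolding \<Sigma>_def U_def using S0_psd by (intro resolvent_eq F_pos) (auto dest: pos_semidef_sym)

lemma \<Sigma>_psd: "L \<in> U \<Longrightarrow> pos_semidef (\<Sigma> L)"
  unfolding \<Sigma>_def U_def using S0_psd by (intro resolvent_psd F_pos) (auto dest: pos_semidef_sym)

lemma \<Sigma>_ge: "L \<in> U \<Longrightarrow> pos_semidef (\<Sigma> L - mu *\<^sub>R mat 1)"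
  using resolvent_ge[OF F_pos _ S0_psd, of L] mu(2) unfolding \<Sigma>_def U_def
  by (auto intro: pos_semidef_trans)

text \<open>Substituting \<open>K L = P L - F' L (P L)\<close> and moving the operator to the other
  side leaves \<open>\<Sigma> L - F L (\<Sigma> L) = S0\<close>.\<close>

lemma J_eq_P:
  assumes L: "L \<in> U"
  shows "J L = P L \<bullet> S0"
proof -
  have "J L = (P L - F' L (P L)) \<bullet> \<Sigma> L" using P_eq[OF L] unfolding J_def by (metis add_diff_cancel_left')
  also have "\<dots> = P L \<bullet> (\<Sigma> L - F L (\<Sigma> L))" by (simp add: inner_diff_left inner_diff_right F_adjoint)
  also have "\<Sigma> L - F L (\<Sigma> L) = S0" using \<Sigma>_eq[OF L] by (metis add_diff_cancel_left')
  finally show ?thesis .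
qed

lemma J_nonneg: "L \<in> U \<Longrightarrow> 0 \<le> J L"
  unfolding J_def by (intro inner_pos_semidef_nonneg K_psd \<Sigma>_psd)

lemma V_integrable: "integrable M (\<lambda>\<omega>. transpose (b \<omega>) ** X ** cl L \<omega>)"
  and W_integrable: "integrable M (\<lambda>\<omega>. transpose (b \<omega>) ** X ** b \<omega>)"
  by (intro sq_integrable_mult cl b sq_integrable_transpose)+

text \<open>Since \<open>cl (L + H) = cl L - b ** H\<close>, the integrand is a quadratic polynomial
  in \<open>H\<close>. The matrix \<open>P L\<close> stays fixed.\<close>

lemma F'_add:
  assumes L: "L \<in> U"
  shows "F' (L + H) (P L) = F' L (P L) - transpose H ** V L - transpose (V L) ** H + transpose H ** W L ** H"
proof -
  let ?v = "\<lambda>\<omega>. transpose (b \<omega>) ** P L ** cl L \<omega>" and ?w = "\<lambda>\<omega>. transpose (b \<omega>) ** P L ** b \<omega>"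
  have sym: "transpose (P L) = P L" by (rule pos_semidef_sym[OF P_psd[OF L]])
  have v: "integrable M ?v" by (rule V_integrable)
  have w: "integrable M ?w" by (rule W_integrable)
  have v': "integrable M (\<lambda>\<omega>. transpose (?v \<omega>))"
    by (rule integrable_bounded_linear[OF bounded_linear_transpose v])
  have "transpose (cl (L + H) \<omega>) ** P L ** cl (L + H) \<omega> =
      transpose (cl L \<omega>) ** P L ** cl L \<omega> - transpose H ** ?v \<omega> - transpose (?v \<omega>) ** H
      + transpose H ** ?w \<omega> ** H" for \<omega>
  proof -
    have "cl (L + H) \<omega> = cl L \<omega> - b \<omega> ** H"
      by (simp add: cl_def matrix_mult_algebra)
    then show ?thesis
      by (simp add: transpose_algebra matrix_mult_algebra matrix_transpose_mul matrix_mul_assoc sym)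
  qed
  moreover have "(\<integral>\<omega>. transpose (?v \<omega>) \<partial>M) = transpose (V L)"
    unfolding V_def by (rule integral_bounded_linear[OF bounded_linear_transpose v])
  ultimately show ?thesis
    using v w v' F'_integrable[of L "P L"]
    by (simp add: F'_def integral_matrix_mult_left integral_matrix_mult_right flip: V_def W_def)
qed

lemma K_add: "K (L + H) = K L + transpose H ** (Rm ** L) + transpose (Rm ** L) ** H + transpose H ** Rm ** H"
  by (simp add: K_def transpose_algebra matrix_mult_algebra matrix_transpose_mul matrix_mul_assoc
      pos_semidef_sym[OF Rm_psd])

text \<open>The formula is exact because the value matrix is taken at the old gain and the second
  moments at the new one: both costs become inner products with the same
  \<open>\<Sigma> (L + H)\<close>.\<close>

lemma J_diff:
  assumes L: "L \<in> U" and L': "L + H \<in> U"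
  shows "J (L + H) - J L = 2 * ((E L ** \<Sigma> (L + H)) \<bullet> H) + (G L ** H ** \<Sigma> (L + H)) \<bullet> H"
proof -
  let ?S = "\<Sigma> (L + H)"
  have S_sym: "transpose ?S = ?S" by (rule pos_semidef_sym[OF \<Sigma>_psd[OF L']])
  \<comment> \<open>\<open>S0\<close> is rewritten through the Lyapunov equation of the new gain,
    although \<open>J L\<close> belongs to the old one.\<close>
  have "J L = P L \<bullet> (?S - F (L + H) ?S)"
    unfolding J_eq_P[OF L] using \<Sigma>_eq[OF L'] by (metis add_diff_cancel_left')
  also have "\<dots> = (P L - F' (L + H) (P L)) \<bullet> ?S"
    by (simp add: inner_diff_left inner_diff_right F_adjoint)
  finally have "J (L + H) - J L = (K (L + H) + F' (L + H) (P L) - P L) \<bullet> ?S"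
    by (simp add: J_def inner_diff_left inner_add_left)
  also have "K (L + H) + F' (L + H) (P L) - P L =
      transpose H ** E L + transpose (E L) ** H + transpose H ** G L ** H"
  proof -
    have "K (L + H) + F' (L + H) (P L) - (F' L (P L) + K L) =
      transpose H ** E L + transpose (E L) ** H + transpose H ** G L ** H"
      unfolding F'_add[OF L] K_add E_def G_def
      by (simp add: transpose_algebra matrix_mult_algebra)
    then show ?thesis using P_eq[OF L] by simp
  qed
  also have "\<dots> \<bullet> ?S = 2 * ((E L ** ?S) \<bullet> H) + (G L ** H ** ?S) \<bullet> H"
  proof -
    have "(transpose H ** E L) \<bullet> ?S = (E L ** ?S) \<bullet> H"
      by (simp add: inner_mult_left[of "transpose H"] inner_mult_right[of _ ?S] S_sym)
    moreover have "(transpose (E L) ** H) \<bullet> ?S = (E L ** ?S) \<bullet> H"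
      by (simp add: inner_mult_left inner_commute[of H])
    moreover have "(transpose H ** G L ** H) \<bullet> ?S = (G L ** H ** ?S) \<bullet> H"
      unfolding matrix_mul_assoc[symmetric, of "transpose H"]
      by (simp add: inner_mult_left[of "transpose H"] inner_mult_right[of _ ?S] S_sym)
    ultimately show ?thesis by (simp add: inner_add_left)
  qed
  finally show ?thesis .
qed

end

section \<open>Perturbation bounds on the set of stabilising gains\<close>

text \<open>Besides the moments and the reciprocals, \<open>k\<close> also bounds \<open>mu\<close>
  and \<open>sR\<close> from above; this makes the contraction factor nonnegative for the chosen
  step size.\<close>

locale lq_bounded = lq_moments M a b Qm Rm S0 sQ sR mu
  for M :: "'w measure"
    and a :: "'w \<Rightarrow> real ^ 'n ^ 'n" and b :: "'w \<Rightarrow> real ^ 'm ^ 'n"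
    and Qm :: "real ^ 'n ^ 'n" and Rm :: "real ^ 'm ^ 'm" and S0 :: "real ^ 'n ^ 'n"
    and sQ sR mu :: real +
  fixes k :: real
  assumes k_bounds: "1 \<le> k" "second_moment M a \<le> k" "second_moment M b \<le> k" "norm Rm \<le> k"
    "1 / sQ \<le> k" "1 / sR \<le> k" "1 / mu \<le> k" "mu \<le> k" "sR \<le> k"
begin

text \<open>The shift by 1 makes powers of \<open>u L\<close> increasing in the exponent and matches
  the factor \<open>1 + C(L0)\<close> in the step size.\<close>

definition u :: "real ^ 'n ^ 'm \<Rightarrow> real" where
  "u L = 1 + J L"

lemma u_ge: "L \<in> U \<Longrightarrow> 1 \<le> u L" and J_le_u: "J L \<le> u L"
  using J_nonneg by (auto simp: u_def)

lemma bound_by_k: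
  assumes "0 < c" "1 / c \<le> k" "c * x \<le> y" "0 \<le> y"
  shows "x \<le> k * y"
proof -
  have "x \<le> (1 / c) * y" using assms(1,3) by (simp add: field_simps)
  also have "\<dots> \<le> k * y" using assms by (intro mult_right_mono) auto
  finally show ?thesis .
qed

text \<open>The cost pays at least \<open>sQ\<close> per unit of second moment, since
  \<open>K L \<ge> sQ\<close>. The bound for \<open>P L\<close> is dual, with
  \<open>S0 \<ge> mu\<close>.\<close>

lemma trace_\<Sigma>_le:
  assumes L: "L \<in> U"
  shows "trace (\<Sigma> L) \<le> k * u L"
proof -
  have "pos_semidef (transpose L ** Rm ** L)" by (intro pos_semidef_congruence' Rm_psd)
  with sQ(2) have "pos_semidef (K L - sQ *\<^sub>R mat 1)"
    using pos_semidef_add[of "Qm - sQ *\<^sub>R mat 1" "transpose L ** Rm ** L"] by (simp add: K_def algebra_simps)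
  then have "sQ * trace (\<Sigma> L) \<le> J L" unfolding J_def by (intro inner_ge_trace \<Sigma>_psd L)
  then have "sQ * trace (\<Sigma> L) \<le> u L" using J_le_u[of L] by simp
  then show ?thesis using u_ge[OF L] k_bounds sQ by (intro bound_by_k) auto
qed

lemma trace_P_le:
  assumes L: "L \<in> U"
  shows "trace (P L) \<le> k * u L"
proof -
  have "mu * trace (P L) \<le> J L"
    unfolding J_eq_P[OF L] inner_commute[of "P L"] by (intro inner_ge_trace mu P_psd L)
  then have "mu * trace (P L) \<le> u L" using J_le_u[of L] by simp
  then show ?thesis using u_ge[OF L] k_bounds mu by (intro bound_by_k) auto
qed

text \<open>The control part of the cost is at least \<open>sR * mu * (norm L) ^ 2\<close>, by
  \<open>Rm \<ge> sR\<close> and \<open>\<Sigma> L \<ge> mu\<close>. In particular sublevel sets of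
  \<open>J\<close> are bounded.\<close>

lemma norm_L_power2_le:
  assumes L: "L \<in> U"
  shows "(norm L)\<^sup>2 \<le> k\<^sup>2 * u L"
proof -
  have tr: "trace (transpose L ** L) = (norm L)\<^sup>2"
    by (simp add: trace_eq_inner inner_commute[of "mat 1"] inner_mult_left power2_norm_eq_inner)
  have psd: "pos_semidef (transpose L ** L)" using pos_semidef_congruence'[of "mat 1" L] by simp
  have "mu * (norm L)\<^sup>2 \<le> \<Sigma> L \<bullet> (transpose L ** L)"
    unfolding tr[symmetric] by (intro inner_ge_trace \<Sigma>_ge L psd)
  then have "sR * (mu * (norm L)\<^sup>2) \<le> sR * ((transpose L ** L) \<bullet> \<Sigma> L)"
    using sR by (simp add: inner_commute)
  also have "\<dots> \<le> (transpose L ** Rm ** L) \<bullet> \<Sigma> L"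
  proof -
    have "pos_semidef (transpose L ** (Rm - sR *\<^sub>R mat 1) ** L)" by (intro pos_semidef_congruence' sR)
    from inner_pos_semidef_nonneg[OF this \<Sigma>_psd[OF L]] show ?thesis
      by (simp add: matrix_mult_algebra inner_diff_left)
  qed
  also have "\<dots> \<le> J L"
    using inner_pos_semidef_nonneg[OF Qm_psd \<Sigma>_psd[OF L]] by (simp add: J_def K_def inner_add_left)
  finally have "sR * (mu * (norm L)\<^sup>2) \<le> u L" using J_le_u[of L] by simp
  then have "mu * (norm L)\<^sup>2 \<le> k * u L"
    using u_ge[OF L] k_bounds(6) by (intro bound_by_k[OF sR(1)]) auto
  then have "(norm L)\<^sup>2 \<le> k * (k * u L)"
    using u_ge[OF L] k_bounds(1,7) by - (rule bound_by_k[OF mu(1)], auto)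
  then show ?thesis by (simp add: power2_eq_square mult_ac)
qed

lemma second_moment_cl_le:
  assumes L: "L \<in> U"
  shows "second_moment M (cl L) \<le> 4 * k ^ 3 * u L"
proof -
  have "second_moment M (cl L) \<le> 2 * second_moment M a + 2 * (norm L)\<^sup>2 * second_moment M b"
    by (rule second_moment_cl)
  also have "\<dots> \<le> 2 * k + 2 * (k\<^sup>2 * u L) * k"
    using k_bounds norm_L_power2_le[OF L] u_ge[OF L]
    by (intro add_mono mult_mono second_moment_nonneg) auto
  also have "\<dots> \<le> 4 * k ^ 3 * u L"
    using power_product_mono[OF k_bounds(1) u_ge[OF L], of 1 3 0 1]
    by (simp add: power2_eq_square power3_eq_cube algebra_simps)
  finally show ?thesis .
qed

lemma norm_\<Sigma>_le: "L \<in> U \<Longrightarrow> norm (\<Sigma> L) \<le> k * u L"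
  using norm_le_trace[OF \<Sigma>_psd] trace_\<Sigma>_le by fastforce

lemma norm_P_le: "L \<in> U \<Longrightarrow> norm (P L) \<le> k * u L"
  using norm_le_trace[OF P_psd] trace_P_le by fastforce

lemma cross_moment_le:
  assumes L: "L \<in> U"
  shows "second_moment M b + second_moment M (cl L) \<le> 5 * (k ^ 3 * u L)"
  using second_moment_cl_le[OF L] k_bounds(3) power_product_mono[OF k_bounds(1) u_ge[OF L], of 1 3 0 1]
  by simp

lemma norm_E_le:
  assumes L: "L \<in> U"
  shows "norm (E L) \<le> 4 * k ^ 4 * (u L)\<^sup>2"
proof -
  \<comment> \<open>Avoids a square root, so that the bounds remain polynomial in \<open>k\<close>
    and \<open>u L\<close>.\<close>
  have "norm L \<le> (1 + (norm L)\<^sup>2) / 2" using sum_squares_bound[of 1 "norm L"] by simp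
  also have "\<dots> \<le> (1 + k\<^sup>2 * u L) / 2" using norm_L_power2_le[OF L] by simp
  finally have nL: "norm L \<le> (1 + k\<^sup>2 * u L) / 2" .
  have "norm (Rm ** L) \<le> norm Rm * norm L" by (rule norm_matrix_mult_le)
  also have "\<dots> \<le> k * ((1 + k\<^sup>2 * u L) / 2)" using k_bounds nL by (intro mult_mono) auto
  finally have 1: "norm (Rm ** L) \<le> (k + k ^ 3 * u L) / 2"
    by (simp add: power2_eq_square power3_eq_cube algebra_simps)
  have "norm (V L) \<le> norm (P L) * ((second_moment M b + second_moment M (cl L)) / 2)"
    unfolding V_def using sq_integrable_mult(2)[OF sq_integrable_transpose[OF b] cl] by simp
  also have "\<dots> \<le> (k * u L) * (5 * (k ^ 3 * u L) / 2)"
    using cross_moment_le[OF L] u_ge[OF L] k_bounds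
    by (intro mult_mono norm_P_le[OF L] divide_right_mono add_nonneg_nonneg divide_nonneg_nonneg second_moment_nonneg) auto
  finally have 2: "norm (V L) \<le> 5 / 2 * (k ^ 4 * (u L)\<^sup>2)"
    by (simp add: power2_eq_square numeral_eq_Suc mult_ac)
  have "norm (E L) \<le> norm (Rm ** L) + norm (V L)" unfolding E_def by (rule norm_triangle_ineq4)
  then show ?thesis
    using 1 2 power_product_mono[OF k_bounds(1) u_ge[OF L], of 1 4 0 2]
      power_product_mono[OF k_bounds(1) u_ge[OF L], of 3 4 1 2]
      k_bounds(1)
    unfolding mult.assoc by simp
qed

lemma norm_D_le:
  assumes L: "L \<in> U"
  shows "norm (D L) \<le> 8 * k ^ 5 * u L ^ 3"
proof -
  have "norm (D L) \<le> 2 * (norm (E L) * norm (\<Sigma> L))" by (simp add: D_def norm_matrix_mult_le)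
  also have "\<dots> \<le> 2 * ((4 * k ^ 4 * (u L)\<^sup>2) * (k * u L))"
    using k_bounds u_ge[OF L] by (intro mult_mono norm_E_le norm_\<Sigma>_le L) auto
  finally show ?thesis by (simp add: numeral_eq_Suc mult_ac)
qed

lemma norm_G_le:
  assumes L: "L \<in> U"
  shows "norm (G L) \<le> 2 * k\<^sup>2 * u L"
proof -
  have "norm (W L) \<le> norm (P L) * second_moment M b"
    unfolding W_def using sq_integrable_mult(2)[OF sq_integrable_transpose[OF b] b, of "P L"] by simp
  also have "\<dots> \<le> (k * u L) * k"
    using k_bounds u_ge[OF L] by (intro mult_mono norm_P_le second_moment_nonneg L) auto
  finally have "norm (G L) \<le> k + k\<^sup>2 * u L"
    using k_bounds(4) norm_triangle_ineq[of Rm "W L"] by (simp add: G_def power2_eq_square mult_ac)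
  then show ?thesis using power_product_mono[OF k_bounds(1) u_ge[OF L], of 1 2 0 1] by simp
qed

lemma F_diff_bound:
  "norm (F (L + H) X - F L X) \<le>
    norm X * norm H * (second_moment M b + second_moment M (cl L) + norm H * second_moment M b)"
proof -
  let ?d = "\<lambda>\<omega>. cl (L + H) \<omega> ** X ** transpose (cl (L + H) \<omega>) - cl L \<omega> ** X ** transpose (cl L \<omega>)"
  let ?h = "\<lambda>\<omega>. norm X * norm H * ((norm (b \<omega>))\<^sup>2 + (norm (cl L \<omega>))\<^sup>2 + norm H * (norm (b \<omega>))\<^sup>2)"
  have int: "integrable M (\<lambda>\<omega>. (norm (b \<omega>))\<^sup>2)" "integrable M (\<lambda>\<omega>. (norm (cl L \<omega>))\<^sup>2)"
    using b cl[of L] by (auto simp: sq_integrable_def)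
  then have h: "integrable M ?h" by simp
  have d: "integrable M ?d" by (intro Bochner_Integration.integrable_diff F_integrable)
  have le: "norm (?d \<omega>) \<le> ?h \<omega>" for \<omega>
  proof -
    let ?B = "b \<omega> ** H" and ?c = "cl L \<omega>"
    have cl': "cl (L + H) \<omega> = ?c - ?B" by (simp add: cl_def matrix_mult_algebra)
    have "?d \<omega> = ?B ** X ** transpose ?B - ?B ** X ** transpose ?c - ?c ** X ** transpose ?B"
      by (simp add: cl' transpose_algebra matrix_mult_algebra)
    also have "norm \<dots> \<le> norm (?B ** X ** transpose ?B) + norm (?B ** X ** transpose ?c) + norm (?c ** X ** transpose ?B)"
      by (intro order_trans[OF norm_triangle_ineq4] add_right_mono norm_triangle_ineq4)
    also have "\<dots> \<le> norm ?B * norm X * norm ?B + norm ?B * norm X * norm ?c + norm ?c * norm X * norm ?B"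
    proof -
      have "norm (Y ** X ** transpose Z) \<le> norm Y * norm X * norm Z" for Y Z :: "real ^ 'n ^ 'n"
        using norm_matrix_mult_le[of "Y ** X" "transpose Z"]
          mult_right_mono[OF norm_matrix_mult_le[of Y X] norm_ge_zero[of Z]] by simp
      then show ?thesis by (intro add_mono)
    qed
    also have "\<dots> = norm X * (norm ?B * (norm ?B + 2 * norm ?c))" by (simp add: algebra_simps)
    also have "\<dots> \<le> norm X * ((norm (b \<omega>) * norm H) * (norm (b \<omega>) * norm H + 2 * norm ?c))"
      using norm_matrix_mult_le[of "b \<omega>" H] by (intro mult_left_mono mult_mono add_mono) auto
    also have "\<dots> = norm X * norm H * (2 * norm (b \<omega>) * norm ?c + norm H * (norm (b \<omega>))\<^sup>2)"
      by (simp add: algebra_simps power2_eq_square)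
    also have "\<dots> \<le> ?h \<omega>"
      using sum_squares_bound[of "norm (b \<omega>)" "norm ?c"] by (intro mult_left_mono) auto
    finally show ?thesis .
  qed
  have "F (L + H) X - F L X = (\<integral>\<omega>. ?d \<omega> \<partial>M)"
    unfolding F_def by (intro Bochner_Integration.integral_diff[symmetric] F_integrable)
  also have "norm \<dots> \<le> (\<integral>\<omega>. ?h \<omega> \<partial>M)"
    by (rule order_trans[OF integral_norm_bound integral_mono[OF integrable_norm[OF d] h le]])
  also have "\<dots> = norm X * norm H * (second_moment M b + second_moment M (cl L) + norm H * second_moment M b)"
    using int by (simp add: second_moment_def)
  finally show ?thesis .
qed

text \<open>As long as \<open>F (L + H)\<close> and \<open>F L\<close> differ at \<open>\<Sigma> L\<close> by at most \<open>mu / 2\<close>, the matrix \<open>\<Sigma> L\<close> is a Lyapunov matrix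
  for \<open>L + H\<close> as well; the comparison principle then bounds \<open>\<Sigma> (L + H)\<close> and its distance to \<open>\<Sigma> L\<close>.\<close>

lemma perturbation:
  assumes L: "L \<in> U" and H: "14 * k ^ 5 * (u L)\<^sup>2 * norm H \<le> 1"
  shows "L + H \<in> U" "\<bar>J (L + H) - J L - D L \<bullet> H\<bar> \<le> 340 * k ^ 10 * u L ^ 5 * (norm H)\<^sup>2"
proof -
  note k1 = k_bounds(1) and u1 = u_ge[OF L] and ku = power_product_mono[OF k_bounds(1) u_ge[OF L]]
  let ?F = "F (L + H)" and ?S = "\<Sigma> L"
  define Z where "Z = ?F ?S - F L ?S"
  have S_sym: "transpose ?S = ?S" by (rule pos_semidef_sym[OF \<Sigma>_psd[OF L]])
  have Z_sym: "transpose Z = Z"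
    by (simp add: Z_def transpose_algebra pos_operator_sym[OF F_pos S_sym])
  have "1 * norm H \<le> 14 * k ^ 5 * (u L)\<^sup>2 * norm H"
    using ku[of 0 5 0 2] by (intro mult_right_mono) auto
  then have H1: "norm H \<le> 1" using H by simp
  have "norm Z \<le> norm ?S * norm H * (second_moment M b + second_moment M (cl L) + norm H * second_moment M b)"
    unfolding Z_def by (rule F_diff_bound)
  also have "\<dots> \<le> (k * u L) * norm H * (5 * (k ^ 3 * u L) + 1 * k)"
    using k_bounds u1 H1 cross_moment_le[OF L]
    by (intro mult_mono add_mono norm_\<Sigma>_le L add_nonneg_nonneg mult_nonneg_nonneg second_moment_nonneg) auto
  also have "\<dots> \<le> (k * u L) * norm H * (7 * (k ^ 3 * u L))"
    using ku[of 1 3 0 1] k1 u1 by (intro mult_left_mono) auto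
  finally have Z: "norm Z \<le> 7 * k ^ 4 * (u L)\<^sup>2 * norm H"
    by (simp add: numeral_eq_Suc mult_ac)
  \<comment> \<open>The 14 in the hypothesis is twice the constant 7 of the bound on
    \<open>Z\<close>; the extra power of \<open>k\<close> pays for \<open>1 / mu\<close>.\<close>
  have Z_mu: "norm Z \<le> mu / 2"
  proof -
    have "1 \<le> k * mu" using k_bounds(7) mu(1) by (simp add: field_simps)
    have "2 * k * norm Z \<le> 2 * k * (7 * k ^ 4 * (u L)\<^sup>2 * norm H)" using Z k1 by (intro mult_left_mono) auto
    also have "\<dots> = 14 * k ^ 5 * (u L)\<^sup>2 * norm H" by (simp add: numeral_eq_Suc)
    also have "\<dots> \<le> k * mu" using H \<open>1 \<le> k * mu\<close> by simp
    finally have "k * (2 * norm Z) \<le> k * mu" by simp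
    then show ?thesis using k1 by simp
  qed
  have S_F: "?S - ?F ?S = S0 - Z" using \<Sigma>_eq[OF L] by (simp add: Z_def algebra_simps)
  have "pos_semidef ((mu / 2) *\<^sub>R mat 1 - Z)" by (rule pos_semidef_norm_minus[OF Z_sym Z_mu])
  moreover have "S0 - Z - (mu / 2) *\<^sub>R mat 1 = S0 - mu *\<^sub>R mat 1 + ((mu / 2) *\<^sub>R mat 1 - Z)"
    by (simp add: vec_eq_iff)
  ultimately have half: "pos_semidef (S0 - Z - (mu / 2) *\<^sub>R mat 1)"
    using pos_semidef_add[OF mu(2)] by presburger
  show U': "L + H \<in> U"
    unfolding U_def mem_Collect_eq stable_operator_def
  proof (intro exI conjI)
    \<comment> \<open>\<open>?S - ?F ?S = S0 - Z\<close> is at least \<open>mu / 2\<close>, so the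
      factor \<open>2 / mu\<close> normalises it to the identity.\<close>
    show "pos_semidef ((2 / mu) *\<^sub>R ?S)" using mu \<Sigma>_psd[OF L] by (intro pos_semidef_scaleR) auto
    have "(2 / mu) *\<^sub>R ?S - ?F ((2 / mu) *\<^sub>R ?S) = (2 / mu) *\<^sub>R (S0 - Z)"
      unfolding linear_scale[OF pos_operator_linear[OF F_pos]] S_F[symmetric] by (simp add: scaleR_diff_right)
    then have "(2 / mu) *\<^sub>R ?S - ?F ((2 / mu) *\<^sub>R ?S) - mat 1 = (2 / mu) *\<^sub>R (S0 - Z - (mu / 2) *\<^sub>R mat 1)"
      using mu(1) by (simp add: scaleR_diff_right)
    moreover have "pos_semidef ((2 / mu) *\<^sub>R (S0 - Z - (mu / 2) *\<^sub>R mat 1))"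
      using mu(1) half by (intro pos_semidef_scaleR) auto
    ultimately show "pos_semidef ((2 / mu) *\<^sub>R ?S - ?F ((2 / mu) *\<^sub>R ?S) - mat 1)" by simp
  qed
  let ?S' = "\<Sigma> (L + H)"
  note F'_lin = pos_operator_linear[OF F_pos, of "L + H"]
  have stab: "stable_operator ?F" using U' by (simp add: U_def)
  have S'_psd: "pos_semidef ?S'" by (rule \<Sigma>_psd[OF U'])
  have S'_sym: "transpose ?S' = ?S'" by (rule pos_semidef_sym[OF S'_psd])
  have S'_F: "?S' - ?F ?S' = S0" using \<Sigma>_eq[OF U'] by (metis add_diff_cancel_left')
  define Y where "Y = ?S' - ?S"
  have Y_F: "Y - ?F Y = Z"
  proof -
    have "Y - ?F Y = (?S' - ?F ?S') - (?S - ?F ?S)"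
      unfolding Y_def linear_diff[OF F'_lin] by simp
    then show ?thesis unfolding S_F S'_F by simp
  qed
  have Y_sym: "transpose Y = Y" by (simp add: Y_def transpose_algebra S_sym S'_sym)
  \<comment> \<open>Comparison applies because the right-hand side for
    \<open>2 *\<^sub>R ?S - ?S'\<close> is
    \<open>2 *\<^sub>R (S0 - Z) - S0 = S0 - 2 *\<^sub>R Z\<close>, which is semidefinite by the
    bound \<open>mu / 2\<close>.\<close>
  have "pos_semidef (2 *\<^sub>R ?S - ?S')"
  proof (rule stable_operator_comparison[OF F_pos stab])
    show "transpose (2 *\<^sub>R ?S - ?S') = 2 *\<^sub>R ?S - ?S'" by (simp add: transpose_algebra S_sym S'_sym)
    have "2 *\<^sub>R ?S - ?S' - ?F (2 *\<^sub>R ?S - ?S') = 2 *\<^sub>R (?S - ?F ?S) - (?S' - ?F ?S')"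
      unfolding linear_diff[OF F'_lin] linear_scale[OF F'_lin] by (simp add: algebra_simps)
    also have "\<dots> = (S0 - mu *\<^sub>R mat 1) + 2 *\<^sub>R ((mu / 2) *\<^sub>R mat 1 - Z)"
      unfolding S_F S'_F by (simp add: algebra_simps scaleR_2)
    finally show "pos_semidef (2 *\<^sub>R ?S - ?S' - ?F (2 *\<^sub>R ?S - ?S'))"
      using pos_semidef_add[OF mu(2) pos_semidef_scaleR[OF pos_semidef_norm_minus(1)[OF Z_sym Z_mu], of 2]]
      by simp
  qed
  from trace_mono[OF this] have tr': "trace ?S' \<le> 2 * (k * u L)"
    using trace_\<Sigma>_le[OF L] by (simp add: trace_scaleR)
  have Y: "norm Y \<le> 42 * k ^ 6 * u L ^ 3 * norm H"
  proof -
    \<comment> \<open>With this \<open>d\<close>, \<open>d *\<^sub>R S0\<close> dominates both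
      \<open>Z\<close> and \<open>- Z\<close>. As \<open>Y\<close> solves the Lyapunov equation with
      right-hand side \<open>Z\<close>, the matrix \<open>d *\<^sub>R ?S'\<close> then dominates
      \<open>Y\<close> and \<open>- Y\<close>.\<close>
    define d where "d = norm Z / mu"
    have d0: "0 \<le> d" using mu(1) by (simp add: d_def)
    have dS0: "pos_semidef (d *\<^sub>R S0 - norm Z *\<^sub>R mat 1)"
      using pos_semidef_scaleR[OF mu(2) d0] mu(1) by (simp add: d_def scaleR_diff_right)
    have "pos_semidef (d *\<^sub>R ?S' - Y)"
    proof (rule stable_operator_comparison[OF F_pos stab])
      show "transpose (d *\<^sub>R ?S' - Y) = d *\<^sub>R ?S' - Y" by (simp add: transpose_algebra S'_sym Y_sym)
      have "d *\<^sub>R ?S' - Y - ?F (d *\<^sub>R ?S' - Y) = d *\<^sub>R (?S' - ?F ?S') - (Y - ?F Y)"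
        unfolding linear_diff[OF F'_lin] linear_scale[OF F'_lin] by (simp add: algebra_simps)
      also have "\<dots> = (d *\<^sub>R S0 - norm Z *\<^sub>R mat 1) + (norm Z *\<^sub>R mat 1 - Z)" by (simp add: S'_F Y_F)
      finally show "pos_semidef (d *\<^sub>R ?S' - Y - ?F (d *\<^sub>R ?S' - Y))"
        using pos_semidef_add[OF dS0 pos_semidef_norm_minus(1)[OF Z_sym order_refl]] by simp
    qed
    moreover have "pos_semidef (d *\<^sub>R ?S' + Y)"
    proof (rule stable_operator_comparison[OF F_pos stab])
      show "transpose (d *\<^sub>R ?S' + Y) = d *\<^sub>R ?S' + Y" by (simp add: transpose_algebra S'_sym Y_sym)
      have "d *\<^sub>R ?S' + Y - ?F (d *\<^sub>R ?S' + Y) = d *\<^sub>R (?S' - ?F ?S') + (Y - ?F Y)"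
        unfolding linear_add[OF F'_lin] linear_scale[OF F'_lin] by (simp add: algebra_simps)
      also have "\<dots> = (d *\<^sub>R S0 - norm Z *\<^sub>R mat 1) + (norm Z *\<^sub>R mat 1 + Z)" by (simp add: S'_F Y_F)
      finally show "pos_semidef (d *\<^sub>R ?S' + Y - ?F (d *\<^sub>R ?S' + Y))"
        using pos_semidef_add[OF dS0 pos_semidef_norm_minus(2)[OF Z_sym order_refl]] by simp
    qed
    ultimately have "norm Y \<le> 3 * trace (d *\<^sub>R ?S')" by (rule norm_sandwich)
    also have "\<dots> = 3 * (d * trace ?S')" by (simp add: trace_scaleR)
    also have "\<dots> \<le> 3 * ((k * (7 * k ^ 4 * (u L)\<^sup>2 * norm H)) * (2 * (k * u L)))"
    proof -
      have "d \<le> k * norm Z"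
        using k_bounds(7) mult_right_mono[of "1 / mu" k "norm Z"] by (simp add: d_def)
      also have "\<dots> \<le> k * (7 * k ^ 4 * (u L)\<^sup>2 * norm H)" using Z k1 by (intro mult_left_mono) auto
      finally show ?thesis
        using tr' k1 u1 trace_nonneg[OF S'_psd] by (intro mult_left_mono mult_mono) auto
    qed
    also have "\<dots> = 42 * k ^ 6 * u L ^ 3 * norm H" by (simp add: numeral_eq_Suc)
    finally show ?thesis .
  qed
  have "J (L + H) - J L - D L \<bullet> H = 2 * ((E L ** Y) \<bullet> H) + (G L ** H ** ?S') \<bullet> H"
    unfolding J_diff[OF L U'] by (simp add: Y_def D_def matrix_mult_algebra inner_diff_left)
  also have "\<bar>\<dots>\<bar> \<le> 2 * (norm (E L) * norm Y * norm H) + norm (G L) * norm H * norm ?S' * norm H"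
  proof -
    have "\<bar>(E L ** Y) \<bullet> H\<bar> \<le> norm (E L) * norm Y * norm H"
      by (rule order_trans[OF Cauchy_Schwarz_ineq2]) (intro mult_right_mono norm_matrix_mult_le norm_ge_zero)
    moreover have "\<bar>(G L ** H ** ?S') \<bullet> H\<bar> \<le> norm (G L) * norm H * norm ?S' * norm H"
      by (rule order_trans[OF Cauchy_Schwarz_ineq2])
        (intro mult_right_mono order_trans[OF norm_matrix_mult_le] norm_matrix_mult_le norm_ge_zero)
    ultimately show ?thesis by linarith
  qed
  \<comment> \<open>The first term yields \<open>2 * 4 * 42 = 336\<close> and the power
    \<open>u L ^ 5\<close>; the second contributes the remaining 4 and is of lower order.\<close>
  also have "\<dots> \<le> 2 * ((4 * k ^ 4 * (u L)\<^sup>2) * (42 * k ^ 6 * u L ^ 3 * norm H) * norm H)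
      + (2 * k\<^sup>2 * u L) * norm H * (2 * (k * u L)) * norm H"
    using k1 u1 Y norm_E_le[OF L] norm_G_le[OF L] order_trans[OF norm_le_trace[OF S'_psd] tr']
    by (intro add_mono mult_mono) auto
  also have "\<dots> = 336 * (k ^ 10 * u L ^ 5 * (norm H)\<^sup>2) + 4 * ((k ^ 3 * u L ^ 2) * (norm H)\<^sup>2)"
    by (simp add: numeral_eq_Suc)
  also have "\<dots> \<le> 336 * (k ^ 10 * u L ^ 5 * (norm H)\<^sup>2) + 4 * ((k ^ 10 * u L ^ 5) * (norm H)\<^sup>2)"
    using ku[of 3 10 2 5] by (intro add_left_mono mult_left_mono mult_right_mono) auto
  finally show "\<bar>J (L + H) - J L - D L \<bullet> H\<bar> \<le> 340 * k ^ 10 * u L ^ 5 * (norm H)\<^sup>2"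
    by (simp add: mult_ac)
qed

end

section \<open>Gradient dominance and convergence\<close>

lemma GDERIV_unique: "GDERIV f x :> D \<Longrightarrow> GDERIV f x :> D' \<Longrightarrow> D = D'"
  unfolding gderiv_def
  by (metis (no_types, lifting) has_derivative_unique inner_commute vector_eq_rdot)

lemma grad_eq: "GDERIV f x :> D \<Longrightarrow> grad f x = D"
  unfolding grad_def by (blast intro: GDERIV_unique)

context lq_bounded
begin

lemma perturbation_radius:
  assumes L: "L \<in> U"
  obtains r where "0 < r" "\<And>H :: real ^ 'n ^ 'm. norm H \<le> r \<Longrightarrow> 14 * k ^ 5 * (u L)\<^sup>2 * norm H \<le> 1"
proof
  have p: "0 < 14 * k ^ 5 * (u L)\<^sup>2" using k_bounds(1) u_ge[OF L] by simp
  then show "0 < 1 / (14 * k ^ 5 * (u L)\<^sup>2)" by simp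
  fix H :: "real ^ 'n ^ 'm"
  assume "norm H \<le> 1 / (14 * k ^ 5 * (u L)\<^sup>2)"
  then show "14 * k ^ 5 * (u L)\<^sup>2 * norm H \<le> 1" using p by (simp add: pos_le_divide_eq mult.commute)
qed

lemma open_U: "open U"
  unfolding open_dist
proof
  fix L assume L: "L \<in> U"
  obtain r where r: "0 < r" "\<And>H :: real ^ 'n ^ 'm. norm H \<le> r \<Longrightarrow> 14 * k ^ 5 * (u L)\<^sup>2 * norm H \<le> 1"
    using perturbation_radius[OF L] by metis
  have "L' \<in> U" if "dist L' L < r" for L'
    using perturbation(1)[OF L r(2), of "L' - L"] that by (simp add: dist_norm)
  then show "\<exists>e>0. \<forall>L'. dist L' L < e \<longrightarrow> L' \<in> U" using r(1) by blast
qed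

lemma GDERIV_J:
  assumes L: "L \<in> U"
  shows "GDERIV J L :> D L"
  unfolding gderiv_def has_derivative_at
proof
  show "bounded_linear (\<lambda>h. h \<bullet> D L)" by (rule bounded_linear_inner_left)
  obtain r where r: "0 < r" "\<And>H :: real ^ 'n ^ 'm. norm H \<le> r \<Longrightarrow> 14 * k ^ 5 * (u L)\<^sup>2 * norm H \<le> 1"
    using perturbation_radius[OF L] by metis
  let ?c = "340 * k ^ 10 * u L ^ 5"
  have le: "norm (J (L + H) - J L - H \<bullet> D L) / norm H \<le> ?c * norm H" if "norm H < r" for H
  proof (cases "H = 0")
    case False
    then show ?thesis
      using perturbation(2)[OF L r(2), of H] that
      by (simp add: inner_commute[of H] pos_divide_le_eq power2_eq_square mult.assoc less_imp_le)
  qed simp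
  have "((\<lambda>H :: real ^ 'n ^ 'm. ?c * norm H) \<longlongrightarrow> ?c * norm (0 :: real ^ 'n ^ 'm)) (at 0)"
    by (intro tendsto_intros)
  then have lim: "((\<lambda>H :: real ^ 'n ^ 'm. ?c * norm H) \<longlongrightarrow> 0) (at 0)" by simp
  have ev: "\<forall>\<^sub>F H in at 0. norm (J (L + H) - J L - H \<bullet> D L) / norm H \<le> ?c * norm H"
    using r(1) le unfolding eventually_at by (auto simp: dist_norm)
  show "(\<lambda>H. norm (J (L + H) - J L - H \<bullet> D L) / norm H) \<midarrow>0\<rightarrow> 0"
    by (rule tendsto_sandwich[OF _ ev tendsto_const lim]) simp
qed

text \<open>The number 680 is twice the remainder constant 340: the quadratic error then costs at
  most half of the first-order decrease.\<close>

lemma descent: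
  assumes L: "L \<in> U" and eta: "0 < eta" "680 * k ^ 10 * u L ^ 5 * eta \<le> 1"
  shows "L - eta *\<^sub>R D L \<in> U" "J (L - eta *\<^sub>R D L) \<le> J L - eta / 2 * (norm (D L))\<^sup>2"
proof -
  define H where "H = - (eta *\<^sub>R D L)"
  have nH: "norm H = eta * norm (D L)" using eta by (simp add: H_def)
  have p: "0 \<le> k ^ 10 * u L ^ 5 * eta" using k_bounds(1) u_ge[OF L] eta by simp
  \<comment> \<open>The step must also lie within the perturbation radius. The gradient bound gives
    the constant \<open>14 * 8 = 112\<close>, which is below 680.\<close>
  have "14 * k ^ 5 * (u L)\<^sup>2 * norm H \<le> 14 * k ^ 5 * (u L)\<^sup>2 * (eta * (8 * k ^ 5 * u L ^ 3))"
    unfolding nH using k_bounds(1) u_ge[OF L] eta norm_D_le[OF L] by (intro mult_left_mono) auto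
  also have "\<dots> = 112 * (k ^ 10 * u L ^ 5 * eta)" by (simp add: numeral_eq_Suc)
  also have "\<dots> \<le> 1" using eta(2) p by (simp add: mult.assoc)
  finally have H: "14 * k ^ 5 * (u L)\<^sup>2 * norm H \<le> 1" .
  have LH: "L - eta *\<^sub>R D L = L + H" by (simp add: H_def)
  show "L - eta *\<^sub>R D L \<in> U" unfolding LH by (rule perturbation(1)[OF L H])
  have "J (L + H) - J L \<le> D L \<bullet> H + 340 * k ^ 10 * u L ^ 5 * (norm H)\<^sup>2"
    using perturbation(2)[OF L H] by linarith
  also have "D L \<bullet> H = - (eta * (norm (D L))\<^sup>2)" by (simp add: H_def power2_norm_eq_inner)
  also have "340 * k ^ 10 * u L ^ 5 * (norm H)\<^sup>2 =
      (680 * k ^ 10 * u L ^ 5 * eta) * (eta / 2 * (norm (D L))\<^sup>2)"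
    unfolding nH by (simp add: power2_eq_square)
  also have "\<dots> \<le> 1 * (eta / 2 * (norm (D L))\<^sup>2)" using eta by (intro mult_right_mono) auto
  finally show "J (L - eta *\<^sub>R D L) \<le> J L - eta / 2 * (norm (D L))\<^sup>2"
    unfolding LH by simp
qed

lemma G_lower:
  assumes L: "L \<in> U" and S: "pos_semidef S"
  shows "sR * ((H ** S) \<bullet> H) \<le> (G L ** H ** S) \<bullet> H"
proof -
  have S_sym: "transpose S = S" by (rule pos_semidef_sym[OF S])
  have "pos_semidef (W L)"
    unfolding W_def by (intro integral_pos_semidef W_integrable pos_semidef_congruence' P_psd L)
  from pos_semidef_add[OF sR(2) this] have "pos_semidef (G L - sR *\<^sub>R mat 1)"
    by (simp add: G_def algebra_simps)
  then have "sR * trace (H ** S ** transpose H) \<le> G L \<bullet> (H ** S ** transpose H)"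
    by (intro inner_ge_trace pos_semidef_congruence S)
  moreover have "trace (H ** S ** transpose H) = (H ** S) \<bullet> H"
    by (simp add: trace_eq_inner inner_commute[of "mat 1"] inner_mult_right[of _ "transpose H"])
  moreover have "(G L ** H ** S) \<bullet> H = G L \<bullet> (H ** S ** transpose H)"
    unfolding matrix_mul_assoc[symmetric]
    by (simp add: inner_mult_right[of "G L"] matrix_transpose_mul S_sym)
  ultimately show ?thesis by simp
qed

lemma norm_E_le_norm_D:
  assumes L: "L \<in> U"
  shows "2 * mu * norm (E L) \<le> norm (D L)"
  using norm_mult_ge[OF \<Sigma>_ge[OF L], of "E L"] mu(1) by (simp add: D_def)

text \<open>Completing the square in \<open>H = L' - L\<close>.\<close>

lemma gradient_dominance:
  assumes L: "L \<in> U" and L': "L' \<in> U"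
  shows "4 * mu\<^sup>2 * sR * (J L - J L') \<le> op_norm (\<Sigma> L') * (norm (D L))\<^sup>2"
proof -
  let ?S = "\<Sigma> L'" and ?E = "E L" and ?H = "L' - L"
  have S: "pos_semidef ?S" by (rule \<Sigma>_psd[OF L'])
  note S_sym = pos_semidef_sym[OF S]
  have diff: "J L' - J L = 2 * ((?E ** ?S) \<bullet> ?H) + (G L ** ?H ** ?S) \<bullet> ?H"
    using J_diff[OF L, of ?H] L' by simp
  have form: "(X ** ?S) \<bullet> X = ?S \<bullet> (transpose X ** X)" for X :: "real ^ 'n ^ 'm"
    using inner_mult_left[of X ?S X] by simp
  have gram: "pos_semidef (transpose X ** X)" "trace (transpose X ** X) = (norm X)\<^sup>2" for X :: "real ^ 'n ^ 'm"
    using pos_semidef_congruence'[of "mat 1" X]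
    by (simp_all add: trace_eq_inner inner_commute[of "mat 1"] inner_mult_left power2_norm_eq_inner)
  have cross: "(?H ** ?S) \<bullet> ?E = (?E ** ?S) \<bullet> ?H"
    using inner_mult_right[of ?E ?S ?H] S_sym by (simp add: inner_commute)
  \<comment> \<open>This square is weighted by \<open>?S\<close>. Its quadratic part in
    \<open>?H\<close> is at most \<open>sR\<close> times the \<open>G L\<close> term, so together
    with the cross term it is at most \<open>sR * (J L' - J L)\<close>.\<close>
  have "0 \<le> ((sR *\<^sub>R ?H + ?E) ** ?S) \<bullet> (sR *\<^sub>R ?H + ?E)"
    unfolding form by (intro inner_pos_semidef_nonneg S gram)
  also have "\<dots> = sR * (sR * ((?H ** ?S) \<bullet> ?H)) + sR * (2 * ((?E ** ?S) \<bullet> ?H)) + (?E ** ?S) \<bullet> ?E"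
    using cross by (simp add: matrix_mult_algebra(1,7) inner_add_left inner_add_right distrib_left)
  also have "(?E ** ?S) \<bullet> ?E \<le> op_norm ?S * (norm ?E)\<^sup>2"
    unfolding form gram(2)[symmetric] by (intro inner_le_trace pos_semidef_op_norm_minus S gram(1))
  also have "sR * (sR * ((?H ** ?S) \<bullet> ?H)) \<le> sR * ((G L ** ?H ** ?S) \<bullet> ?H)"
    using sR(1) by (intro mult_left_mono G_lower L S) auto
  finally have "0 \<le> sR * (J L' - J L) + op_norm ?S * (norm ?E)\<^sup>2"
    unfolding diff by (simp add: algebra_simps)
  then have "4 * mu\<^sup>2 * (sR * (J L - J L')) \<le> 4 * mu\<^sup>2 * (op_norm ?S * (norm ?E)\<^sup>2)"
    by (intro mult_left_mono) (auto simp: algebra_simps)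
  also have "\<dots> = op_norm ?S * (2 * mu * norm ?E)\<^sup>2" by (simp add: power_mult_distrib)
  also have "\<dots> \<le> op_norm ?S * (norm (D L))\<^sup>2"
    using norm_E_le_norm_D[OF L] mu(1) by (intro mult_left_mono power_mono op_norm_nonneg) auto
  finally show ?thesis by (simp add: mult.assoc)
qed

text \<open>A descent step from \<open>L\<close> stays in \<open>U\<close> and would lower
  \<open>J\<close> unless \<open>D L = 0\<close>. As \<open>\<Sigma> L \<ge> mu\<close>, the
  vanishing passes to \<open>E L\<close>.\<close>

lemma stationary_of_minimal:
  assumes L: "L \<in> U" and min: "\<And>L'. L' \<in> U \<Longrightarrow> J L \<le> J L'"
  shows "E L = 0"
proof -
  define eta where "eta = 1 / (680 * k ^ 10 * u L ^ 5)"
  have "0 < 680 * k ^ 10 * u L ^ 5" using k_bounds(1) u_ge[OF L] by simp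
  then have eta: "0 < eta" "680 * k ^ 10 * u L ^ 5 * eta \<le> 1" by (auto simp: eta_def)
  have "eta / 2 * (norm (D L))\<^sup>2 \<le> 0"
    using descent[OF L eta] min[of "L - eta *\<^sub>R D L"] by linarith
  then have "(norm (D L))\<^sup>2 \<le> 0" using eta(1) by (simp add: mult_le_0_iff)
  then have "norm (D L) = 0" by simp
  then show ?thesis using norm_E_le_norm_D[OF L] mu(1) by (simp add: mult_le_0_iff)
qed

text \<open>At a minimiser the linear term of \<open>J_diff\<close> vanishes, and the remaining form
  is bounded below by \<open>G L \<ge> sR\<close> and \<open>\<Sigma> L' \<ge> mu\<close>. This
  turns convergence of costs into convergence of gains.\<close>

lemma quadratic_growth:
  assumes L: "L \<in> U" and L': "L' \<in> U" and min: "\<And>L'. L' \<in> U \<Longrightarrow> J L \<le> J L'"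
  shows "sR * mu * (norm (L' - L))\<^sup>2 \<le> J L' - J L"
proof -
  let ?H = "L' - L" and ?S = "\<Sigma> L'"
  have "J L' - J L = (G L ** ?H ** ?S) \<bullet> ?H"
    using J_diff[OF L, of ?H] L' by (simp add: stationary_of_minimal[OF L min] bounded_bilinear.zero_left[OF bounded_bilinear_matrix_mult])
  moreover have "sR * ((?H ** ?S) \<bullet> ?H) \<le> \<dots>" by (intro G_lower L \<Sigma>_psd L')
  moreover have "mu * (norm ?H)\<^sup>2 \<le> (?H ** ?S) \<bullet> ?H"
  proof -
    have "mu * trace (transpose ?H ** ?H) \<le> ?S \<bullet> (transpose ?H ** ?H)"
      using pos_semidef_congruence'[of "mat 1" ?H] by (intro inner_ge_trace \<Sigma>_ge L') simp
    then show ?thesis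
      using inner_mult_left[of ?H ?S ?H]
      by (simp add: trace_eq_inner inner_commute[of "mat 1"] inner_mult_left power2_norm_eq_inner)
  qed
  then have "sR * (mu * (norm ?H)\<^sup>2) \<le> sR * ((?H ** ?S) \<bullet> ?H)"
    using sR(1) by (intro mult_left_mono) auto
  ultimately show ?thesis by (simp add: mult.assoc)
qed

lemma continuous_on_J: "continuous_on U J"
  using GDERIV_J unfolding gderiv_def
  by (auto intro!: continuous_at_imp_continuous_on has_derivative_continuous)

text \<open>The sublevel set of \<open>L0\<close> is compact. Closedness is the delicate part, since
  a limit of gains in the open set \<open>U\<close> could a priori be non-stabilising.\<close>

lemma minimiser_exists:
  assumes L0: "L0 \<in> U"
  shows "\<exists>L\<in>U. \<forall>L'\<in>U. J L \<le> J L'"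
proof -
  define S where "S = {L \<in> U. J L \<le> J L0}"
  have S_U: "L \<in> U" and S_u: "u L \<le> u L0" if "L \<in> S" for L using that by (auto simp: S_def u_def)
  have "bounded S"
  proof -
    have "(norm L)\<^sup>2 \<le> k\<^sup>2 * u L0" if "L \<in> S" for L
      by (rule order_trans[OF norm_L_power2_le[OF S_U[OF that]] mult_left_mono[OF S_u[OF that]]]) simp
    then have "norm L \<le> sqrt (k\<^sup>2 * u L0)" if "L \<in> S" for L using that by (auto intro: real_le_rsqrt)
    then show ?thesis unfolding bounded_iff by blast
  qed
  moreover have "closed S"
    unfolding closed_sequential_limits
  proof (intro allI impI, elim conjE)
    fix X L assume X: "\<forall>n. X n \<in> S" and lim: "X \<longlonglongrightarrow> L"
    obtain r where r: "0 < r" "\<And>H :: real ^ 'n ^ 'm. norm H \<le> r \<Longrightarrow> 14 * k ^ 5 * (u L0)\<^sup>2 * norm H \<le> 1"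
      using perturbation_radius[OF L0] by metis
    obtain n where n: "dist (X n) L < r" using LIMSEQ_D[OF lim r(1)] by (auto simp: dist_norm)
    \<comment> \<open>The limit is viewed as a perturbation of a late member of the sequence. The
      radius \<open>r\<close> obtained from \<open>u L0\<close> is valid there because
      \<open>u (X n) \<le> u L0\<close>.\<close>
    let ?H = "L - X n"
    have "14 * k ^ 5 * (u (X n))\<^sup>2 * norm ?H \<le> 14 * k ^ 5 * (u L0)\<^sup>2 * norm ?H"
      using X k_bounds(1) u_ge[OF S_U] S_u by (intro mult_right_mono mult_left_mono power_mono) (auto intro: order_trans[of 0 1])
    also have "\<dots> \<le> 1" using r(2)[of ?H] n by (simp add: dist_norm norm_minus_commute)
    finally have L: "L \<in> U" using perturbation(1)[of "X n" ?H] X S_U by simp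
    then have "isCont J L" using GDERIV_J has_derivative_continuous unfolding gderiv_def by blast
    then have "(\<lambda>n. J (X n)) \<longlonglongrightarrow> J L" using lim by (rule isCont_tendsto_compose)
    then have "J L \<le> J L0" using X by (intro LIMSEQ_le_const2[of "\<lambda>n. J (X n)"]) (auto simp: S_def)
    then show "L \<in> S" using L by (simp add: S_def)
  qed
  ultimately have "compact S" by (simp add: compact_eq_bounded_closed)
  moreover have "S \<noteq> {}" "continuous_on S J"
    using L0 continuous_on_subset[OF continuous_on_J] by (auto simp: S_def)
  ultimately obtain L where L: "L \<in> S" "\<forall>L'\<in>S. J L \<le> J L'"
    using continuous_attains_inf by blast
  have "J L \<le> J L'" if "L' \<in> U" for L'
    using L that by (cases "L' \<in> S") (auto simp: S_def)
  then show ?thesis using L(1) S_U by blast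
qed

text \<open>\<open>C\<close> is only assumed to agree with \<open>J\<close> on \<open>U\<close>,
  because the actual cost may take default values elsewhere. Openness of \<open>U\<close> still
  transfers the derivative.\<close>

lemma gradient_descent:
  fixes C :: "real ^ 'n ^ 'm \<Rightarrow> real" and eta :: real
  assumes C: "\<And>L. L \<in> U \<Longrightarrow> C L = J L" and L0: "L0 \<in> U"
    and eta: "0 < eta" "680 * k ^ 10 * (1 + C L0) ^ 5 * eta \<le> 1"
  defines "Lopt \<equiv> arg_min_on C U"
  defines "S \<equiv> op_norm (\<Sigma> Lopt)"
  defines "L \<equiv> policy_gradient C eta L0"
  shows "is_arg_min C (\<lambda>L. L \<in> U) Lopt"
    and "L n \<in> U \<and> C differentiable (at (L n))"
    and "L \<longlonglongrightarrow> Lopt"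
    and "C (L (Suc n)) - C Lopt \<le> (1 - 2 * eta * (mu\<^sup>2 * sR / S)) * (C (L n) - C Lopt)"
    and "0 < e \<Longrightarrow> S / (2 * eta * mu\<^sup>2 * sR) * ln ((C L0 - C Lopt) / e) \<le> real n \<Longrightarrow>
      \<not> (n = 0 \<and> C L0 - C Lopt = e) \<Longrightarrow> C (L n) - C Lopt < e"
proof -
  have GC: "GDERIV C L :> D L" if "L \<in> U" for L
    using GDERIV_J[OF that] unfolding gderiv_def
    by (rule has_derivative_transform_within_open[OF _ open_U that]) (simp add: C)
  \<comment> \<open>\<open>arg_min_on\<close> is a choice operator, so \<open>Lopt\<close> has its
    defining property only once some minimiser exists.\<close>
  obtain L1 where "L1 \<in> U" "\<And>L'. L' \<in> U \<Longrightarrow> J L1 \<le> J L'" using minimiser_exists[OF L0] by blast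
  then have "is_arg_min C (\<lambda>L. L \<in> U) L1" by (auto simp: is_arg_min_def C not_less)
  then show min: "is_arg_min C (\<lambda>L. L \<in> U) Lopt"
    unfolding Lopt_def arg_min_on_def arg_min_def by (rule someI)
  then have Lopt: "Lopt \<in> U" and opt: "\<And>L'. L' \<in> U \<Longrightarrow> J Lopt \<le> J L'"
    by (auto simp: is_arg_min_def C not_less)
  have step: "L (Suc n) = L n - eta *\<^sub>R D (L n)" if "L n \<in> U" for n
    using grad_eq[OF GC[OF that]] by (simp add: L_def)
  \<comment> \<open>The step size is fixed by the initial cost; it remains admissible as long as the
    cost has not increased.\<close>
  have eta_n: "680 * k ^ 10 * u L' ^ 5 * eta \<le> 1" if "L' \<in> U" "J L' \<le> J L0" for L'
  proof -
    have "680 * k ^ 10 * u L' ^ 5 * eta \<le> 680 * k ^ 10 * (1 + C L0) ^ 5 * eta"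
      using that eta(1) k_bounds(1) u_ge[OF that(1)] unfolding C[OF L0]
      by (intro mult_right_mono mult_left_mono power_mono) (auto simp: u_def)
    then show ?thesis using eta(2) by simp
  qed
  have inv: "L n \<in> U \<and> J (L n) \<le> J L0" for n
  proof (induction n)
    case 0
    then show ?case using L0 by (simp add: L_def)
  next
    case (Suc n)
    then have Ln: "L n \<in> U" and Jn: "J (L n) \<le> J L0" by auto
    have "0 \<le> eta / 2 * (norm (D (L n)))\<^sup>2" using eta(1) by simp
    then show ?case using descent[OF Ln eta(1) eta_n[OF Ln Jn]] Jn unfolding step[OF Ln] by auto
  qed
  then have LU: "L n \<in> U" for n by blast
  show "L n \<in> U \<and> C differentiable (at (L n))"
    using LU GC[OF LU[of n]] unfolding gderiv_def differentiable_def by blast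
  have S: "mu \<le> S" unfolding S_def by (rule op_norm_ge[OF \<Sigma>_ge[OF Lopt]])
  then have S0: "0 < S" using mu(1) by simp
  define x where "x = 2 * eta * (mu\<^sup>2 * sR / S)"
  have x0: "0 < x" using eta(1) mu(1) sR(1) S0 by (simp add: x_def)
  \<comment> \<open>Nonnegativity of \<open>1 - x\<close> allows the one-step estimate to be
    iterated. It follows from \<open>mu \<le> S\<close>, \<open>mu \<le> k\<close> and
    \<open>sR \<le> k\<close>.\<close>
  have x1: "x \<le> 1"
  proof -
    have "mu\<^sup>2 * sR \<le> (k * k) * S"
    proof -
      have "mu\<^sup>2 * sR = (mu * sR) * mu" by (simp add: power2_eq_square)
      also have "\<dots> \<le> (k * k) * S" using S mu(1) sR(1) k_bounds by (intro mult_mono) auto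
      finally show ?thesis .
    qed
    then have "mu\<^sup>2 * sR / S \<le> k * k" using S0 by (simp add: pos_divide_le_eq)
    then have "x \<le> 2 * eta * (k * k)" unfolding x_def using eta(1) by (intro mult_left_mono) auto
    also have "\<dots> = 2 * (k ^ 2 * u L0 ^ 0) * eta" by (simp add: power2_eq_square)
    also have "\<dots> \<le> 680 * (k ^ 10 * u L0 ^ 5) * eta"
    proof (rule mult_right_mono)
      have "0 \<le> k ^ 2 * u L0 ^ 0" by simp
      then show "2 * (k ^ 2 * u L0 ^ 0) \<le> 680 * (k ^ 10 * u L0 ^ 5)"
        using power_product_mono[OF k_bounds(1) u_ge[OF L0], of 2 10 0 5] by linarith
    qed (use eta(1) in simp)
    also have "\<dots> \<le> 1" using eta(2) by (simp add: C[OF L0] u_def mult.assoc)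
    finally show ?thesis .
  qed
  define d where "d n = C (L n) - C Lopt" for n
  have d0: "0 \<le> d n" for n using opt[OF LU] by (simp add: d_def C LU Lopt)
  have rate: "d (Suc n) \<le> (1 - x) * d n" for n
  proof -
    have "J (L (Suc n)) \<le> J (L n) - eta / 2 * (norm (D (L n)))\<^sup>2"
      unfolding step[OF LU] using inv[of n] by (intro descent(2) eta eta_n) auto
    moreover have "x * (J (L n) - J Lopt) \<le> eta / 2 * (norm (D (L n)))\<^sup>2"
    proof -
      \<comment> \<open>The factor 4 of gradient dominance and the \<open>1 / 2\<close> of the
        descent inequality combine to the 2 in the rate.\<close>
      have "eta / 2 / S * (4 * mu\<^sup>2 * sR * (J (L n) - J Lopt)) \<le> eta / 2 / S * (S * (norm (D (L n)))\<^sup>2)"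
        using gradient_dominance[OF LU Lopt, of n] eta(1) S0 by (intro mult_left_mono) (auto simp: S_def)
      then show ?thesis using S0 by (simp add: x_def mult_ac)
    qed
    ultimately show ?thesis by (simp add: d_def C LU Lopt algebra_simps)
  qed
  then show "C (L (Suc n)) - C Lopt \<le> (1 - 2 * eta * (mu\<^sup>2 * sR / S)) * (C (L n) - C Lopt)"
    by (simp add: d_def x_def)
  have pow: "d n \<le> (1 - x) ^ n * d 0" for n
  proof (induction n)
    case (Suc n)
    have "d (Suc n) \<le> (1 - x) * d n" by (rule rate)
    also have "\<dots> \<le> (1 - x) * ((1 - x) ^ n * d 0)" using Suc x1 by (intro mult_left_mono) auto
    finally show ?case by (simp add: mult.assoc)
  qed simp
  show "L \<longlonglongrightarrow> Lopt"
  proof -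
    have "(\<lambda>n. (1 - x) ^ n) \<longlonglongrightarrow> 0" using x0 x1 by (intro LIMSEQ_power_zero) auto
    from tendsto_mult_left_zero[OF this, of "d 0 / (sR * mu)"]
    have lim: "(\<lambda>n. (1 - x) ^ n * (d 0 / (sR * mu))) \<longlonglongrightarrow> 0" .
    have "(norm (L n - Lopt))\<^sup>2 \<le> (1 - x) ^ n * (d 0 / (sR * mu))" for n
    proof -
      have "sR * mu * (norm (L n - Lopt))\<^sup>2 \<le> d n"
        using quadratic_growth[OF Lopt LU opt] by (simp add: d_def C LU Lopt)
      also have "\<dots> \<le> (1 - x) ^ n * d 0" by (rule pow)
      finally have "(norm (L n - Lopt))\<^sup>2 * (sR * mu) \<le> (1 - x) ^ n * d 0" by (simp add: mult_ac)
      then show ?thesis using sR(1) mu(1) by (simp add: pos_le_divide_eq)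
    qed
    then have "(\<lambda>n. (norm (L n - Lopt))\<^sup>2) \<longlonglongrightarrow> 0"
      by (intro tendsto_sandwich[OF _ _ tendsto_const lim]) auto
    then have "(\<lambda>n. sqrt ((norm (L n - Lopt))\<^sup>2)) \<longlonglongrightarrow> sqrt 0" by (rule tendsto_real_sqrt)
    then have "(\<lambda>n. L n - Lopt) \<longlonglongrightarrow> 0" by (simp add: tendsto_norm_zero_iff)
    then show ?thesis by (rule LIM_zero_cancel)
  qed
  show "C (L n) - C Lopt < e"
    if e: "0 < e" and n: "S / (2 * eta * mu\<^sup>2 * sR) * ln ((C L0 - C Lopt) / e) \<le> real n"
      and exc: "\<not> (n = 0 \<and> C L0 - C Lopt = e)"
  \<comment> \<open>For a vanishing initial gap the logarithm is the default \<open>ln 0 = 0\<close>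
    and carries no information; the gap then stays nonpositive.\<close>
  proof (cases "d 0 = 0")
    case True
    then have "d n \<le> 0" using pow[of n] by simp
    then show ?thesis using e by (simp add: d_def)
  next
    case False
    then have d00: "0 < d 0" using d0[of 0] by simp
    have d_0: "C L0 - C Lopt = d 0" by (simp add: d_def L_def)
    have eq: "S / (2 * eta * mu\<^sup>2 * sR) = 1 / x" using S0 by (simp add: x_def)
    have "ln (d 0 / e) \<le> x * real n"
      using n x0 unfolding d_0 eq by (simp add: pos_divide_le_eq mult.commute)
    then have "exp (ln (d 0 / e)) \<le> exp (x * real n)" by simp
    then have "d 0 / e \<le> exp (x * real n)" using d00 e by simp
    then have le: "exp (- (x * real n)) * d 0 \<le> e" using e by (simp add: exp_minus field_simps)
    show ?thesis
    \<comment> \<open>For \<open>n = 0\<close> the iteration bound only gives an initial gap of at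
      most \<open>e\<close>, and \<open>exc\<close> rules out equality. For \<open>n > 0\<close>
      strictness comes from \<open>1 - x < exp (- x)\<close>.\<close>
    proof (cases "n = 0")
      case True
      then show ?thesis using le exc d_0 by (simp add: L_def)
    next
      case n0: False
      have "(1 - x) ^ n < exp (- x) ^ n"
        using x0 x1 n0 exp_minus_greater[of x] by (intro power_strict_mono) auto
      also have "exp (- x) ^ n = exp (- (x * real n))" by (simp add: exp_of_nat_mult[symmetric] mult.commute)
      finally have "(1 - x) ^ n * d 0 < exp (- (x * real n)) * d 0" using d00 by simp
      then show ?thesis using pow[of n] le by (simp add: d_def)
    qed
  qed
qed

end

section \<open>Moments of the closed loop\<close>

lemma sum_UNIV_Plus:
  fixes f :: "'n::finite + 'm::finite \<Rightarrow> 'a::comm_monoid_add"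
  shows "sum f UNIV = (\<Sum>i\<in>UNIV. f (Inl i)) + (\<Sum>i\<in>UNIV. f (Inr i))"
  by (subst UNIV_Plus_UNIV[symmetric], subst sum.Plus) (simp_all add: comp_def)

definition left_cols :: "real ^ ('n::finite + 'm::finite) ^ 'k \<Rightarrow> real ^ 'n ^ 'k" where
  "left_cols X = (\<chi> i j. X $ i $ Inl j)"

definition right_cols :: "real ^ ('n::finite + 'm::finite) ^ 'k \<Rightarrow> real ^ 'm ^ 'k" where
  "right_cols X = (\<chi> i j. X $ i $ Inr j)"

definition upper_block :: "real ^ ('n::finite + 'm::finite) ^ ('n + 'm) \<Rightarrow> real ^ 'n ^ 'n" where
  "upper_block X = (\<chi> i j. X $ Inl i $ Inl j)"

definition lower_block :: "real ^ ('n::finite + 'm::finite) ^ ('n + 'm) \<Rightarrow> real ^ 'm ^ 'm" where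
  "lower_block X = (\<chi> i j. X $ Inr i $ Inr j)"

text \<open>Measurability and integrability are assumed for the assembled matrices; linearity of the
  block projections carries them over to the blocks.\<close>

lemma bounded_linear_blocks:
  "bounded_linear (left_cols :: real ^ ('n::finite + 'm::finite) ^ 'k \<Rightarrow> real ^ 'n ^ 'k)"
  "bounded_linear (right_cols :: real ^ ('n::finite + 'm::finite) ^ 'k \<Rightarrow> real ^ 'm ^ 'k)"
  "bounded_linear (upper_block :: real ^ ('n::finite + 'm::finite) ^ ('n + 'm) \<Rightarrow> real ^ 'n ^ 'n)"
  "bounded_linear (lower_block :: real ^ ('n::finite + 'm::finite) ^ ('n + 'm) \<Rightarrow> real ^ 'm ^ 'm)"
  unfolding linear_conv_bounded_linear[symmetric]
  by (auto intro!: linearI simp: vec_eq_iff left_cols_def right_cols_def upper_block_def lower_block_def)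

lemma blocks [simp]:
  "left_cols (block_row A B) = A" "right_cols (block_row A B) = B"
  "upper_block (block_diag Q R) = Q" "lower_block (block_diag Q R) = R"
  by (simp_all add: vec_eq_iff left_cols_def right_cols_def upper_block_def lower_block_def
      block_row_def block_diag_def)

definition join_vec :: "real ^ 'n \<Rightarrow> real ^ 'm \<Rightarrow> real ^ ('n::finite + 'm::finite)" where
  "join_vec x y = (\<chi> i. case i of Inl k \<Rightarrow> x $ k | Inr k \<Rightarrow> y $ k)"

text \<open>A diagonal block is the restriction of the form to zero-padded vectors, hence it
  inherits definiteness.\<close>

lemma block_forms:
  "x \<bullet> (upper_block X *v x) = join_vec x 0 \<bullet> (X *v join_vec x 0)"
  "y \<bullet> (lower_block X *v y) = join_vec 0 y \<bullet> (X *v join_vec 0 y)"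
  by (simp_all add: inner_vec_def matrix_vector_mult_def sum_UNIV_Plus join_vec_def
      upper_block_def lower_block_def)

lemma join_vec_eq_0: "join_vec x y = 0 \<longleftrightarrow> x = 0 \<and> y = 0"
proof
  assume eq: "join_vec x y = 0"
  have "x $ i = join_vec x y $ Inl i" "y $ j = join_vec x y $ Inr j" for i j
    by (simp_all add: join_vec_def)
  then show "x = 0 \<and> y = 0" unfolding eq by (simp add: vec_eq_iff)
qed (auto simp: vec_eq_iff join_vec_def split: sum.splits)

lemma transpose_blocks:
  "transpose X = X \<Longrightarrow> transpose (upper_block X) = upper_block X"
  "transpose X = X \<Longrightarrow> transpose (lower_block X) = lower_block X"
  by (simp_all add: vec_eq_iff upper_block_def lower_block_def transpose_def)

lemma pos_semidef_blocks:
  assumes "pos_semidef X"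
  shows "pos_semidef (upper_block X)" "pos_semidef (lower_block X)"
  using assms by (simp_all add: pos_semidef_def block_forms transpose_blocks)

lemma pos_def_blocks:
  assumes "pos_def X"
  shows "pos_def (upper_block X)" "pos_def (lower_block X)"
  using assms by (simp_all add: pos_def_def block_forms transpose_blocks join_vec_eq_0)

section \<open>Exchange of expectation and series, measurability\<close>

lemma AE_summable_norm:
  fixes f :: "nat \<Rightarrow> 'w \<Rightarrow> 'b::{banach, second_countable_topology}"
  assumes f: "\<And>i. integrable M (f i)" and sum: "summable (\<lambda>i. \<integral>\<omega>. norm (f i \<omega>) \<partial>M)"
  shows "AE \<omega> in M. summable (\<lambda>i. norm (f i \<omega>))"
proof -
  have [measurable]: "\<And>i. f i \<in> borel_measurable M" using f by auto
  \<comment> \<open>Exchanging sum and integral for nonnegative functions shows that the sum of the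
    norms has finite expectation, hence is finite almost everywhere.\<close>
  have "(\<integral>\<^sup>+\<omega>. (\<Sum>i. ennreal (norm (f i \<omega>))) \<partial>M) = (\<Sum>i. \<integral>\<^sup>+\<omega>. ennreal (norm (f i \<omega>)) \<partial>M)"
    by (intro nn_integral_suminf) simp
  also have "\<dots> = (\<Sum>i. ennreal (\<integral>\<omega>. norm (f i \<omega>) \<partial>M))"
    by (intro arg_cong[where f = suminf] ext nn_integral_eq_integral integrable_norm f) auto
  also have "\<dots> \<noteq> \<infinity>"
    unfolding infinity_ennreal_def by (rule ennreal_suminf_neq_top[OF sum]) simp
  finally have fin: "(\<integral>\<^sup>+\<omega>. (\<Sum>i. ennreal (norm (f i \<omega>))) \<partial>M) \<noteq> \<infinity>" .
  have "AE \<omega> in M. (\<Sum>i. ennreal (norm (f i \<omega>))) \<noteq> \<infinity>"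
    by (rule nn_integral_PInf_AE[OF _ fin]) measurable
  then show ?thesis
  proof eventually_elim
    case (elim \<omega>)
    show ?case
      by (rule summable_suminf_not_top[OF norm_ge_zero]) (use elim in \<open>simp only: infinity_ennreal_def not_False_eq_True\<close>)
  qed
qed

lemma integral_suminf_of_summable:
  fixes f :: "nat \<Rightarrow> 'w \<Rightarrow> 'b::{banach, second_countable_topology}"
  assumes f: "\<And>i. integrable M (f i)" and sum: "summable (\<lambda>i. \<integral>\<omega>. norm (f i \<omega>) \<partial>M)"
  shows "(\<integral>\<omega>. (\<Sum>i. f i \<omega>) \<partial>M) = (\<Sum>i. \<integral>\<omega>. f i \<omega> \<partial>M)"
  by (rule integral_suminf[OF f AE_summable_norm[OF f sum] sum])

lemma borel_measurable_matrix_vector [measurable]: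
  assumes "f \<in> borel_measurable N" "g \<in> borel_measurable N"
  shows "(\<lambda>\<omega>. (f \<omega> :: real ^ 'k ^ 'l) *v (g \<omega> :: real ^ 'k)) \<in> borel_measurable N"
  by (rule borel_measurable_continuous_Pair[OF assms])
     (auto simp: matrix_vector_mult_def intro!: continuous_intros)

lemma measurable_component_continuous:
  assumes "continuous_on UNIV f" "s \<in> I"
  shows "(\<lambda>h. f (h s)) \<in> borel_measurable (\<Pi>\<^sub>M s\<in>I. borel)"
  by (rule measurable_compose[OF measurable_component_singleton[of s I "\<lambda>_. borel"]
      borel_measurable_continuous_onI]) fact+

section \<open>Independence of the state from the next parameters\<close>

context lq_system
begin

definition params where
  "params t \<omega> = (block_row (A t \<omega>) (B t \<omega>), block_diag (Q t \<omega>) (R t \<omega>))"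

lemma params_measurable: "1 \<le> t \<Longrightarrow> params t \<in> borel_measurable M"
  using params_indep by (simp add: indep_vars_def params_def[abs_def])

lemma params_A: "A t \<omega> = left_cols (fst (params t \<omega>))" and params_B: "B t \<omega> = right_cols (fst (params t \<omega>))"
  and params_Q: "Q t \<omega> = upper_block (snd (params t \<omega>))" and params_R: "R t \<omega> = lower_block (snd (params t \<omega>))"
  by (simp_all add: params_def)

lemma params_expectation:
  fixes f :: "_ \<Rightarrow> 'b::{banach, second_countable_topology}"
  assumes t: "1 \<le> t" and f: "f \<in> borel_measurable borel"
  shows "(\<integral>\<omega>. f (params t \<omega>) \<partial>M) = (\<integral>\<omega>. f (params 1 \<omega>) \<partial>M)"
    "integrable M (\<lambda>\<omega>. f (params t \<omega>)) \<longleftrightarrow> integrable M (\<lambda>\<omega>. f (params 1 \<omega>))"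
proof -
  have eq: "distr M borel (params t) = distr M borel (params 1)"
    using params_ident_distr[OF t] by (simp add: params_def[abs_def])
  have m: "params t \<in> M \<rightarrow>\<^sub>M borel" "params 1 \<in> M \<rightarrow>\<^sub>M borel" using params_measurable t by auto
  show "(\<integral>\<omega>. f (params t \<omega>) \<partial>M) = (\<integral>\<omega>. f (params 1 \<omega>) \<partial>M)"
    using integral_distr[OF m(1) f] integral_distr[OF m(2) f] eq by simp
  show "integrable M (\<lambda>\<omega>. f (params t \<omega>)) \<longleftrightarrow> integrable M (\<lambda>\<omega>. f (params 1 \<omega>))"
    using integrable_distr_eq[OF m(1) f] integrable_distr_eq[OF m(2) f] eq by simp
qed

text \<open>The initial state becomes the time \<open>0\<close> member of a single independent family.\<close>

definition history where
  "history t \<omega> = (if t = 0 then (x0 \<omega>, 0) else (0, params t \<omega>))"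

lemma history_measurable: "history t \<in> borel_measurable M"
proof -
  have pair: "(\<lambda>\<omega>. (f \<omega>, g \<omega>)) \<in> borel_measurable M"
    if "f \<in> borel_measurable M" "g \<in> borel_measurable M"
    for f :: "'w \<Rightarrow> real ^ 'n" and g :: "'w \<Rightarrow> (real ^ ('n + 'm) ^ 'n) \<times> (real ^ ('n + 'm) ^ ('n + 'm))"
    using that by (rule borel_measurable_Pair)
  show ?thesis
  proof (cases "t = 0")
    case True
    then show ?thesis using pair[OF init_measurable, of "\<lambda>_. 0"] by (simp add: history_def[abs_def])
  next
    case False
    then show ?thesis using pair[of "\<lambda>_. 0", OF _ params_measurable[of t]] by (simp add: history_def[abs_def])
  qed
qed

text \<open>For finitely many events, the one at time 0 is split off by independence of
  \<open>x0\<close> from the sigma-algebra of the whole parameter sequence; the others factor by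
  independence of the parameters.\<close>

lemma indep_history: "indep_vars (\<lambda>_. borel) history UNIV"
  unfolding indep_vars_def2
proof (intro conjI ballI)
  show "random_variable borel (history t)" for t by (rule history_measurable)
  let ?V = "\<lambda>t. {params t -` S \<inter> space M | S. S \<in> sets borel}"
  let ?rest = "\<lambda>\<omega>. \<lambda>t\<in>{1..}. params t \<omega>"
  let ?\<F> = "sets (vimage_algebra (space M) ?rest (\<Pi>\<^sub>M t\<in>{1..}. borel))"
  have indep: "indep_sets ?V {1..}"
    using params_indep unfolding indep_vars_def2 by (simp add: params_def[abs_def])
  have indep0: "indep_set (sets (vimage_algebra (space M) x0 borel)) ?\<F>"
    using init_indep by (simp add: params_def[abs_def])
  \<comment> \<open>Single-time parameter events lie in the sigma-algebra of the sequence, so their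
    finite intersections do too.\<close>
  have V_F: "X \<in> ?\<F>" if t: "1 \<le> t" and X: "X \<in> ?V t" for t X
  proof -
    from X obtain S where S: "S \<in> sets borel" "X = params t -` S \<inter> space M" by blast
    have "(\<lambda>f. f t) -` S \<inter> space (\<Pi>\<^sub>M t\<in>{1..}. borel) \<in> sets (\<Pi>\<^sub>M t\<in>{1::nat..}. borel)"
      using t by (intro measurable_sets[OF measurable_component_singleton[of t "{1..}" "\<lambda>_. borel"] S(1)]) simp
    from in_vimage_algebra[OF this, of ?rest "space M"]
    have "?rest -` ((\<lambda>f. f t) -` S \<inter> space (\<Pi>\<^sub>M t\<in>{1..}. borel)) \<inter> space M \<in> ?\<F>" .
    also have "?rest -` ((\<lambda>f. f t) -` S \<inter> space (\<Pi>\<^sub>M t\<in>{1..}. borel)) \<inter> space M = X"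
      using t unfolding S(2) by (auto simp: space_PiM)
    finally show ?thesis .
  qed
  show "indep_sets (\<lambda>t. {history t -` S \<inter> space M | S. S \<in> sets borel}) UNIV"
  proof (rule indep_setsI)
    show "{history t -` S \<inter> space M | S. S \<in> sets borel} \<subseteq> events" for t
      using measurable_sets[OF history_measurable] by blast
    fix X :: "nat \<Rightarrow> 'w set" and I :: "nat set"
    assume I: "I \<noteq> {}" "finite I" and X: "\<forall>t\<in>I. X t \<in> {history t -` S \<inter> space M | S. S \<in> sets borel}"
    define I' where "I' = I - {0}"
    have XV: "X t \<in> ?V t" if "t \<in> I'" for t
    proof -
      from X that obtain S where S: "S \<in> sets borel" "X t = history t -` S \<inter> space M"
        unfolding I'_def by blast
      have "Pair 0 \<in> borel_measurable (borel :: ((real ^ ('n + 'm) ^ 'n) \<times> (real ^ ('n + 'm) ^ ('n + 'm))) measure)"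
        by (intro borel_measurable_continuous_onI continuous_intros)
      from measurable_sets[OF this S(1)]
      have "Pair 0 -` S \<in> sets (borel :: ((real ^ ('n + 'm) ^ 'n) \<times> (real ^ ('n + 'm) ^ ('n + 'm))) measure)" by simp
      moreover have "X t = params t -` (Pair 0 -` S) \<inter> space M"
        unfolding S(2) using that by (auto simp: history_def I'_def)
      ultimately show ?thesis by blast
    qed
    have prob': "prob (\<Inter>t\<in>I'. X t) = (\<Prod>t\<in>I'. prob (X t))" if "I' \<noteq> {}"
      using XV I that by (intro indep_setsD[OF indep]) (auto simp: I'_def)
    show "prob (\<Inter>t\<in>I. X t) = (\<Prod>t\<in>I. prob (X t))"
    proof (cases "0 \<in> I")
      case False
      then show ?thesis using prob' I by (simp add: I'_def)
    next
      case True
      then have I_eq: "I = insert 0 I'" and fin: "finite I'" and notin: "0 \<notin> I'" using I by (auto simp: I'_def)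
      show ?thesis
      proof (cases "I' = {}")
        case True
        then show ?thesis by (simp add: I_eq)
      next
        case ne: False
        from X \<open>0 \<in> I\<close> obtain S where S: "S \<in> sets borel" "X 0 = history 0 -` S \<inter> space M" by blast
        have "(\<lambda>x. (x, 0)) \<in> borel_measurable (borel :: (real ^ 'n) measure)"
          by (intro borel_measurable_continuous_onI continuous_intros)
        from measurable_sets[OF this S(1)] have "(\<lambda>x. (x, 0)) -` S \<in> sets (borel :: (real ^ 'n) measure)" by simp
        from in_vimage_algebra[OF this, of x0 "space M"]
        have X0: "X 0 \<in> sets (vimage_algebra (space M) x0 borel)"
          unfolding S(2) by (simp add: history_def vimage_def)
        have "X t \<in> ?\<F>" if "t \<in> I'" for t
          using V_F[OF _ XV[OF that]] that by (simp add: I'_def)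
        then have "(\<Inter>t\<in>I'. X t) \<in> ?\<F>" using ne fin by (intro sets.finite_INT) auto
        from indep_setD[OF indep0 X0 this]
        have "prob (X 0 \<inter> (\<Inter>t\<in>I'. X t)) = prob (X 0) * prob (\<Inter>t\<in>I'. X t)" .
        then show ?thesis using prob'[OF ne] notin fin by (simp add: I_eq)
      qed
    qed
  qed
qed

text \<open>The closed loop as a function of the history alone. The state at time \<open>t\<close>
  then depends on coordinates up to \<open>t\<close> only, which separates it from the parameters at
  time \<open>t + 1\<close>.\<close>

primrec state_of where
  "state_of L 0 h = fst (h 0)"
| "state_of L (Suc t) h = (left_cols (fst (snd (h (Suc t)))) - right_cols (fst (snd (h (Suc t)))) ** L) *v state_of L t h"

lemma closed_loop_state_of:
  "{..t} \<subseteq> I \<Longrightarrow> closed_loop A B L x0 t \<omega> = state_of L t (\<lambda>s\<in>I. history s \<omega>)"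
proof (induction t)
  case 0
  then show ?case by (simp add: history_def)
next
  case (Suc t)
  then have "{..t} \<subseteq> I" "Suc t \<in> I" by auto
  then show ?case using Suc.IH by (simp add: history_def params_def)
qed

lemma state_of_measurable:
  "{..t} \<subseteq> I \<Longrightarrow> state_of L t \<in> borel_measurable (\<Pi>\<^sub>M s\<in>I. borel)"
proof (induction t)
  case 0
  then show ?case unfolding state_of.simps
    by (intro measurable_component_continuous continuous_intros) auto
next
  case (Suc t)
  then have t: "Suc t \<in> I" "{..t} \<subseteq> I" by auto
  note IH = Suc.IH[OF t(2)]
  have "(\<lambda>h. left_cols (fst (snd (h (Suc t)))) - right_cols (fst (snd (h (Suc t)))) ** L)
      \<in> borel_measurable (\<Pi>\<^sub>M s\<in>I. borel)"
    by (rule measurable_component_continuous[OF _ t(1)])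
       (intro continuous_intros bounded_linear.continuous_on[OF bounded_linear_blocks(1)]
        bounded_linear.continuous_on[OF bounded_linear_blocks(2)]
        bounded_bilinear.continuous_on[OF bounded_bilinear_matrix_mult])
  from borel_measurable_matrix_vector[OF this IH] show ?case unfolding state_of.simps .
qed

lemma closed_loop_measurable: "closed_loop A B L x0 t \<in> borel_measurable M"
proof -
  have "(\<lambda>\<omega>. \<lambda>s\<in>{..t}. history s \<omega>) \<in> M \<rightarrow>\<^sub>M (\<Pi>\<^sub>M s\<in>{..t}. borel)"
    by (intro measurable_restrict history_measurable)
  from measurable_compose[OF this state_of_measurable[OF order_refl]] show ?thesis
    by (simp add: closed_loop_state_of[OF order_refl, symmetric])
qed

text \<open>The index sets \<open>{Suc t}\<close> and \<open>{..t}\<close> are disjoint, so the two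
  factors are functions of independent parts of the history; identical distribution moves the
  parameter factor to time 1.\<close>

lemma product_expectation:
  fixes f :: "_ \<Rightarrow> real" and g :: "_ \<Rightarrow> real"
  assumes f: "f \<in> borel_measurable borel" "integrable M (\<lambda>\<omega>. f (params 1 \<omega>))"
    and g: "g \<in> borel_measurable borel" "integrable M (\<lambda>\<omega>. g (closed_loop A B L x0 t \<omega>))"
  shows "integrable M (\<lambda>\<omega>. f (params (Suc t) \<omega>) * g (closed_loop A B L x0 t \<omega>))"
    and "(\<integral>\<omega>. f (params (Suc t) \<omega>) * g (closed_loop A B L x0 t \<omega>) \<partial>M) =
      (\<integral>\<omega>. f (params 1 \<omega>) \<partial>M) * (\<integral>\<omega>. g (closed_loop A B L x0 t \<omega>) \<partial>M)"
proof -
  have "indep_var (\<Pi>\<^sub>M s\<in>{Suc t}. borel) (\<lambda>\<omega>. \<lambda>s\<in>{Suc t}. history s \<omega>)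
      (\<Pi>\<^sub>M s\<in>{..t}. borel) (\<lambda>\<omega>. \<lambda>s\<in>{..t}. history s \<omega>)"
    by (intro indep_var_restrict[OF indep_history]) auto
  moreover have "(\<lambda>h. f (snd (h (Suc t)))) \<in> borel_measurable (\<Pi>\<^sub>M s\<in>{Suc t}. borel)"
    by (rule measurable_compose[OF measurable_component_continuous f(1)])
      (auto intro: continuous_intros)
  moreover have "(\<lambda>h. g (state_of L t h)) \<in> borel_measurable (\<Pi>\<^sub>M s\<in>{..t}. borel)"
    by (rule measurable_compose[OF state_of_measurable[OF order_refl] g(1)])
  ultimately have "indep_var borel ((\<lambda>h. f (snd (h (Suc t)))) \<circ> (\<lambda>\<omega>. \<lambda>s\<in>{Suc t}. history s \<omega>))
      borel ((\<lambda>h. g (state_of L t h)) \<circ> (\<lambda>\<omega>. \<lambda>s\<in>{..t}. history s \<omega>))"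
    by (rule indep_var_compose)
  then have indep: "indep_var borel (\<lambda>\<omega>. f (params (Suc t) \<omega>)) borel (\<lambda>\<omega>. g (closed_loop A B L x0 t \<omega>))"
    unfolding comp_def closed_loop_state_of[OF order_refl, symmetric] by (simp add: history_def)
  have fi: "integrable M (\<lambda>\<omega>. f (params (Suc t) \<omega>))"
    using params_expectation(2)[OF _ f(1), of "Suc t"] f(2) by simp
  show "integrable M (\<lambda>\<omega>. f (params (Suc t) \<omega>) * g (closed_loop A B L x0 t \<omega>))"
    by (rule indep_var_integrable[OF indep fi g(2)])
  show "(\<integral>\<omega>. f (params (Suc t) \<omega>) * g (closed_loop A B L x0 t \<omega>) \<partial>M) =
      (\<integral>\<omega>. f (params 1 \<omega>) \<partial>M) * (\<integral>\<omega>. g (closed_loop A B L x0 t \<omega>) \<partial>M)"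
    using indep_var_lebesgue_integral[OF indep fi g(2)] params_expectation(1)[OF _ f(1), of "Suc t"] by simp
qed

text \<open>The Frobenius inner product is a finite sum of entry products, to each of which the
  scalar factorisation applies.\<close>

lemma matrix_expectation:
  fixes f :: "_ \<Rightarrow> real ^ 'n ^ 'n"
  assumes f: "f \<in> borel_measurable borel" "integrable M (\<lambda>\<omega>. f (params 1 \<omega>))"
    and x: "integrable M (\<lambda>\<omega>. (norm (closed_loop A B L x0 t \<omega>))\<^sup>2)"
  defines "X \<equiv> \<lambda>\<omega>. outer_prod (closed_loop A B L x0 t \<omega>) (closed_loop A B L x0 t \<omega>)"
  shows "integrable M X"
    and "integrable M (\<lambda>\<omega>. f (params (Suc t) \<omega>) \<bullet> X \<omega>)"
    and "(\<integral>\<omega>. f (params (Suc t) \<omega>) \<bullet> X \<omega> \<partial>M) = (\<integral>\<omega>. f (params 1 \<omega>) \<partial>M) \<bullet> (\<integral>\<omega>. X \<omega> \<partial>M)"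
proof -
  have outer: "continuous_on UNIV (\<lambda>x :: real ^ 'n. outer_prod x x)"
    unfolding outer_prod_def by (intro continuous_intros)
  have X_meas: "X \<in> borel_measurable M"
    unfolding X_def
    by (rule measurable_compose[OF closed_loop_measurable borel_measurable_continuous_onI[OF outer]])
  show X: "integrable M X"
    by (rule Bochner_Integration.integrable_bound[OF x X_meas])
       (simp add: X_def norm_outer_prod power2_eq_square)
  let ?f = "\<lambda>i j p. f p $ i $ j" and ?g = "\<lambda>i j (x :: real ^ 'n). outer_prod x x $ i $ j"
  have comp: "bounded_linear (\<lambda>Z :: real ^ 'n ^ 'n. Z $ i $ j)" for i j
    by (intro bounded_linear_compose[OF bounded_linear_vec_nth bounded_linear_vec_nth])
  have comp_meas: "(\<lambda>Z :: real ^ 'n ^ 'n. Z $ i $ j) \<in> borel_measurable borel" for i j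
    by (intro borel_measurable_continuous_onI linear_continuous_on comp)
  have f_meas: "?f i j \<in> borel_measurable borel" for i j
    by (rule measurable_compose[OF f(1) comp_meas])
  have g_meas: "?g i j \<in> borel_measurable borel" for i j
    by (rule measurable_compose[OF borel_measurable_continuous_onI[OF outer] comp_meas])
  have f_int: "integrable M (\<lambda>\<omega>. ?f i j (params 1 \<omega>))" for i j
    by (rule integrable_bounded_linear[OF comp f(2)])
  have g_int: "integrable M (\<lambda>\<omega>. ?g i j (closed_loop A B L x0 t \<omega>))" for i j
    using integrable_bounded_linear[OF comp X] by (simp add: X_def)
  note prod = product_expectation[OF f_meas f_int g_meas g_int]
  have eq: "f (params (Suc t) \<omega>) \<bullet> X \<omega> =
      (\<Sum>i\<in>UNIV. \<Sum>j\<in>UNIV. ?f i j (params (Suc t) \<omega>) * ?g i j (closed_loop A B L x0 t \<omega>))" for \<omega>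
    by (simp add: inner_matrix X_def)
  show "integrable M (\<lambda>\<omega>. f (params (Suc t) \<omega>) \<bullet> X \<omega>)"
    unfolding eq by (intro Bochner_Integration.integrable_sum prod(1))
  have "(\<integral>\<omega>. f (params (Suc t) \<omega>) \<bullet> X \<omega> \<partial>M) =
      (\<Sum>i\<in>UNIV. \<Sum>j\<in>UNIV. (\<integral>\<omega>. ?f i j (params 1 \<omega>) \<partial>M) * (\<integral>\<omega>. ?g i j (closed_loop A B L x0 t \<omega>) \<partial>M))"
    unfolding eq using prod by (simp add: Bochner_Integration.integrable_sum)
  also have "\<dots> = (\<Sum>i\<in>UNIV. \<Sum>j\<in>UNIV. (\<integral>\<omega>. f (params 1 \<omega>) \<partial>M) $ i $ j * (\<integral>\<omega>. X \<omega> \<partial>M) $ i $ j)"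
    using integral_bounded_linear[OF comp f(2)] integral_bounded_linear[OF comp X] by (simp add: X_def)
  finally show "(\<integral>\<omega>. f (params (Suc t) \<omega>) \<bullet> X \<omega> \<partial>M) = (\<integral>\<omega>. f (params 1 \<omega>) \<partial>M) \<bullet> (\<integral>\<omega>. X \<omega> \<partial>M)"
    by (simp add: inner_matrix)
qed

end

text \<open>Bounding every model parameter by one constant \<open>k \<ge> 1\<close> turns all estimates into monomials in \<open>k\<close> and
  \<open>u L = 1 + J L\<close>; \<open>kappa\<close> is such a constant. The factors in the dimensions compare the Frobenius
  norm with the operator norm.\<close>

definition kappa :: "'n itself \<Rightarrow> 'm itself \<Rightarrow> real \<Rightarrow> real \<Rightarrow> real \<Rightarrow> real \<Rightarrow> real \<Rightarrow> real \<Rightarrow> real" where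
  "kappa _ _ a b r sQ sR \<mu> = 1 + (real CARD('n) * real CARD('n))\<^sup>2 * \<bar>a\<bar> + (real CARD('n) * real CARD('m))\<^sup>2 * \<bar>b\<bar>
    + real CARD('m) * real CARD('m) * \<bar>r\<bar> + \<bar>1 / sQ\<bar> + \<bar>1 / sR\<bar> + \<bar>1 / \<mu>\<bar> + \<bar>\<mu>\<bar> + \<bar>sR\<bar>"

lemma kappa_ge:
  defines "k \<equiv> \<lambda>a b r sQ sR \<mu>. kappa TYPE('n) TYPE('m) a b r sQ sR \<mu>"
  shows "1 \<le> k a b r sQ sR \<mu>" "(real CARD('n) * real CARD('n))\<^sup>2 * a \<le> k a b r sQ sR \<mu>"
    "(real CARD('n) * real CARD('m))\<^sup>2 * b \<le> k a b r sQ sR \<mu>"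
    "real CARD('m) * real CARD('m) * r \<le> k a b r sQ sR \<mu>"
    "1 / sQ \<le> k a b r sQ sR \<mu>" "1 / sR \<le> k a b r sQ sR \<mu>" "1 / \<mu> \<le> k a b r sQ sR \<mu>"
    "\<mu> \<le> k a b r sQ sR \<mu>" "sR \<le> k a b r sQ sR \<mu>"
proof -
  define ta tb tr where "ta = (real CARD('n) * real CARD('n))\<^sup>2 * \<bar>a\<bar>"
    and "tb = (real CARD('n) * real CARD('m))\<^sup>2 * \<bar>b\<bar>" and "tr = real CARD('m) * real CARD('m) * \<bar>r\<bar>"
  have k: "k a b r sQ sR \<mu> = 1 + ta + tb + tr + \<bar>1 / sQ\<bar> + \<bar>1 / sR\<bar> + \<bar>1 / \<mu>\<bar> + \<bar>\<mu>\<bar> + \<bar>sR\<bar>"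
    by (simp add: k_def kappa_def ta_def tb_def tr_def)
  have nn: "0 \<le> ta" "0 \<le> tb" "0 \<le> tr" "0 \<le> \<bar>1 / sQ\<bar>" "0 \<le> \<bar>1 / sR\<bar>" "0 \<le> \<bar>1 / \<mu>\<bar>" "0 \<le> \<bar>\<mu>\<bar>" "0 \<le> \<bar>sR\<bar>"
    by (simp_all add: ta_def tb_def tr_def)
  have le: "(real CARD('n) * real CARD('n))\<^sup>2 * a \<le> ta" "(real CARD('n) * real CARD('m))\<^sup>2 * b \<le> tb"
    "real CARD('m) * real CARD('m) * r \<le> tr"
    unfolding ta_def tb_def tr_def by (intro mult_left_mono abs_ge_self; simp)+
  note abs = abs_ge_self[of "1 / sQ"] abs_ge_self[of "1 / sR"] abs_ge_self[of "1 / \<mu>"]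
    abs_ge_self[of \<mu>] abs_ge_self[of sR]
  show "1 \<le> k a b r sQ sR \<mu>" "(real CARD('n) * real CARD('n))\<^sup>2 * a \<le> k a b r sQ sR \<mu>"
    "(real CARD('n) * real CARD('m))\<^sup>2 * b \<le> k a b r sQ sR \<mu>"
    "real CARD('m) * real CARD('m) * r \<le> k a b r sQ sR \<mu>"
    "1 / sQ \<le> k a b r sQ sR \<mu>" "1 / sR \<le> k a b r sQ sR \<mu>" "1 / \<mu> \<le> k a b r sQ sR \<mu>"
    "\<mu> \<le> k a b r sQ sR \<mu>" "sR \<le> k a b r sQ sR \<mu>"
    unfolding k using nn le abs by linarith+
qed

lemma kappa_pos: "0 < kappa TYPE('n) TYPE('m) a b r sQ sR \<mu>"
  using kappa_ge(1)[where 'n = 'n and 'm = 'm] by (rule less_le_trans[OF zero_less_one])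

lemma borel_measurable_op_norm [measurable]:
  "f \<in> borel_measurable M \<Longrightarrow> (\<lambda>\<omega>. op_norm (f \<omega> :: real ^ 'n ^ 'm)) \<in> borel_measurable M"
  by (rule borel_measurable_continuous_on[OF continuous_on_op_norm])

lemma second_moment_le_op_norm:
  fixes f :: "'w \<Rightarrow> real ^ 'n ^ 'm"
  assumes f: "sq_integrable M f"
  shows "second_moment M f \<le> (real CARD('m) * real CARD('n))\<^sup>2 * (\<integral>\<omega>. (op_norm (f \<omega>))\<^sup>2 \<partial>M)"
proof -
  have [measurable]: "f \<in> borel_measurable M" and int: "integrable M (\<lambda>\<omega>. (norm (f \<omega>))\<^sup>2)"
    using f by (auto simp: sq_integrable_def)
  have "integrable M (\<lambda>\<omega>. (op_norm (f \<omega>))\<^sup>2)"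
    by (rule Bochner_Integration.integrable_bound[OF int])
       (auto intro!: AE_I2 power_mono op_norm_le_norm op_norm_nonneg)
  then have int': "integrable M (\<lambda>\<omega>. (real CARD('m) * real CARD('n))\<^sup>2 * (op_norm (f \<omega>))\<^sup>2)" by simp
  have "second_moment M f \<le> (\<integral>\<omega>. (real CARD('m) * real CARD('n))\<^sup>2 * (op_norm (f \<omega>))\<^sup>2 \<partial>M)"
    unfolding second_moment_def
  proof (rule integral_mono[OF int int'])
    fix \<omega>
    show "(norm (f \<omega>))\<^sup>2 \<le> (real CARD('m) * real CARD('n))\<^sup>2 * (op_norm (f \<omega>))\<^sup>2"
      using power_mono[OF norm_le_op_norm[of "f \<omega>"], of 2] by (simp add: power_mult_distrib)
  qed
  then show ?thesis by simp
qed

lemma sq_integrable_bound: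
  assumes int: "integrable M (\<lambda>\<omega>. (g \<omega>)\<^sup>2)" and f: "f \<in> borel_measurable M"
    and le: "\<And>\<omega>. norm (f \<omega>) \<le> c * g \<omega>"
  shows "sq_integrable M f"
proof -
  have "integrable M (\<lambda>\<omega>. (norm (f \<omega>))\<^sup>2)"
  proof (rule Bochner_Integration.integrable_bound)
    show "integrable M (\<lambda>\<omega>. c\<^sup>2 * (g \<omega>)\<^sup>2)" using int by simp
    show "(\<lambda>\<omega>. (norm (f \<omega>))\<^sup>2) \<in> borel_measurable M" using f by simp
    have "(norm (f \<omega>))\<^sup>2 \<le> (c * g \<omega>)\<^sup>2" for \<omega> by (rule power_mono[OF le norm_ge_zero])
    then show "AE \<omega> in M. norm ((norm (f \<omega>))\<^sup>2) \<le> norm (c\<^sup>2 * (g \<omega>)\<^sup>2)"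
      by (simp add: power_mult_distrib)
  qed
  then show ?thesis using f by (simp add: sq_integrable_def)
qed

lemma sq_integrable_bounded_linear:
  assumes T: "bounded_linear T" and f: "sq_integrable M f"
  shows "sq_integrable M (\<lambda>\<omega>. T (f \<omega>))"
proof -
  obtain c where c: "\<And>x. norm (T x) \<le> norm x * c" using bounded_linear.bounded[OF T] by blast
  show ?thesis
  proof (rule sq_integrable_bound)
    show "integrable M (\<lambda>\<omega>. (norm (f \<omega>))\<^sup>2)" using f by (simp add: sq_integrable_def)
    show "(\<lambda>\<omega>. T (f \<omega>)) \<in> borel_measurable M"
      using f by (intro borel_measurable_continuous_on[OF linear_continuous_on[OF T]]) (simp add: sq_integrable_def)
    show "norm (T (f \<omega>)) \<le> c * norm (f \<omega>)" for \<omega> using c[of "f \<omega>"] by (simp only: mult.commute)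
  qed
qed

section \<open>Reduction of the random problem to its moments\<close>

context lq_problem
begin

lemma block_row_sq_integrable: "sq_integrable M (\<lambda>\<omega>. fst (params 1 \<omega>))"
proof (rule sq_integrable_bound)
  show "integrable M (\<lambda>\<omega>. (op_norm (fst (params 1 \<omega>)))\<^sup>2)"
    using params_second_moment by (simp add: params_def)
  show "(\<lambda>\<omega>. fst (params 1 \<omega>)) \<in> borel_measurable M"
    by (rule borel_measurable_continuous_on[OF _ params_measurable]) (auto intro: continuous_intros)
  show "norm (fst (params 1 \<omega>)) \<le> real CARD('n) * real CARD('n + 'm) * op_norm (fst (params 1 \<omega>))" for \<omega>
    by (rule norm_le_op_norm)
qed

lemma A_sq_integrable: "sq_integrable M (A 1)" and B_sq_integrable: "sq_integrable M (B 1)"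
  using sq_integrable_bounded_linear[OF bounded_linear_blocks(1) block_row_sq_integrable]
    sq_integrable_bounded_linear[OF bounded_linear_blocks(2) block_row_sq_integrable]
  unfolding params_A[symmetric] params_B[symmetric] by auto

lemma weights_integrable': "integrable M (\<lambda>\<omega>. snd (params 1 \<omega>))"
proof (rule Bochner_Integration.integrable_bound)
  show "integrable M (\<lambda>\<omega>. real CARD('n + 'm) * real CARD('n + 'm) * op_norm (snd (params 1 \<omega>)))"
    using weights_integrable by (simp add: params_def)
  show "(\<lambda>\<omega>. snd (params 1 \<omega>)) \<in> borel_measurable M"
    by (rule borel_measurable_continuous_on[OF _ params_measurable]) (auto intro: continuous_intros)
  show "AE \<omega> in M. norm (snd (params 1 \<omega>))
      \<le> norm (real CARD('n + 'm) * real CARD('n + 'm) * op_norm (snd (params 1 \<omega>)))"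
    unfolding real_norm_def by (intro AE_I2 order_trans[OF norm_le_op_norm abs_ge_self])
qed

lemma Q_integrable: "integrable M (Q 1)" and R_integrable: "integrable M (R 1)"
  using integrable_bounded_linear[OF bounded_linear_blocks(3) weights_integrable']
    integrable_bounded_linear[OF bounded_linear_blocks(4) weights_integrable']
  unfolding params_Q[symmetric] params_R[symmetric] by auto

lemma Q_pos_def: "pos_def (\<integral>\<omega>. Q 1 \<omega> \<partial>M)" and R_pos_def: "pos_def (\<integral>\<omega>. R 1 \<omega> \<partial>M)"
  using pos_def_blocks[OF weights_pos_def]
    integral_bounded_linear[OF bounded_linear_blocks(3) weights_integrable']
    integral_bounded_linear[OF bounded_linear_blocks(4) weights_integrable']
  unfolding params_Q[symmetric] params_R[symmetric] by (auto simp: params_def)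

abbreviation "sigma_Q \<equiv> sigma_min (\<integral>\<omega>. Q 1 \<omega> \<partial>M)"
abbreviation "sigma_R \<equiv> sigma_min (\<integral>\<omega>. R 1 \<omega> \<partial>M)"
abbreviation "mu0 \<equiv> sigma_min (Sigma0 M x0)"
abbreviation "kappa0 \<equiv> kappa TYPE('n) TYPE('m) (\<integral>\<omega>. (op_norm (A 1 \<omega>))\<^sup>2 \<partial>M) (\<integral>\<omega>. (op_norm (B 1 \<omega>))\<^sup>2 \<partial>M)
  (\<integral>\<omega>. op_norm (R 1 \<omega>) \<partial>M) sigma_Q sigma_R mu0"

lemma norm_mean_R_le: "norm (\<integral>\<omega>. R 1 \<omega> \<partial>M) \<le> real CARD('m) * real CARD('m) * (\<integral>\<omega>. op_norm (R 1 \<omega>) \<partial>M)"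
proof -
  have "integrable M (\<lambda>\<omega>. op_norm (R 1 \<omega>))"
  proof (rule Bochner_Integration.integrable_bound[OF integrable_norm[OF R_integrable]])
    show "(\<lambda>\<omega>. op_norm (R 1 \<omega>)) \<in> borel_measurable M"
      by (rule borel_measurable_op_norm[OF borel_measurable_integrable[OF R_integrable]])
    show "AE \<omega> in M. norm (op_norm (R 1 \<omega>)) \<le> norm (norm (R 1 \<omega>))"
      by (intro AE_I2) (simp add: op_norm_le_norm op_norm_nonneg)
  qed
  then have int: "integrable M (\<lambda>\<omega>. real CARD('m) * real CARD('m) * op_norm (R 1 \<omega>))"
    by (rule integrable_mult_right)
  have "norm (\<integral>\<omega>. R 1 \<omega> \<partial>M) \<le> (\<integral>\<omega>. real CARD('m) * real CARD('m) * op_norm (R 1 \<omega>) \<partial>M)"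
    by (rule order_trans[OF integral_norm_bound integral_mono[OF integrable_norm[OF R_integrable] int norm_le_op_norm]])
  then show ?thesis by (simp only: integral_mult_right_zero)
qed

sublocale mean: lq_bounded M "A 1" "B 1" "\<integral>\<omega>. Q 1 \<omega> \<partial>M" "\<integral>\<omega>. R 1 \<omega> \<partial>M" "Sigma0 M x0"
  sigma_Q sigma_R mu0 kappa0
proof
  show "sq_integrable M (A 1)" "sq_integrable M (B 1)"
    by (rule A_sq_integrable B_sq_integrable)+
  show "0 < sigma_Q" "pos_semidef ((\<integral>\<omega>. Q 1 \<omega> \<partial>M) - sigma_Q *\<^sub>R mat 1)"
    "0 < sigma_R" "pos_semidef ((\<integral>\<omega>. R 1 \<omega> \<partial>M) - sigma_R *\<^sub>R mat 1)"
    "0 < mu0" "pos_semidef (Sigma0 M x0 - mu0 *\<^sub>R mat 1)"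
    by (rule pos_def_sigma_min Q_pos_def R_pos_def Sigma0_pos_def)+
  show "second_moment M (A 1) \<le> kappa0"
    by (rule order_trans[OF second_moment_le_op_norm[OF A_sq_integrable] kappa_ge(2)])
  show "second_moment M (B 1) \<le> kappa0"
    by (rule order_trans[OF second_moment_le_op_norm[OF B_sq_integrable] kappa_ge(3)])
  show "norm (\<integral>\<omega>. R 1 \<omega> \<partial>M) \<le> kappa0"
    by (rule order_trans[OF norm_mean_R_le kappa_ge(4)])
  show "1 \<le> kappa0" "1 / sigma_Q \<le> kappa0" "1 / sigma_R \<le> kappa0" "1 / mu0 \<le> kappa0" "mu0 \<le> kappa0" "sigma_R \<le> kappa0"
    by (rule kappa_ge)+
qed

lemma F_op_eq: "F_op M A B L = mean.F L"
  by (rule ext) (simp only: F_op_def mean.F_def mean.cl_def)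

lemma U_ad_eq: "U_ad M A B = mean.U"
  unfolding U_ad_def mean.U_def F_op_eq spectral_radius_less_1_iff[OF mean.F_pos] ..

abbreviation "state \<equiv> closed_loop A B"

text \<open>The recursion is tested against arbitrary \<open>Y\<close>: the random congruence moves
  to \<open>Y\<close>, where independence replaces it by its mean \<open>mean.F' L Y\<close>, and
  adjointness moves it back to the second moment.\<close>

lemma closed_loop_moments:
  "integrable M (\<lambda>\<omega>. (norm (state L x0 t \<omega>))\<^sup>2) \<and>
   (\<integral>\<omega>. outer_prod (state L x0 t \<omega>) (state L x0 t \<omega>) \<partial>M) = (mean.F L ^^ t) (Sigma0 M x0)"
proof (induction t)
  case 0
  then show ?case using init_second_moment by (simp add: Sigma0_def)
next
  case (Suc t)
  define c where "c p = left_cols (fst p) - right_cols (fst p) ** L"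
    for p :: "(real ^ ('n + 'm) ^ 'n) \<times> (real ^ ('n + 'm) ^ ('n + 'm))"
  have c_cl: "c (params 1 \<omega>) = mean.cl L \<omega>" for \<omega> by (simp add: c_def mean.cl_def params_def del: One_nat_def)
  have c_Suc: "c (params (Suc t) \<omega>) = A (Suc t) \<omega> - B (Suc t) \<omega> ** L" for \<omega> by (simp add: c_def params_def)
  have "continuous_on UNIV c"
    unfolding c_def
    by (intro continuous_intros bounded_linear.continuous_on[OF bounded_linear_blocks(1)]
        bounded_linear.continuous_on[OF bounded_linear_blocks(2)]
        bounded_bilinear.continuous_on[OF bounded_bilinear_matrix_mult])
  then have [measurable]: "c \<in> borel_measurable borel" by (rule borel_measurable_continuous_onI)
  let ?x = "state L x0 t" and ?y = "state L x0 (Suc t)"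
  have x: "integrable M (\<lambda>\<omega>. (norm (?x \<omega>))\<^sup>2)" using Suc by blast
  have y: "?y \<omega> = c (params (Suc t) \<omega>) *v ?x \<omega>" for \<omega> by (simp add: c_Suc)
  have [measurable]: "state L x0 t \<in> borel_measurable M" for t by (rule closed_loop_measurable)
  \<comment> \<open>The product of the independent factors \<open>norm c ^ 2\<close> and
    \<open>norm x ^ 2\<close> is an integrable majorant of the next squared state.\<close>
  have "integrable M (\<lambda>\<omega>. (norm (c (params (Suc t) \<omega>)))\<^sup>2 * (norm (?x \<omega>))\<^sup>2)"
  proof (rule product_expectation(1)[where f = "\<lambda>p. (norm (c p))\<^sup>2" and g = "\<lambda>x. (norm x)\<^sup>2"])
    show "integrable M (\<lambda>\<omega>. (norm (c (params 1 \<omega>)))\<^sup>2)"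
      unfolding c_cl using mean.cl[of L] by (simp add: sq_integrable_def)
    show "integrable M (\<lambda>\<omega>. (norm (?x \<omega>))\<^sup>2)" by (rule x)
  qed measurable
  then have int: "integrable M (\<lambda>\<omega>. (norm (?y \<omega>))\<^sup>2)"
  proof (rule Bochner_Integration.integrable_bound)
    show "(\<lambda>\<omega>. (norm (?y \<omega>))\<^sup>2) \<in> borel_measurable M" by measurable
    show "AE \<omega> in M. norm ((norm (?y \<omega>))\<^sup>2) \<le> norm ((norm (c (params (Suc t) \<omega>)))\<^sup>2 * (norm (?x \<omega>))\<^sup>2)"
      unfolding y using power_mono[OF norm_matrix_vector_le norm_ge_zero, of _ _ 2]
      by (auto simp: power_mult_distrib)
  qed
  have "Y \<bullet> (\<integral>\<omega>. outer_prod (?y \<omega>) (?y \<omega>) \<partial>M) = Y \<bullet> (mean.F L ^^ Suc t) (Sigma0 M x0)" for Y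
  proof -
    let ?f = "\<lambda>p. transpose (c p) ** Y ** c p"
    have f: "?f \<in> borel_measurable borel" by measurable
    have fi: "integrable M (\<lambda>\<omega>. ?f (params 1 \<omega>))" unfolding c_cl by (rule mean.F'_integrable)
    have "Y \<bullet> (\<integral>\<omega>. outer_prod (?y \<omega>) (?y \<omega>) \<partial>M) = (\<integral>\<omega>. Y \<bullet> outer_prod (?y \<omega>) (?y \<omega>) \<partial>M)"
    proof -
      have "integrable M (\<lambda>\<omega>. outer_prod (?y \<omega>) (?y \<omega>))"
        \<comment> \<open>The first conclusion concerns the state alone, so the zero weight is a
          convenient instance.\<close>
        by (rule matrix_expectation(1)[where f = "\<lambda>_. 0"]) (use int in auto)
      then show ?thesis by simp
    qed
    also have "\<dots> = (\<integral>\<omega>. ?f (params (Suc t) \<omega>) \<bullet> outer_prod (?x \<omega>) (?x \<omega>) \<partial>M)"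
      unfolding y outer_prod_matrix_vector
      by (simp add: inner_mult_right[of _ "c _"] inner_mult_left[of _ Y] matrix_mul_assoc)
    also have "\<dots> = (\<integral>\<omega>. ?f (params 1 \<omega>) \<partial>M) \<bullet> (\<integral>\<omega>. outer_prod (?x \<omega>) (?x \<omega>) \<partial>M)"
      by (rule matrix_expectation(3)[OF f fi x])
    also have "(\<integral>\<omega>. ?f (params 1 \<omega>) \<partial>M) = mean.F' L Y" unfolding c_cl mean.F'_def ..
    also have "mean.F' L Y \<bullet> (\<integral>\<omega>. outer_prod (?x \<omega>) (?x \<omega>) \<partial>M) = Y \<bullet> (mean.F L ^^ Suc t) (Sigma0 M x0)"
      using Suc by (simp add: mean.F_adjoint del: One_nat_def)
    finally show ?thesis .
  qed
  then have "(\<integral>\<omega>. outer_prod (?y \<omega>) (?y \<omega>) \<partial>M) = (mean.F L ^^ Suc t) (Sigma0 M x0)"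
    by - (rule vector_eq_ldot[THEN iffD1], rule allI)
  with int show ?case by (rule conjI)
qed

lemma outer_integrable: "integrable M (\<lambda>\<omega>. outer_prod (state L x0 t \<omega>) (state L x0 t \<omega>))"
  by (rule matrix_expectation(1)[where f = "\<lambda>_. 0"]) (use closed_loop_moments in auto)

lemma moments_summable:
  assumes "L \<in> mean.U"
  shows "summable (\<lambda>t. norm ((mean.F L ^^ t) (Sigma0 M x0)))"
  using assms mean.S0_psd unfolding mean.U_def
  by (intro stable_operator_summable mean.F_pos) (auto dest: pos_semidef_sym)

lemma Sigma_L_eq:
  assumes L: "L \<in> mean.U"
  shows "Sigma_L M A B x0 L = mean.\<Sigma> L"
proof -
  let ?X = "\<lambda>t \<omega>. outer_prod (state L x0 t \<omega>) (state L x0 t \<omega>)"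
  have "(\<integral>\<omega>. norm (?X t \<omega>) \<partial>M) = mat 1 \<bullet> (mean.F L ^^ t) (Sigma0 M x0)" for t
  proof -
    \<comment> \<open>For a rank-one matrix \<open>outer_prod x x\<close> norm and trace agree, so
      the expected norm is the trace of the expected matrix.\<close>
    have "norm (?X t \<omega>) = mat 1 \<bullet> ?X t \<omega>" for \<omega>
      by (simp add: norm_outer_prod inner_outer_prod power2_eq_square flip: power2_norm_eq_inner)
    then show ?thesis using outer_integrable closed_loop_moments by simp
  qed
  moreover have "summable (\<lambda>t. mat 1 \<bullet> (mean.F L ^^ t) (Sigma0 M x0))"
    by (intro summable_norm_cancel[OF moments_summable[OF L]] bounded_linear.summable[OF bounded_linear_inner_right])
  ultimately have "summable (\<lambda>t. \<integral>\<omega>. norm (?X t \<omega>) \<partial>M)" by simp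
  from integral_suminf_of_summable[OF outer_integrable this] show ?thesis
    using closed_loop_moments by (simp add: Sigma_L_def mean.\<Sigma>_def resolvent_def del: One_nat_def)
qed

lemma stage_cost_psd:
  assumes "1 \<le> t"
  shows "AE \<omega> in M. pos_semidef (Q t \<omega> + transpose L ** R t \<omega> ** L)"
  using weights_psd[OF assms]
proof eventually_elim
  case (elim \<omega>)
  then have "pos_semidef (Q t \<omega>)" "pos_semidef (R t \<omega>)" using pos_semidef_blocks[OF elim] by auto
  then show ?case by (intro pos_semidef_add pos_semidef_congruence')
qed

text \<open>Stage costs are nonnegative almost surely, so their expected absolute values are the
  terms \<open>K L \<bullet> (F L ^^ t) \<Sigma>0\<close> of a convergent series, and expectation
  and sum may be exchanged.\<close>

lemma cost_eq:
  assumes L: "L \<in> mean.U"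
  shows "cost M A B Q R x0 L = mean.J L"
proof -
  define q where "q p = upper_block (snd p) + transpose L ** lower_block (snd p) ** L"
    for p :: "(real ^ ('n + 'm) ^ 'n) \<times> (real ^ ('n + 'm) ^ ('n + 'm))"
  have q_params: "q (params t \<omega>) = Q t \<omega> + transpose L ** R t \<omega> ** L" for t \<omega>
    by (simp add: q_def params_def)
  have "continuous_on UNIV q"
    unfolding q_def
    by (intro continuous_intros bounded_linear.continuous_on[OF bounded_linear_blocks(3)]
        bounded_linear.continuous_on[OF bounded_linear_blocks(4)]
        bounded_bilinear.continuous_on[OF bounded_bilinear_matrix_mult])
  then have q: "q \<in> borel_measurable borel" by (rule borel_measurable_continuous_onI)
  have LRL: "integrable M (\<lambda>\<omega>. transpose L ** R 1 \<omega> ** L)"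
    by (intro integral_matrix_mult_left integral_matrix_mult_right R_integrable)
  have qi: "integrable M (\<lambda>\<omega>. q (params 1 \<omega>))"
    unfolding q_params by (intro Bochner_Integration.integrable_add Q_integrable LRL)
  have q_mean: "(\<integral>\<omega>. q (params 1 \<omega>) \<partial>M) = mean.K L"
    unfolding q_params mean.K_def using Q_integrable R_integrable LRL
    by (simp add: integral_matrix_mult_left integral_matrix_mult_right)
  let ?x = "state L x0"
  let ?c = "\<lambda>t \<omega>. q (params (Suc t) \<omega>) \<bullet> outer_prod (?x t \<omega>) (?x t \<omega>)"
  have x: "integrable M (\<lambda>\<omega>. (norm (?x t \<omega>))\<^sup>2)" for t using closed_loop_moments by blast
  have ci: "integrable M (?c t)" for t by (rule matrix_expectation(2)[OF q qi x])
  have c_mean: "(\<integral>\<omega>. ?c t \<omega> \<partial>M) = mean.K L \<bullet> (mean.F L ^^ t) (Sigma0 M x0)" for t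
    using matrix_expectation(3)[OF q qi x] closed_loop_moments by (simp add: q_mean del: One_nat_def)
  have "(\<integral>\<omega>. norm (?c t \<omega>) \<partial>M) = mean.K L \<bullet> (mean.F L ^^ t) (Sigma0 M x0)" for t
    unfolding c_mean[symmetric]
  proof (rule integral_cong_AE)
    show "(\<lambda>\<omega>. norm (?c t \<omega>)) \<in> borel_measurable M" "?c t \<in> borel_measurable M" using ci[of t] by auto
    have "AE \<omega> in M. pos_semidef (q (params (Suc t) \<omega>))" unfolding q_params by (rule stage_cost_psd) simp
    then show "AE \<omega> in M. norm (?c t \<omega>) = ?c t \<omega>"
      by eventually_elim (simp add: inner_pos_semidef_nonneg)
  qed
  moreover have K_sum: "summable (\<lambda>t. mean.K L \<bullet> (mean.F L ^^ t) (Sigma0 M x0))"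
    by (intro summable_norm_cancel[OF moments_summable[OF L]] bounded_linear.summable[OF bounded_linear_inner_right])
  ultimately have "summable (\<lambda>t. \<integral>\<omega>. norm (?c t \<omega>) \<partial>M)" by simp
  from integral_suminf_of_summable[OF ci this]
  have "cost M A B Q R x0 L = (\<Sum>t. mean.K L \<bullet> (mean.F L ^^ t) (Sigma0 M x0))"
    unfolding cost_def c_mean by (simp add: q_params inner_outer_prod)
  also have "\<dots> = mean.J L"
    unfolding mean.J_def mean.\<Sigma>_def resolvent_def
    by (intro bounded_linear.suminf[OF bounded_linear_inner_right, symmetric]
        summable_norm_cancel[OF moments_summable[OF L]])
  finally show ?thesis .
qed

lemma policy_gradient_convergence:
  fixes L0 :: "real ^ 'n ^ 'm" and \<eta> :: real
  assumes L0: "L0 \<in> U_ad M A B" and \<eta>: "0 < \<eta>"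
    "\<eta> \<le> 1 / (680 * kappa0 ^ 10) * (1 + cost M A B Q R x0 L0) powi (- 5)"
  defines "C \<equiv> cost M A B Q R x0"
  defines "Lopt \<equiv> arg_min_on C (U_ad M A B)"
  defines "S \<equiv> op_norm (Sigma_L M A B x0 Lopt)"
  defines "L \<equiv> policy_gradient C \<eta> L0"
  shows "is_arg_min C (\<lambda>K. K \<in> U_ad M A B) Lopt"
    and "L k \<in> U_ad M A B \<and> C differentiable (at (L k))"
    and "L \<longlonglongrightarrow> Lopt"
    and "C (L (Suc k)) - C Lopt \<le> (1 - 2 * \<eta> * (mu0\<^sup>2 * sigma_R / S)) * (C (L k) - C Lopt)"
    and "0 < e \<Longrightarrow> S / (2 * \<eta> * mu0\<^sup>2 * sigma_R) * ln ((C L0 - C Lopt) / e) \<le> real k \<Longrightarrow>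
      \<not> (k = 0 \<and> C L0 - C Lopt = e) \<Longrightarrow> C (L k) - C Lopt < e"
proof -
  have C: "C L = mean.J L" if "L \<in> mean.U" for L unfolding C_def by (rule cost_eq[OF that])
  have L0U: "L0 \<in> mean.U" using L0 by (simp add: U_ad_eq)
  have "0 < 680 * kappa0 ^ 10 * (1 + C L0) ^ 5"
    unfolding C[OF L0U] using kappa_pos[where 'n = 'n and 'm = 'm] mean.J_nonneg[OF L0U]
    by (intro mult_pos_pos zero_less_power) auto
  moreover have "\<eta> \<le> 1 / (680 * kappa0 ^ 10 * (1 + C L0) ^ 5)"
    using \<eta>(2) by (simp add: C_def power_int_minus field_simps)
  ultimately have step: "680 * kappa0 ^ 10 * (1 + C L0) ^ 5 * \<eta> \<le> 1"
    by (simp only: pos_le_divide_eq mult.commute)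
  note gd = mean.gradient_descent[OF C L0U \<eta>(1) step]
  have min: "is_arg_min C (\<lambda>K. K \<in> U_ad M A B) Lopt"
    unfolding Lopt_def U_ad_eq by (rule gd(1))
  then show "is_arg_min C (\<lambda>K. K \<in> U_ad M A B) Lopt" .
  have "Lopt \<in> mean.U" using min by (simp add: is_arg_min_def U_ad_eq)
  then have S: "S = op_norm (mean.\<Sigma> (arg_min_on C mean.U))"
    unfolding S_def by (simp only: Sigma_L_eq) (simp only: Lopt_def U_ad_eq)
  show "L k \<in> U_ad M A B \<and> C differentiable (at (L k))"
    unfolding L_def U_ad_eq by (rule gd(2))
  show "L \<longlonglongrightarrow> Lopt" unfolding L_def Lopt_def U_ad_eq by (rule gd(3))
  show "C (L (Suc k)) - C Lopt \<le> (1 - 2 * \<eta> * (mu0\<^sup>2 * sigma_R / S)) * (C (L k) - C Lopt)"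
    unfolding L_def S Lopt_def U_ad_eq by (rule gd(4))
  show "C (L k) - C Lopt < e" if "0 < e"
    "S / (2 * \<eta> * mu0\<^sup>2 * sigma_R) * ln ((C L0 - C Lopt) / e) \<le> real k"
    "\<not> (k = 0 \<and> C L0 - C Lopt = e)"
    using gd(5)[of e k] that unfolding L_def S Lopt_def U_ad_eq by blast
qed

end

theorem theorem1:
  shows "\<exists>c :: real \<Rightarrow> real \<Rightarrow> real \<Rightarrow> real \<Rightarrow> real \<Rightarrow> real \<Rightarrow> real \<Rightarrow> real.
    (\<forall>a b q r \<sigma>Q \<sigma>R \<mu>. 0 < c a b q r \<sigma>Q \<sigma>R \<mu>) \<and>
    (\<forall>(M :: 'w measure)
       (A :: nat \<Rightarrow> 'w \<Rightarrow> real ^ 'n ^ 'n) (B :: nat \<Rightarrow> 'w \<Rightarrow> real ^ 'm ^ 'n)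
       (Q :: nat \<Rightarrow> 'w \<Rightarrow> real ^ 'n ^ 'n) (R :: nat \<Rightarrow> 'w \<Rightarrow> real ^ 'm ^ 'm)
       (x0 :: 'w \<Rightarrow> real ^ 'n) (L0 :: real ^ 'n ^ 'm) (\<eta> :: real).
      lq_problem M A B Q R x0 \<longrightarrow> L0 \<in> U_ad M A B \<longrightarrow>
      (let C = cost M A B Q R x0;
           Lopt = arg_min_on C (U_ad M A B);
           \<mu> = sigma_min (Sigma0 M x0);
           \<sigma>R = sigma_min (\<integral>\<omega>. R 1 \<omega> \<partial>M);
           S = op_norm (Sigma_L M A B x0 Lopt);
           \<eta>max = c (\<integral>\<omega>. (op_norm (A 1 \<omega>))\<^sup>2 \<partial>M) (\<integral>\<omega>. (op_norm (B 1 \<omega>))\<^sup>2 \<partial>M)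
                    (\<integral>\<omega>. op_norm (Q 1 \<omega>) \<partial>M) (\<integral>\<omega>. op_norm (R 1 \<omega>) \<partial>M)
                    (sigma_min (\<integral>\<omega>. Q 1 \<omega> \<partial>M)) \<sigma>R \<mu>
                  * (1 + C L0) powi (- 5);
           L = policy_gradient C \<eta> L0
       in 0 < \<eta> \<longrightarrow> \<eta> \<le> \<eta>max \<longrightarrow>
            is_arg_min C (\<lambda>K. K \<in> U_ad M A B) Lopt \<and>
            (\<forall>k. L k \<in> U_ad M A B \<and> C differentiable (at (L k))) \<and>
            L \<longlonglongrightarrow> Lopt \<and>
            (\<forall>k. C (L (Suc k)) - C Lopt \<le>
                   (1 - 2 * \<eta> * (\<mu>\<^sup>2 * \<sigma>R / S)) * (C (L k) - C Lopt)) \<and>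
            (\<forall>\<epsilon>>0. \<forall>k.
               real k \<ge> S / (2 * \<eta> * \<mu>\<^sup>2 * \<sigma>R) * ln ((C L0 - C Lopt) / \<epsilon>) \<longrightarrow>
               \<not> (k = 0 \<and> C L0 - C Lopt = \<epsilon>) \<longrightarrow>
               C (L k) - C Lopt < \<epsilon>)))"
\<comment> \<open>The witness is fixed before the probability space, so it is uniform over all
  problems of the given dimensions, which enter through the type arguments of
  \<open>kappa\<close>.\<close>
proof (intro exI[of _ "\<lambda>a b q r sQ sR \<mu>. 1 / (680 * kappa TYPE('n) TYPE('m) a b r sQ sR \<mu> ^ 10)"]
    conjI allI impI)
  show "0 < 1 / (680 * kappa TYPE('n) TYPE('m) a b r sQ sR \<mu> ^ 10)" for a b r sQ sR \<mu>
    using kappa_pos[where 'n = 'n and 'm = 'm, of a b r sQ sR \<mu>] by simp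
next
  fix M :: "'w measure" and A :: "nat \<Rightarrow> 'w \<Rightarrow> real ^ 'n ^ 'n" and B :: "nat \<Rightarrow> 'w \<Rightarrow> real ^ 'm ^ 'n"
    and Q :: "nat \<Rightarrow> 'w \<Rightarrow> real ^ 'n ^ 'n" and R :: "nat \<Rightarrow> 'w \<Rightarrow> real ^ 'm ^ 'm"
    and x0 :: "'w \<Rightarrow> real ^ 'n" and L0 :: "real ^ 'n ^ 'm" and \<eta> :: real
  assume lq: "lq_problem M A B Q R x0" and L0: "L0 \<in> U_ad M A B"
  note conv = lq_problem.policy_gradient_convergence[OF lq L0]
  show "let C = cost M A B Q R x0;
           Lopt = arg_min_on C (U_ad M A B);
           \<mu> = sigma_min (Sigma0 M x0);
           \<sigma>R = sigma_min (\<integral>\<omega>. R 1 \<omega> \<partial>M);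
           S = op_norm (Sigma_L M A B x0 Lopt);
           \<eta>max = 1 / (680 * kappa TYPE('n) TYPE('m) (\<integral>\<omega>. (op_norm (A 1 \<omega>))\<^sup>2 \<partial>M)
                    (\<integral>\<omega>. (op_norm (B 1 \<omega>))\<^sup>2 \<partial>M) (\<integral>\<omega>. op_norm (R 1 \<omega>) \<partial>M)
                    (sigma_min (\<integral>\<omega>. Q 1 \<omega> \<partial>M)) \<sigma>R \<mu> ^ 10)
                  * (1 + C L0) powi (- 5);
           L = policy_gradient C \<eta> L0
       in 0 < \<eta> \<longrightarrow> \<eta> \<le> \<eta>max \<longrightarrow>
            is_arg_min C (\<lambda>K. K \<in> U_ad M A B) Lopt \<and>
            (\<forall>k. L k \<in> U_ad M A B \<and> C differentiable (at (L k))) \<and>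
            L \<longlonglongrightarrow> Lopt \<and>
            (\<forall>k. C (L (Suc k)) - C Lopt \<le>
                   (1 - 2 * \<eta> * (\<mu>\<^sup>2 * \<sigma>R / S)) * (C (L k) - C Lopt)) \<and>
            (\<forall>\<epsilon>>0. \<forall>k.
               real k \<ge> S / (2 * \<eta> * \<mu>\<^sup>2 * \<sigma>R) * ln ((C L0 - C Lopt) / \<epsilon>) \<longrightarrow>
               \<not> (k = 0 \<and> C L0 - C Lopt = \<epsilon>) \<longrightarrow>
               C (L k) - C Lopt < \<epsilon>)"
    unfolding Let_def
    by (intro impI conjI[OF conv(1)] conjI[OF allI[OF conv(2)]] conjI[OF conv(3)]
        conjI[OF allI[OF conv(4)]] allI conv(5))
qed

end
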